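(* Let $\Pi$ be the preprojective algebra of type $D_n$ ($n\ge4$) and $W$ its Weyl group. Let $w=[i_1,\ldots,i_n]\in W$ be a join-irreducible element of type $\ell\ne\pm1$, and let $S(w)$ be the subarray of the array of $P_\ell$ whose row starting at $m$ is $C(m,i_{m+1})$, for each $m\in\{\ell,\ell+1,\ldots,n-1\}$. (a) If $\{1,2\}\not\subset\{|i_{\ell+1}|,\ldots,|i_n|\}$, then $S(w)$ is predecessor-closed. (b) If $\{1,2\}\subset\{|i_{\ell+1}|,\ldots,|i_n|\}$, then $S(w)$ is $(1,0)$-predecessor-closed or $(0,1)$-predecessor-closed. In either case, we have a factor module of $P_\ell$ corresponding to $S(w)$ (using scalars $(\alpha,\beta)$ with $\alpha+\beta=1$ for which $S(w)$ is $(\alpha,\beta)$-predecessor-closed). (c) $J(w)$ is the factor module of $P_\ell$ corresponding to $S(w)$.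
   Context: $\Pi$ is the preprojective algebra of type $D_n$ over a field $k$: the path algebra of the quiver with vertices $-1,1,2,\ldots,n-1$ and arrows $x_1:1\to2$, $x'_1:-1\to2$, $y_2:2\to1$, $y'_2:2\to-1$, $x_i:i\to i+1$ ($2\le i\le n-2$), $y_i:i\to i-1$ ($3\le i\le n-1$), with relations (paths read from left to right) $x_1y_2=0$, $x'_1y'_2=0$, $x_2y_3=y_2x_1+y'_2x'_1$, $x_iy_{i+1}=y_ix_{i-1}$ for $3\le i\le n-2$, $y_{n-1}x_{n-2}=0$. Modules are finite-dimensional left modules, viewed as representations of this quiver with relations; $e_i$ is the idempotent at vertex $i$ and $P_\ell=\Pi e_\ell$. $W$ is the group of permutations $w$ of $\{\pm1,\ldots,\pm n\}$ with $w(-i)=-w(i)$ and an even number of $i\in\{1,\ldots,n\}$ with $w(i)<0$; product $(ww')(i)=w(w'(i))$; write $w=[i_1,\ldots,i_n]$ with $i_m=w(m)$. Simple reflections: $s_{-1}=[-2,-1,3,\ldots,n]$ and $s_m=[1,\ldots,m-1,m+1,m,m+2,\ldots,n]$ for $1\le m\le n-1$. $W$ carries the right weak order ($u\ge v$ iff $\ell(u)=\ell(v)+\ell(v^{-1}u)$ for the length function $\ell(\cdot)$). For $\ell\in\{2,\ldots,n-1\}$, a join-irreducible element (one covering exactly one element) of type $\ell$ is a $w=[i_1,\ldots,i_n]$ with $i_1<\cdots<i_\ell>i_{\ell+1}<\cdots<i_n$ and $-i_1<i_2$; it covers only $ws_\ell$. Let $I_i=\Pi(1-e_i)\Pi$ and,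 for a reduced word $w=s_{j_1}\cdots s_{j_t}$, $I(w)=I_{j_1}\cdots I_{j_t}$ (independent of the reduced word). For $w$ join-irreducible of type $\ell$, $J(w):=(\Pi/I(w))e_\ell$. Array of $P_\ell$ ($2\le\ell\le n-1$): it has rows $m=\ell,\ell+1,\ldots,n-1$ (from top to bottom) and columns $c=0,1,\ldots,n+\ell-3$. Row $m$ (the "row starting at $m$") reads, from left to right, $$m,\ m-1,\ \ldots,\ 2,\ \begin{smallmatrix}1\\-1\end{smallmatrix},\ -2,\ -3,\ \ldots,\ m-\ell+1-n,$$ where the position in column $c=m-1$ contains two entries, $1$ and $-1$, and every other position contains one entry. Each entry $v$ stands for a basis vector of $P_\ell$, lying on the vertex $v$ if $v\ge-1$ and on the vertex $-v$ if $v\le-2$; the generator of $P_\ell$ is the entry $\ell$ in the upper left corner. In the two-entry position of row $m$, call the entry $(-1)^{m-\ell}$ the upper entry and $-(-1)^{m-\ell}$ the lower entry. Fix scalars $\alpha,\beta\in k$ with $\alpha+\beta=1$. The action of the quiver arrows is given by the following arrows between entries, each with a scalar (an arrow $v\to v'$ with scalar $\gamma$ contributes $\gamma$ times the basis vector $v'$ to the image of the basis vector $v$ under the quiver arrow between the corresponding vertices): - horizontal arrows within row $m$: from each single entry to the next single entry on its right, scalar $1$; from $2$ to both entries of the two-entry position, scalar $1$; from the upper entry to $-2$, scalar $1$; from the lower entry to $-2$, scalar $-1$; - vertical arrows from row $m$ to row $m+1$ in the same column: from a single entry to a single entry, scalar $1$; from the upper entry of row $m$ to the entry $2$ of row $m+1$,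 scalar $\alpha$; from the lower entry of row $m$ to the entry $2$ of row $m+1$, scalar $\beta$; from the entry $-2$ of row $m$ to the upper entry of row $m+1$, scalar $\beta$; from the entry $-2$ of row $m$ to the lower entry of row $m+1$, scalar $-\alpha$. For every choice of $\alpha+\beta=1$ this is a description of $P_\ell$ as a quiver representation. A subarray is an arbitrary subset $S$ of the entries. $S$ is predecessor-closed if it is closed under predecessors with respect to all the horizontal and vertical arrows between entries of the array of $P_\ell$. $S$ is $(\alpha,\beta)$-predecessor-closed if it is closed under predecessors with respect to the arrows remaining after removing those whose scalar is $0$. An $(\alpha,\beta)$-predecessor-closed subarray $S$ gives a factor module of $P_\ell$, namely the quotient of $P_\ell$ (realized as the quiver representation whose basis is the set of entries of the array of $P_\ell$ and whose arrow action is given by the horizontal and vertical arrows between entries with the scalars determined by $\alpha,\beta$) by the span of the entries not in $S$. For $m\in\{2,\ldots,n-1\}$ and an integer $j\neq0$, $C(m,j)$ is the following set of entries of the row starting at $m$: empty if $j>m$; $\{m,m-1,\ldots,j+1,j\}$ if $m\ge j\ge1$ (so for $j=1$ only the entry $1$, and not $-1$, of the two-entry position is included); $\{m,m-1,\ldots,2,-1\}$ if $j=-1$; $\{m,m-1,\ldots,2,1,-1\}$ if $j=-2$; $\{m,m-1,\ldots,2,1,-1,-2,-3,\ldots,j+2,j+1\}$ if $j\le-3$. *)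

theory Defs
  imports "HOL-Combinatorics.Permutations"
    "HOL-Algebra.Ideal_Product" "HOL-Algebra.QuotRing" "HOL-Algebra.Module"
begin

section \<open>Left modules over a not necessarily commutative ring\<close>

text \<open>The library locale \<^locale>\<open>module\<close> requires a commutative ring. We reuse its record type and the
  library's \<^locale>\<open>submodule\<close>, which makes no such assumption.\<close>

locale left_module = R?: ring R + M?: abelian_group M
  for R (structure) and M (structure) +
  assumes smult_closed:
      "\<lbrakk>a \<in> carrier R; x \<in> carrier M\<rbrakk> \<Longrightarrow> a \<odot>\<^bsub>M\<^esub> x \<in> carrier M"
    and smult_l_distr:
      "\<lbrakk>a \<in> carrier R; b \<in> carrier R; x \<in> carrier M\<rbrakk> \<Longrightarrow>
        (a \<oplus>\<^bsub>R\<^esub> b) \<odot>\<^bsub>M\<^esub> x = (a \<odot>\<^bsub>M\<^esub> x) \<oplus>\<^bsub>M\<^esub> (b \<odot>\<^bsub>M\<^esub> x)"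
    and smult_r_distr:
      "\<lbrakk>a \<in> carrier R; x \<in> carrier M; y \<in> carrier M\<rbrakk> \<Longrightarrow>
        a \<odot>\<^bsub>M\<^esub> (x \<oplus>\<^bsub>M\<^esub> y) = (a \<odot>\<^bsub>M\<^esub> x) \<oplus>\<^bsub>M\<^esub> (a \<odot>\<^bsub>M\<^esub> y)"
    and smult_assoc1:
      "\<lbrakk>a \<in> carrier R; b \<in> carrier R; x \<in> carrier M\<rbrakk> \<Longrightarrow>
        (a \<otimes>\<^bsub>R\<^esub> b) \<odot>\<^bsub>M\<^esub> x = a \<odot>\<^bsub>M\<^esub> (b \<odot>\<^bsub>M\<^esub> x)"
    and smult_one: "x \<in> carrier M \<Longrightarrow> \<one>\<^bsub>R\<^esub> \<odot>\<^bsub>M\<^esub> x = x"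

definition left_module_iso ::
    "('r, 'e) ring_scheme \<Rightarrow> ('r, 'a) module \<Rightarrow> ('r, 'b) module \<Rightarrow> ('a \<Rightarrow> 'b) \<Rightarrow> bool" where
  "left_module_iso R M N f \<longleftrightarrow>
     bij_betw f (carrier M) (carrier N) \<and>
     (\<forall>x\<in>carrier M. \<forall>y\<in>carrier M. f (x \<oplus>\<^bsub>M\<^esub> y) = f x \<oplus>\<^bsub>N\<^esub> f y) \<and>
     (\<forall>r\<in>carrier R. \<forall>x\<in>carrier M. f (r \<odot>\<^bsub>M\<^esub> x) = r \<odot>\<^bsub>N\<^esub> f x)"

text \<open>The fields \<open>mult\<close> and \<open>one\<close> of the record, inherited from rings, are irrelevant for a module.\<close>

definition quot_module :: "('r, 'a) module \<Rightarrow> 'a set \<Rightarrow> ('r, 'a set) module" where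
  "quot_module M N =
     \<lparr>carrier = a_rcosets\<^bsub>M\<^esub> N, mult = (\<lambda>_ _. undefined), one = undefined,
      zero = N, add = set_add M,
      smult = (\<lambda>r X. \<Union>x\<in>X. N +>\<^bsub>M\<^esub> (r \<odot>\<^bsub>M\<^esub> x))\<rparr>"


section \<open>The preprojective algebra of type D\<close>

text \<open>\<open>X i\<close> and \<open>Y i\<close> are the arrows $x_i : i \to i+1$ and $y_i : i \to i-1$; \<open>X1'\<close> and \<open>Y2'\<close> are
  $x'_1 : -1 \to 2$ and $y'_2 : 2 \to -1$.\<close>

datatype arrow = X int | X1' | Y int | Y2'

fun src :: "arrow \<Rightarrow> int" where
  "src (X i) = i" | "src X1' = -1" | "src (Y i) = i" | "src Y2' = 2"

fun tgt :: "arrow \<Rightarrow> int" where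
  "tgt (X i) = i + 1" | "tgt X1' = 2" | "tgt (Y i) = i - 1" | "tgt Y2' = -1"

definition vertices :: "int \<Rightarrow> int set" where
  "vertices n = insert (-1) {1..n-1}"

definition arrows :: "int \<Rightarrow> arrow set" where
  "arrows n = X ` {1..n-2} \<union> Y ` {2..n-1} \<union> {X1', Y2'}"

text \<open>A path is its starting vertex together with the list of its arrows in the order in which they
  are traversed, i.e. read from left to right.\<close>

type_synonym path = "int \<times> arrow list"

fun path_end :: "path \<Rightarrow> int" where
  "path_end (i, as) = (if as = [] then i else tgt (last as))"

fun is_path :: "int \<Rightarrow> path \<Rightarrow> bool" where
  "is_path n (i, []) \<longleftrightarrow> i \<in> vertices n"
| "is_path n (i, a # as) \<longleftrightarrow> i \<in> vertices n \<and> a \<in> arrows n \<and> src a = i \<and> is_path n (tgt a, as)"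

text \<open>In the path algebra the product \<open>f \<otimes> g\<close> of two paths is ``first \<open>g\<close>, then \<open>f\<close>'' (zero if they do
  not fit together), so that left modules are representations of the quiver: an arrow \<open>i \<rightarrow> j\<close> maps
  \<open>e\<^sub>i M\<close> to \<open>e\<^sub>j M\<close>, and \<open>P\<^sub>l = \<Pi> e\<^sub>l\<close> is spanned by the paths starting in \<open>l\<close>.
  (Reversing paths and exchanging \<open>x\<^sub>i\<close> with \<open>y\<^sub>i\<^sub>+\<^sub>1\<close> and \<open>x'\<^sub>1\<close> with \<open>y'\<^sub>2\<close> preserves the relations below
  and fixes all \<open>e\<^sub>i\<close>; hence the algebra with the opposite product is isomorphic to this one.)\<close>

definition path_algebra :: "int \<Rightarrow> (path \<Rightarrow> 'k::field) ring" where
  "path_algebra n =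
     \<lparr>carrier = {f. finite {p. f p \<noteq> 0} \<and> (\<forall>p. f p \<noteq> 0 \<longrightarrow> is_path n p)},
      mult = (\<lambda>f g (i, as). \<Sum>t\<le>length as.
                f (path_end (i, take t as), drop t as) * g (i, take t as)),
      one = (\<lambda>(i, as). if i \<in> vertices n \<and> as = [] then 1 else 0),
      zero = (\<lambda>p. 0),
      add = (\<lambda>f g p. f p + g p)\<rparr>"

definition path_elt :: "path \<Rightarrow> (path \<Rightarrow> 'k::field)" where
  "path_elt p = (\<lambda>q. if q = p then 1 else 0)"

definition preproj_relations :: "int \<Rightarrow> (path \<Rightarrow> 'k::field) set" where
  "preproj_relations n =
     {path_elt (1, [X 1, Y 2]),
      path_elt (-1, [X1', Y2']),
      path_elt (2, [X 2, Y 3]) \<ominus>\<^bsub>path_algebra n\<^esub>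
        (path_elt (2, [Y 2, X 1]) \<oplus>\<^bsub>path_algebra n\<^esub> path_elt (2, [Y2', X1'])),
      path_elt (n-1, [Y (n-1), X (n-2)])}
     \<union> {path_elt (i, [X i, Y (i+1)]) \<ominus>\<^bsub>path_algebra n\<^esub> path_elt (i, [Y i, X (i-1)]) | i.
          3 \<le> i \<and> i \<le> n - 2}"

definition preproj_ideal :: "int \<Rightarrow> (path \<Rightarrow> 'k::field) set" where
  "preproj_ideal n = Idl\<^bsub>path_algebra n\<^esub> (preproj_relations n)"

definition preproj :: "int \<Rightarrow> (path \<Rightarrow> 'k::field) set ring" where
  "preproj n = path_algebra n Quot preproj_ideal n"

definition idem :: "int \<Rightarrow> int \<Rightarrow> (path \<Rightarrow> 'k::field) set" where
  "idem n i = preproj_ideal n +>\<^bsub>path_algebra n\<^esub> path_elt (i, [])"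

text \<open>\<open>I\<^sub>i = \<Pi> (1 - e\<^sub>i) \<Pi>\<close>\<close>

definition vertex_ideal :: "int \<Rightarrow> int \<Rightarrow> (path \<Rightarrow> 'k::field) set set" where
  "vertex_ideal n i = Idl\<^bsub>preproj n\<^esub> {\<one>\<^bsub>preproj n\<^esub> \<ominus>\<^bsub>preproj n\<^esub> idem n i}"

definition word_ideal :: "int \<Rightarrow> int list \<Rightarrow> (path \<Rightarrow> 'k::field) set set" where
  "word_ideal n js =
     foldr (\<lambda>j I. ideal_prod (preproj n) (vertex_ideal n j) I) js (carrier (preproj n))"

text \<open>The left module \<open>(\<Pi>/I(w)) e\<^sub>l\<close>, where \<open>I(w)\<close> is computed from the word \<open>js\<close> for \<open>w\<close>.\<close>

definition J_module :: "int \<Rightarrow> int list \<Rightarrow> int \<Rightarrow>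
    ((path \<Rightarrow> 'k::field) set, (path \<Rightarrow> 'k) set set) module" where
  "J_module n js l =
     (let I = word_ideal n js; Q = preproj n Quot I in
      \<lparr>carrier = {x \<otimes>\<^bsub>Q\<^esub> (I +>\<^bsub>preproj n\<^esub> idem n l) | x. x \<in> carrier Q},
       mult = (\<lambda>_ _. undefined), one = undefined,
       zero = \<zero>\<^bsub>Q\<^esub>, add = add Q,
       smult = (\<lambda>a x. (I +>\<^bsub>preproj n\<^esub> a) \<otimes>\<^bsub>Q\<^esub> x)\<rparr>)"

definition J_gen :: "int \<Rightarrow> int list \<Rightarrow> int \<Rightarrow> (path \<Rightarrow> 'k::field) set set" where
  "J_gen n js l = word_ideal n js +>\<^bsub>preproj n\<^esub> idem n l"


section \<open>The Weyl group of type D\<close>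

text \<open>Signed permutations are functions on the integers fixing everything outside
  \<open>{\<plusminus>1, \<dots>, \<plusminus>n}\<close>; in one-line notation \<open>w = [w 1, \<dots>, w n]\<close>.\<close>

definition weyl :: "int \<Rightarrow> (int \<Rightarrow> int) set" where
  "weyl n = {w. w permutes ({-n..n} - {0}) \<and> (\<forall>i. w (- i) = - w i) \<and>
               even (card {i \<in> {1..n}. w i < 0})}"

definition simple_refl :: "int \<Rightarrow> int \<Rightarrow> int" where
  "simple_refl j =
     (if j = -1 then transpose 1 (-2) \<circ> transpose 2 (-1)
      else transpose j (j + 1) \<circ> transpose (- j) (- (j + 1)))"

text \<open>The simple reflections are indexed by the vertices of the quiver.\<close>

definition word_prod :: "int list \<Rightarrow> int \<Rightarrow> int" where
  "word_prod js = foldr (\<lambda>j w. simple_refl j \<circ> w) js id"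

definition len :: "int \<Rightarrow> (int \<Rightarrow> int) \<Rightarrow> nat" where
  "len n w = (LEAST t. \<exists>js. set js \<subseteq> vertices n \<and> word_prod js = w \<and> length js = t)"

definition reduced_word :: "int \<Rightarrow> int list \<Rightarrow> (int \<Rightarrow> int) \<Rightarrow> bool" where
  "reduced_word n js w \<longleftrightarrow>
     set js \<subseteq> vertices n \<and> word_prod js = w \<and> length js = len n w"

definition weak_le :: "int \<Rightarrow> (int \<Rightarrow> int) \<Rightarrow> (int \<Rightarrow> int) \<Rightarrow> bool" where
  "weak_le n v u \<longleftrightarrow> len n u = len n v + len n (inv_into UNIV v \<circ> u)"

definition covers :: "int \<Rightarrow> (int \<Rightarrow> int) \<Rightarrow> (int \<Rightarrow> int) \<Rightarrow> bool" where
  "covers n u v \<longleftrightarrow>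
     u \<in> weyl n \<and> v \<in> weyl n \<and> weak_le n v u \<and> v \<noteq> u \<and>
     \<not> (\<exists>x\<in>weyl n. weak_le n v x \<and> weak_le n x u \<and> x \<noteq> v \<and> x \<noteq> u)"

definition join_irreducible :: "int \<Rightarrow> (int \<Rightarrow> int) \<Rightarrow> bool" where
  "join_irreducible n w \<longleftrightarrow> w \<in> weyl n \<and> (\<exists>!v. covers n w v)"

definition of_type :: "int \<Rightarrow> int \<Rightarrow> (int \<Rightarrow> int) \<Rightarrow> bool" where
  "of_type n l w \<longleftrightarrow> covers n w (w \<circ> simple_refl l)"


section \<open>The array\<close>

text \<open>The entry \<open>v\<close> of the row starting at \<open>m\<close> is the pair \<open>(m, v)\<close>; within a row all values are
  distinct.\<close>

type_synonym entry = "int \<times> int"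

definition array :: "int \<Rightarrow> int \<Rightarrow> entry set" where
  "array n l = {(m, v). l \<le> m \<and> m \<le> n - 1 \<and> m - l + 1 - n \<le> v \<and> v \<le> m \<and> v \<noteq> 0}"

fun column :: "entry \<Rightarrow> int" where
  "column (m, v) = (if 1 \<le> v then m - v else if v = -1 then m - 1 else m - v - 2)"

fun entry_vertex :: "entry \<Rightarrow> int" where
  "entry_vertex (m, v) = (if -1 \<le> v then v else - v)"

definition single :: "int \<Rightarrow> bool" where
  "single v \<longleftrightarrow> v \<noteq> 1 \<and> v \<noteq> -1"

text \<open>The upper entry of the two-entry position of row \<open>m\<close>; the lower entry is its negative.\<close>

definition upper :: "int \<Rightarrow> int \<Rightarrow> int" where
  "upper l m = (if even (m - l) then 1 else -1)"

definition h_arrow :: "entry \<Rightarrow> entry \<Rightarrow> bool" where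
  "h_arrow e e' \<longleftrightarrow> fst e' = fst e \<and> column e' = column e + 1"

definition v_arrow :: "entry \<Rightarrow> entry \<Rightarrow> bool" where
  "v_arrow e e' \<longleftrightarrow> fst e' = fst e + 1 \<and> column e' = column e"

fun scalar :: "int \<Rightarrow> 'k::field \<Rightarrow> 'k \<Rightarrow> entry \<Rightarrow> entry \<Rightarrow> 'k" where
  "scalar l \<alpha> \<beta> (m, v) (m', v') =
     (if h_arrow (m, v) (m', v') then
        (if single v \<or> v = upper l m then 1 else -1)
      else if v_arrow (m, v) (m', v') then
        (if single v \<and> single v' then 1
         else if \<not> single v then (if v = upper l m then \<alpha> else \<beta>)
         else (if v' = upper l m' then \<beta> else - \<alpha>))
      else 0)"

definition predecessor_closed :: "int \<Rightarrow> int \<Rightarrow> entry set \<Rightarrow> bool" where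
  "predecessor_closed n l S \<longleftrightarrow> S \<subseteq> array n l \<and>
     (\<forall>e\<in>array n l. \<forall>e'\<in>S. h_arrow e e' \<or> v_arrow e e' \<longrightarrow> e \<in> S)"

definition scalar_predecessor_closed ::
    "int \<Rightarrow> int \<Rightarrow> 'k::field \<Rightarrow> 'k \<Rightarrow> entry set \<Rightarrow> bool" where
  "scalar_predecessor_closed n l \<alpha> \<beta> S \<longleftrightarrow> S \<subseteq> array n l \<and>
     (\<forall>e\<in>array n l. \<forall>e'\<in>S.
        (h_arrow e e' \<or> v_arrow e e') \<and> scalar l \<alpha> \<beta> e e' \<noteq> 0 \<longrightarrow> e \<in> S)"

text \<open>The representation with basis \<open>array n l\<close>: vectors are coefficient functions vanishing outside
  the array. Between two vertices there is at most one quiver arrow in each direction, so the quiver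
  arrow \<open>a\<close> collects exactly the array arrows from entries on \<open>src a\<close> to entries on \<open>tgt a\<close>.\<close>

definition arrow_act ::
    "int \<Rightarrow> int \<Rightarrow> 'k::field \<Rightarrow> 'k \<Rightarrow> arrow \<Rightarrow> (entry \<Rightarrow> 'k) \<Rightarrow> (entry \<Rightarrow> 'k)" where
  "arrow_act n l \<alpha> \<beta> a f = (\<lambda>e'.
     if e' \<in> array n l \<and> entry_vertex e' = tgt a
     then \<Sum>e | e \<in> array n l \<and> entry_vertex e = src a. scalar l \<alpha> \<beta> e e' * f e
     else 0)"

definition path_act ::
    "int \<Rightarrow> int \<Rightarrow> 'k::field \<Rightarrow> 'k \<Rightarrow> path \<Rightarrow> (entry \<Rightarrow> 'k) \<Rightarrow> (entry \<Rightarrow> 'k)" where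
  "path_act n l \<alpha> \<beta> p f =
     fold (arrow_act n l \<alpha> \<beta>) (snd p) (\<lambda>e. if entry_vertex e = fst p then f e else 0)"

definition path_algebra_act ::
    "int \<Rightarrow> int \<Rightarrow> 'k::field \<Rightarrow> 'k \<Rightarrow> (path \<Rightarrow> 'k) \<Rightarrow> (entry \<Rightarrow> 'k) \<Rightarrow> (entry \<Rightarrow> 'k)" where
  "path_algebra_act n l \<alpha> \<beta> c f = (\<lambda>e. \<Sum>p | c p \<noteq> 0. c p * path_act n l \<alpha> \<beta> p f e)"

text \<open>An element of \<open>\<Pi>\<close> is a coset of the ideal of relations. For \<open>\<alpha> + \<beta> = 1\<close> the relations act as
  zero, so all its representatives act in the same way and \<^const>\<open>the_elem\<close> picks the common value.\<close>

definition array_module ::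
    "int \<Rightarrow> int \<Rightarrow> 'k::field \<Rightarrow> 'k \<Rightarrow> ((path \<Rightarrow> 'k) set, entry \<Rightarrow> 'k) module" where
  "array_module n l \<alpha> \<beta> =
     \<lparr>carrier = {f. \<forall>e. e \<notin> array n l \<longrightarrow> f e = 0}, mult = (\<lambda>_ _. undefined), one = undefined,
      zero = (\<lambda>e. 0), add = (\<lambda>f g e. f e + g e),
      smult = (\<lambda>x f. the_elem ((\<lambda>c. path_algebra_act n l \<alpha> \<beta> c f) ` x))\<rparr>"

text \<open>The span of the entries not in \<open>S\<close>.\<close>

definition complement_span :: "int \<Rightarrow> int \<Rightarrow> entry set \<Rightarrow> (entry \<Rightarrow> 'k::field) set" where
  "complement_span n l S = {f. \<forall>e. e \<notin> array n l - S \<longrightarrow> f e = 0}"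

definition factor_module :: "int \<Rightarrow> int \<Rightarrow> 'k::field \<Rightarrow> 'k \<Rightarrow> entry set \<Rightarrow>
    ((path \<Rightarrow> 'k) set, (entry \<Rightarrow> 'k) set) module" where
  "factor_module n l \<alpha> \<beta> S = quot_module (array_module n l \<alpha> \<beta>) (complement_span n l S)"

text \<open>The image of the generator, the entry \<open>l\<close> of the row starting at \<open>l\<close>.\<close>

definition factor_gen :: "int \<Rightarrow> int \<Rightarrow> 'k::field \<Rightarrow> 'k \<Rightarrow> entry set \<Rightarrow> (entry \<Rightarrow> 'k) set" where
  "factor_gen n l \<alpha> \<beta> S =
     complement_span n l S +>\<^bsub>array_module n l \<alpha> \<beta>\<^esub> (\<lambda>e. if e = (l, l) then 1 else 0)"

text \<open>The sets \<open>C(m, j)\<close>, as sets of values in the row starting at \<open>m\<close> (for \<open>j \<noteq> 0\<close>).\<close>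

definition C :: "int \<Rightarrow> int \<Rightarrow> int set" where
  "C m j =
     (if j > m then {}
      else if 1 \<le> j then {j..m}
      else if j = -1 then {2..m} \<union> {-1}
      else if j = -2 then {1..m} \<union> {-1}
      else {j+1..m} - {0})"

definition subarray :: "int \<Rightarrow> int \<Rightarrow> (int \<Rightarrow> int) \<Rightarrow> entry set" where
  "subarray n l w = {(m, v). l \<le> m \<and> m \<le> n - 1 \<and> v \<in> C m (w (m + 1))}"

end

theory Submission
  imports Defs
begin

text \<open>
  The idea is to compute \<open>I(w) e\<^sub>l\<close> along a reduced word of \<open>w\<close>. If \<open>w = s\<^sub>j w'\<close> with \<open>w\<close> longer than \<open>w'\<close>,
  then \<open>I(w) e\<^sub>l = I\<^sub>j I(w') e\<^sub>l\<close> is the submodule generated by \<open>(1 - e\<^sub>j) I(w') e\<^sub>l\<close>. On the side of the array,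
  \<open>S(w)\<close> and \<open>S(w')\<close> differ only in entries on the vertex \<open>j\<close>, and since \<open>j\<close> is a left descent of \<open>w\<close>,
  each entry on \<open>j\<close> outside \<open>S(w)\<close> has a horizontal predecessor outside \<open>S(w)\<close>; so the span of the
  entries outside \<open>S(w)\<close> arises from that for \<open>w'\<close> in the same way. (All suffixes of a
  reduced word of \<open>w\<close> again represent minimal coset representatives.)

  Two points need care. The array is a faithful picture of \<open>\<Pi> e\<^sub>l\<close>: every entry is given a preimage \<open>psi\<close>
  in the path algebra, and the arrows act on these preimages as in the array, modulo the relations.
  Moreover, the scalars admissible for \<open>w\<close> need not be admissible for the shorter factors; but if
  both \<open>S(w)\<close> and \<open>S(w')\<close> restrict the scalars, they do so in the same way, and if \<open>S(w)\<close> does not restrict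
  them, then a base change shows that its factor module does not depend on them.
\<close>

section \<open>Signed permutations: length and descents\<close>

text \<open>The left descent acts through the increasing tail \<open>w (l + 1) < ... < w n\<close>.
  For \<open>j \<ge> 1\<close>, if \<open>j + 1\<close> stood in the tail, then \<open>j\<close>,
  which comes later in \<open>w\<close>, would stand further right in the tail and be larger, which
  is absurd; likewise for \<open>- j\<close> and \<open>- j - 1\<close>. (For \<open>j = -1\<close>
  the excluded values are 1 and 2.) These are the values of \<open>w (m + 1)\<close> for which an
  entry on \<open>j\<close> is missing although all its horizontal predecessors are present. Scalars
  matter only where the values of absolute value 1 and 2 are neighbours in the tail. There is at
  most one such place, so one of the two extreme choices of scalars is always admissible. Left
  multiplication by \<open>simple_refl 2\<close> can shift the place by one row; then the parity of
  the row and the sign of the product of the two values both change, and the scalar that must vanish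
  stays the same. Injectivity of the map from \<open>P_l\<close> to the array comes from a linear
  map \<open>theta\<close> in the other direction, given on entries by \<open>psi\<close>: modulo
  the relations it recovers \<open>c e_l\<close> from the action of \<open>c\<close> on the
  generator.\<close>

definition signed_range :: "int \<Rightarrow> int set" where
  "signed_range n = {-n..n} - {0}"

text \<open>A positive root of type D corresponds to two pairs, \<open>(a, b)\<close> and
  \<open>(- b, - a)\<close>, so every inversion is counted twice. The pairs with
  \<open>a = - b\<close> belong to the additional roots of types B and C.\<close>

definition inv_pairs :: "int \<Rightarrow> (int \<Rightarrow> int) \<Rightarrow> (int \<times> int) set" where
  "inv_pairs n u = {(a, b). a \<in> signed_range n \<and> b \<in> signed_range n \<and> a < b \<and> a \<noteq> -b \<and> u b < u a}"

text \<open>For \<open>u\<close> in the Weyl group: right multiplication by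
  \<open>simple_refl j\<close> lengthens \<open>u\<close>, see \<open>len_comp_simple_refl\<close>.
  Left descents appear as \<open>\<not> ascent (inv_into UNIV w) j\<close>.\<close>

definition ascent :: "(int \<Rightarrow> int) \<Rightarrow> int \<Rightarrow> bool" where
  "ascent u j \<longleftrightarrow> (if j = -1 then - u 1 < u 2 else u j < u (j + 1))"

lemma simple_refl_minus_one:
  "simple_refl (-1) a = (if a = 1 then -2 else if a = 2 then -1 else if a = -1 then 2 else if a = -2 then 1 else a)"
  by (simp add: simple_refl_def transpose_def)

lemma simple_refl_pos:
  "1 \<le> j \<Longrightarrow> simple_refl j a =
    (if a = j then j + 1 else if a = j + 1 then j else if a = - j then - j - 1 else if a = - j - 1 then - j else a)"
  by (simp add: simple_refl_def transpose_def)

lemma simple_refl_involutive: "j = -1 \<or> 1 \<le> j \<Longrightarrow> simple_refl j (simple_refl j a) = a"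
  by (elim disjE) (simp_all add: simple_refl_minus_one simple_refl_pos)

lemma simple_refl_comp_self: "j = -1 \<or> 1 \<le> j \<Longrightarrow> simple_refl j \<circ> simple_refl j = id"
  using simple_refl_involutive by (simp add: fun_eq_iff)

lemma simple_refl_minus: "j = -1 \<or> 1 \<le> j \<Longrightarrow> simple_refl j (- a) = - simple_refl j a"
  by (auto simp: simple_refl_def transpose_def)

lemma vertices_cases: "j \<in> vertices n \<Longrightarrow> j = -1 \<or> 1 \<le> j"
  by (auto simp: vertices_def)

lemma simple_refl_signed_range:
  "\<lbrakk>2 \<le> n; j \<in> vertices n\<rbrakk> \<Longrightarrow> simple_refl j a \<in> signed_range n \<longleftrightarrow> a \<in> signed_range n"
  by (auto simp: simple_refl_def transpose_def vertices_def signed_range_def)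

definition simple_root_pairs :: "int \<Rightarrow> (int \<times> int) set" where
  "simple_root_pairs j = (if j = -1 then {(-1, 2), (-2, 1)} else {(j, j + 1), (- j - 1, - j)})"

text \<open>A simple reflection permutes the positive roots other than its own, which is represented
  by the two pairs in \<open>simple_root_pairs j\<close>.\<close>

lemma simple_refl_strict_mono:
  assumes "j = -1 \<or> 1 \<le> j" "a < b" "a \<noteq> -b" "(a, b) \<notin> simple_root_pairs j" "a \<noteq> 0" "b \<noteq> 0"
  shows "simple_refl j a < simple_refl j b"
  using assms(1)
proof
  assume "j = -1"
  with assms(2-) show ?thesis by (auto simp: simple_refl_minus_one simple_root_pairs_def)
next
  assume "1 \<le> j"
  moreover have "(a, b) \<noteq> (j, j + 1)" "(a, b) \<noteq> (- j - 1, - j)"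
    using assms(4) \<open>1 \<le> j\<close> by (auto simp: simple_root_pairs_def)
  ultimately show ?thesis
    using assms(2,3,5,6) unfolding simple_refl_pos[OF \<open>1 \<le> j\<close>] prod.inject by (smt (verit))
qed

lemma simple_refl_root_pairs:
  assumes "j = -1 \<or> 1 \<le> j"
  shows "(a, b) \<in> simple_root_pairs j \<longleftrightarrow> (simple_refl j b, simple_refl j a) \<in> simple_root_pairs j"
  using assms
proof
  assume "j = -1"
  then show ?thesis by (simp add: simple_refl_minus_one simple_root_pairs_def)
next
  assume j: "1 \<le> j"
  show ?thesis using j unfolding simple_refl_pos[OF j] simple_root_pairs_def by simp
qed

lemma weyl_minus: "w \<in> weyl n \<Longrightarrow> w (- i) = - w i"
  by (simp add: weyl_def)

lemma weyl_permutes: "w \<in> weyl n \<Longrightarrow> w permutes signed_range n"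
  by (simp add: weyl_def signed_range_def)

lemma weyl_inj: "w \<in> weyl n \<Longrightarrow> w a = w b \<longleftrightarrow> a = b"
  using permutes_inj[OF weyl_permutes] by (auto dest: injD)

lemma weyl_signed_range: "w \<in> weyl n \<Longrightarrow> w a \<in> signed_range n \<longleftrightarrow> a \<in> signed_range n"
  using permutes_in_image[OF weyl_permutes] by auto

lemma finite_signed_range [simp]: "finite (signed_range n)"
  by (simp add: signed_range_def)

lemma finite_inv_pairs: "finite (inv_pairs n u)"
  by (rule finite_subset[of _ "signed_range n \<times> signed_range n"]) (auto simp: inv_pairs_def)

lemma weyl_comp_simple_refl:
  assumes n: "2 \<le> n" and w: "w \<in> weyl n" and j: "j \<in> vertices n"
  shows "w \<circ> simple_refl j \<in> weyl n"
proof -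
  note j' = vertices_cases[OF j]
  have "simple_refl j permutes signed_range n"
    unfolding permutes_def
  proof (intro conjI allI impI ex1I)
    fix a show "a \<notin> signed_range n \<Longrightarrow> simple_refl j a = a"
      using n j by (auto simp: simple_refl_def transpose_def vertices_def signed_range_def)
    show "simple_refl j (simple_refl j a) = a" by (rule simple_refl_involutive[OF j'])
    fix b assume "simple_refl j b = a" then show "b = simple_refl j a"
      using simple_refl_involutive[OF j'] by auto
  qed
  then have 1: "(w \<circ> simple_refl j) permutes signed_range n"
    using weyl_permutes[OF w] by (rule permutes_compose)
  have "even (card {i \<in> {1..n}. (w \<circ> simple_refl j) i < 0})"
  proof (cases "j = -1")
    case False
    then have s: "1 \<le> j" "j \<le> n - 1" using j by (auto simp: vertices_def)
    have "bij_betw (simple_refl j) {i \<in> {1..n}. (w \<circ> simple_refl j) i < 0} {i \<in> {1..n}. w i < 0}"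
      by (rule bij_betw_byWitness[where f' = "simple_refl j"])
        (use s in \<open>auto simp: simple_refl_def transpose_def, presburger?\<close>)
    then show ?thesis using w by (simp add: bij_betw_same_card weyl_def)
  next
    case True
    \<comment> \<open>For \<open>j = -1\<close> the first two values become \<open>- w 2\<close> and
      \<open>- w 1\<close>, so the number of negative ones among them changes by 0 or 2.\<close>
    let ?A = "{i \<in> {3..n}. w i < 0}"
    let ?f = "\<lambda>a i. if a < (0::int) then {i::int} else {}"
    have rng: "i \<in> {1..n} \<longleftrightarrow> i = 1 \<or> i = 2 \<or> i \<in> {3..n}" for i using n by auto
    have sr: "simple_refl (-1) 1 = -2" "simple_refl (-1) 2 = -1" "\<And>i. 3 \<le> i \<Longrightarrow> simple_refl (-1) i = i"
      by (auto simp: simple_refl_def transpose_def)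
    have e1: "{i \<in> {1..n}. w i < 0} = ?f (w 1) 1 \<union> (?f (w 2) 2 \<union> ?A)"
      unfolding rng by auto
    have "{i \<in> {1..n}. (w \<circ> simple_refl j) i < 0} = {i \<in> {1..n}. w (simple_refl (-1) i) < 0}"
      using True by simp
    also have "\<dots> = ?f (- w 2) 1 \<union> (?f (- w 1) 2 \<union> ?A)"
      unfolding rng using weyl_minus[OF w, of 1] weyl_minus[OF w, of 2] by (auto simp: sr)
    finally have e2: "{i \<in> {1..n}. (w \<circ> simple_refl j) i < 0} = ?f (- w 2) 1 \<union> (?f (- w 1) 2 \<union> ?A)" .
    have nz: "w 1 \<noteq> 0" "w 2 \<noteq> 0"
      using weyl_signed_range[OF w, of 1] weyl_signed_range[OF w, of 2] n by (auto simp: signed_range_def)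
    have c: "card (?f x 1 \<union> (?f y 2 \<union> ?A)) = (if x < 0 then 1 else 0) + ((if y < 0 then 1 else 0) + card ?A)" for x y
    proof -
      have "finite ?A" by (rule finite_subset[of _ "{3..n}"]) auto
      then show ?thesis by (simp add: card_insert_if)
    qed
    have "even (card {i \<in> {1..n}. w i < 0})" using w by (simp add: weyl_def)
    then show ?thesis using nz unfolding e1 e2 c by (auto split: if_splits)
  qed
  then show ?thesis using 1 w simple_refl_minus[OF j'] by (simp add: weyl_def signed_range_def)
qed

lemma id_weyl: "id \<in> weyl n"
proof -
  have "{i \<in> {1..n}. id i < 0} = {}" by auto
  then have "even (card {i \<in> {1..n}. id i < 0})" by (metis card.empty even_zero)
  then show ?thesis by (auto simp: weyl_def)
qed

lemma ascent_iff_root_pairs: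
  assumes "w \<in> weyl n" "j = -1 \<or> 1 \<le> j" "(a, b) \<in> simple_root_pairs j"
  shows "ascent w j \<longleftrightarrow> w a < w b"
  using assms weyl_minus[OF assms(1), of j] weyl_minus[OF assms(1), of "j+1"]
    weyl_minus[OF assms(1), of 1] weyl_minus[OF assms(1), of 2]
  by (auto simp: simple_root_pairs_def ascent_def split: if_splits)

text \<open>Applying the reflection to both components matches the inverted pairs of the two
  elements, apart from the two pairs of the simple root, which become inverted.\<close>

lemma card_inv_pairs_ascent:
  assumes n: "2 \<le> n" and w: "w \<in> weyl n" and j: "j \<in> vertices n" and asc: "ascent w j"
  shows "card (inv_pairs n (w \<circ> simple_refl j)) = card (inv_pairs n w) + 2"
proof -
  note j' = vertices_cases[OF j]
  let ?s = "simple_refl j" and ?R = "simple_root_pairs j"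
  have wR: "w a < w b" if "(a, b) \<in> ?R" for a b
    using ascent_iff_root_pairs[OF w j' that] asc by simp
  have disj: "inv_pairs n w \<inter> ?R = {}"
    using wR unfolding inv_pairs_def by (blast dest: less_asym)
  have R: "?R \<subseteq> inv_pairs n (w \<circ> ?s)"
  proof
    fix p assume p: "p \<in> ?R"
    obtain a b where ab: "p = (a, b)" by force
    have "w (?s b) < w (?s a)"
      using wR p simple_refl_root_pairs[OF j', of a b] unfolding ab by blast
    moreover have "a \<in> signed_range n" "b \<in> signed_range n" "a < b" "a \<noteq> -b"
      using p ab n j by (auto simp: simple_root_pairs_def signed_range_def vertices_def split: if_splits)
    ultimately show "p \<in> inv_pairs n (w \<circ> ?s)" by (simp add: inv_pairs_def ab)
  qed
  \<comment> \<open>Stated for arbitrary \<open>v\<close>, because the two directions of the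
    bijection below use it once for \<open>w\<close> and once for
    \<open>w \<circ> ?s\<close>.\<close>
  have step: "(?s a, ?s b) \<in> inv_pairs n v - ?R" if p: "(a, b) \<in> inv_pairs n (v \<circ> ?s) - ?R" for a b v
  proof -
    have ab: "a \<in> signed_range n" "b \<in> signed_range n" "a < b" "a \<noteq> -b" "v (?s b) < v (?s a)" "(a, b) \<notin> ?R"
      using p by (auto simp: inv_pairs_def)
    have "?s a < ?s b" using ab by (intro simple_refl_strict_mono[OF j']) (auto simp: signed_range_def)
    moreover have "?s a \<noteq> - ?s b"
    proof
      assume "?s a = - ?s b"
      then have "?s (?s a) = ?s (?s (- b))" using simple_refl_minus[OF j', of b] by simp
      then show False using ab(4) by (simp only: simple_refl_involutive[OF j'])
    qed
    moreover have "(?s a, ?s b) \<notin> ?R"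
    proof
      assume "(?s a, ?s b) \<in> ?R"
      then have "(?s (?s b), ?s (?s a)) \<in> ?R" using simple_refl_root_pairs[OF j'] by blast
      then have "(b, a) \<in> ?R" by (simp only: simple_refl_involutive[OF j'])
      then have "b < a" using j' by (auto simp: simple_root_pairs_def split: if_splits)
      then show False using ab(3) by simp
    qed
    ultimately show ?thesis using ab simple_refl_signed_range[OF n j] by (simp add: inv_pairs_def)
  qed
  have ss: "(w \<circ> ?s) \<circ> ?s = w" by (simp add: comp_assoc simple_refl_comp_self[OF j'])
  have "bij_betw (map_prod ?s ?s) (inv_pairs n (w \<circ> ?s) - ?R) (inv_pairs n w - ?R)"
  proof (rule bij_betw_byWitness[where f' = "map_prod ?s ?s"])
    show "map_prod ?s ?s ` (inv_pairs n (w \<circ> ?s) - ?R) \<subseteq> inv_pairs n w - ?R"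
      using step[of _ _ w] by auto
    show "map_prod ?s ?s ` (inv_pairs n w - ?R) \<subseteq> inv_pairs n (w \<circ> ?s) - ?R"
      using step[of _ _ "w \<circ> ?s"] unfolding ss by auto
  qed (auto simp: simple_refl_involutive[OF j'])
  then have "card (inv_pairs n (w \<circ> ?s) - ?R) = card (inv_pairs n w - ?R)"
    by (rule bij_betw_same_card)
  moreover have "card ?R = 2" "finite ?R" using j' by (auto simp: simple_root_pairs_def)
  moreover have "card (inv_pairs n (w \<circ> ?s) - ?R) = card (inv_pairs n (w \<circ> ?s)) - card ?R"
    using R \<open>finite ?R\<close> by (intro card_Diff_subset) auto
  moreover have "card ?R \<le> card (inv_pairs n (w \<circ> ?s))"
    by (rule card_mono[OF finite_inv_pairs R])
  moreover have "inv_pairs n w - ?R = inv_pairs n w" using disj by auto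
  ultimately show ?thesis by simp
qed

lemma ascent_comp_simple_refl:
  assumes n: "2 \<le> n" and w: "w \<in> weyl n" and j: "j \<in> vertices n"
  shows "ascent (w \<circ> simple_refl j) j \<longleftrightarrow> \<not> ascent w j"
proof -
  note j' = vertices_cases[OF j]
  define p :: "int \<times> int" where "p = (if j = -1 then (-1, 2) else (j, j + 1))"
  obtain a b where ab: "p = (a, b)" by force
  have p: "(a, b) \<in> simple_root_pairs j" using ab by (auto simp: p_def simple_root_pairs_def split: if_splits)
  have "(simple_refl j b, simple_refl j a) \<in> simple_root_pairs j"
    using p simple_refl_root_pairs[OF j'] by blast
  then have "ascent w j \<longleftrightarrow> w (simple_refl j b) < w (simple_refl j a)"
    by (rule ascent_iff_root_pairs[OF w j'])
  moreover have "ascent (w \<circ> simple_refl j) j \<longleftrightarrow> w (simple_refl j a) < w (simple_refl j b)"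
    using ascent_iff_root_pairs[OF weyl_comp_simple_refl[OF n w j] j' p] by simp
  moreover have "w (simple_refl j a) \<noteq> w (simple_refl j b)"
  proof
    assume "w (simple_refl j a) = w (simple_refl j b)"
    then have "simple_refl j a = simple_refl j b" using weyl_inj[OF w] by simp
    then have "simple_refl j (simple_refl j a) = simple_refl j (simple_refl j b)" by simp
    then have "a = b" by (simp only: simple_refl_involutive[OF j'])
    then show False using ab by (auto simp: p_def split: if_splits)
  qed
  ultimately show ?thesis by auto
qed

lemma card_inv_pairs_descent:
  assumes n: "2 \<le> n" and w: "w \<in> weyl n" and j: "j \<in> vertices n" and asc: "\<not> ascent w j"
  shows "card (inv_pairs n w) = card (inv_pairs n (w \<circ> simple_refl j)) + 2"
  using card_inv_pairs_ascent[OF n weyl_comp_simple_refl[OF n w j] j] ascent_comp_simple_refl[OF n w j] asc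
  by (simp add: comp_assoc simple_refl_comp_self[OF vertices_cases[OF j]])

text \<open>Downward induction from \<open>n\<close>: a strictly increasing integer sequence loses
  at least 1 with each step to the left.\<close>

lemma increasing_bounded_above:
  fixes w :: "int \<Rightarrow> int"
  assumes asc: "\<And>i. a \<le> i \<Longrightarrow> i < n \<Longrightarrow> w i < w (i + 1)" and "w n \<le> n" and "a \<le> i" "i \<le> n"
  shows "w i \<le> i"
  using \<open>i \<le> n\<close> \<open>a \<le> i\<close>
proof (induction rule: int_le_induct)
  case base then show ?case using assms by simp
next
  case (step i)
  show ?case
  proof (cases "a \<le> i - 1")
    case True then show ?thesis using step asc[of "i - 1"] by simp
  qed (use step in simp)
qed

text \<open>\<open>w 1 < w 2\<close> and \<open>- w 1 < w 2\<close> force \<open>w 2 > 0\<close>,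
  the parity of the number of negative values excludes \<open>w 1 < 0\<close>, and \<open>n\<close>
  increasing positive integers bounded by \<open>n\<close> are \<open>1, ..., n\<close>.\<close>

lemma weyl_all_ascents:
  assumes n: "2 \<le> n" and w: "w \<in> weyl n" and asc: "\<And>j. j \<in> vertices n \<Longrightarrow> ascent w j"
  shows "w = id"
proof -
  have inc: "w i < w (i + 1)" if "1 \<le> i" "i < n" for i
    using asc[of i] that by (auto simp: vertices_def ascent_def)
  have pos2: "0 < w 2" "- w 1 < w 2"
    using asc[of "-1"] inc[of 1] n by (auto simp: vertices_def ascent_def)
  have pos: "0 < w i" if "2 \<le> i" "i \<le> n" for i
    using that
  proof (induction rule: int_ge_induct)
    case (step i) then show ?case using inc[of i] by simp
  qed (use pos2 in auto)
  have rng: "w i \<in> signed_range n" if "1 \<le> i" "i \<le> n" for i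
    using weyl_signed_range[OF w] that by (auto simp: signed_range_def)
  have pos1: "0 < w 1"
  proof (rule ccontr)
    assume "\<not> 0 < w 1"
    then have "w 1 < 0" using rng[of 1] n by (auto simp: signed_range_def)
    moreover have "i = 1" if "1 \<le> i" "i \<le> n" "w i < 0" for i using pos[of i] that by linarith
    ultimately have "{i \<in> {1..n}. w i < 0} = {1}" using n by auto
    then show False using w by (auto simp: weyl_def)
  qed
  have le: "w i \<le> i" if "1 \<le> i" "i \<le> n" for i
    by (rule increasing_bounded_above[where a = 1 and n = n]) (use inc rng[of n] n that in \<open>auto simp: signed_range_def\<close>)
  have ge: "i \<le> w i" if "1 \<le> i" "i \<le> n" for i
    using that
  proof (induction rule: int_ge_induct)
    case (step i) then show ?case using inc[of i] by simp
  qed (use pos1 in auto)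
  have eq: "w i = i" if "1 \<le> i" "i \<le> n" for i using le[OF that] ge[OF that] by simp
  show "w = id"
  proof
    fix i show "w i = id i"
    proof (cases "i \<in> signed_range n")
      case False then show ?thesis using weyl_permutes[OF w] by (simp add: permutes_def)
    next
      case True
      then have "1 \<le> i \<and> i \<le> n \<or> 1 \<le> - i \<and> - i \<le> n" by (auto simp: signed_range_def)
      then show ?thesis using eq[of i] eq[of "- i"] weyl_minus[OF w, of i] by fastforce
    qed
  qed
qed

section \<open>Length as half the number of inverted pairs\<close>

lemma inv_pairs_id [simp]: "inv_pairs n id = {}"
  by (auto simp: inv_pairs_def)

lemma word_prod_append: "word_prod (xs @ ys) = word_prod xs \<circ> word_prod ys"
  by (induction xs) (auto simp: word_prod_def)

lemma word_prod_Nil [simp]: "word_prod [] = id"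
  and word_prod_Cons [simp]: "word_prod (j # js) = simple_refl j \<circ> word_prod js"
  by (auto simp: word_prod_def)

lemma word_prod_snoc: "word_prod (js @ [j]) = word_prod js \<circ> simple_refl j"
  unfolding word_prod_append by (simp only: word_prod_Cons word_prod_Nil o_id)

lemma word_prod_weyl:
  assumes n: "2 \<le> n" and "set js \<subseteq> vertices n"
  shows "word_prod js \<in> weyl n"
  using assms(2)
proof (induction js rule: rev_induct)
  case (snoc j js)
  then have "word_prod js \<in> weyl n" "j \<in> vertices n" by simp_all
  then show ?case unfolding word_prod_snoc by (rule weyl_comp_simple_refl[OF n])
qed (simp only: word_prod_Nil id_weyl)

lemma card_inv_pairs_word_le:
  assumes n: "2 \<le> n" and "set js \<subseteq> vertices n"
  shows "card (inv_pairs n (word_prod js)) \<le> 2 * length js"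
  using assms(2)
proof (induction js rule: rev_induct)
  case (snoc j js)
  then have w: "word_prod js \<in> weyl n" using word_prod_weyl[OF n] by simp
  have j: "j \<in> vertices n" using snoc by simp
  have "card (inv_pairs n (word_prod js \<circ> simple_refl j)) \<le> card (inv_pairs n (word_prod js)) + 2"
    using card_inv_pairs_ascent[OF n w j] card_inv_pairs_descent[OF n w j] by fastforce
  also have "\<dots> \<le> 2 * length js + 2" using snoc by simp
  finally show ?case unfolding word_prod_snoc by (simp only: length_append_singleton mult_Suc_right add.commute)
qed (simp only: word_prod_Nil inv_pairs_id card.empty)

text \<open>Removing a descent on the right lowers the number of inverted pairs by 2, until only the
  identity is left. By \<open>card_inv_pairs_word_le\<close> no word can be shorter.\<close>

lemma weyl_word_exists:
  assumes n: "2 \<le> n" and "w \<in> weyl n"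
  shows "\<exists>js. set js \<subseteq> vertices n \<and> word_prod js = w \<and> 2 * length js = card (inv_pairs n w)"
  using assms(2)
proof (induction "card (inv_pairs n w)" arbitrary: w rule: less_induct)
  case less
  show ?case
  proof (cases "\<forall>j\<in>vertices n. ascent w j")
    case True
    then have "w = id" using weyl_all_ascents[OF n less.prems] by simp
    then show ?thesis by (intro exI[of _ "[]"]) simp
  next
    case False
    then obtain j where j: "j \<in> vertices n" "\<not> ascent w j" by auto
    note c = card_inv_pairs_descent[OF n less.prems j]
    obtain js where js: "set js \<subseteq> vertices n" "word_prod js = w \<circ> simple_refl j"
      "2 * length js = card (inv_pairs n (w \<circ> simple_refl j))"
      using less.hyps[OF _ weyl_comp_simple_refl[OF n less.prems j(1)]] c by auto
    show ?thesis
      by (rule exI[of _ "js @ [j]"])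
        (use js c j simple_refl_comp_self[OF vertices_cases[OF j(1)]] in \<open>simp add: word_prod_snoc comp_assoc\<close>)
  qed
qed

lemma len_eq_card_inv_pairs:
  assumes n: "2 \<le> n" and w: "w \<in> weyl n"
  shows "2 * len n w = card (inv_pairs n w)"
proof -
  obtain js where js: "set js \<subseteq> vertices n" "word_prod js = w" "2 * length js = card (inv_pairs n w)"
    using weyl_word_exists[OF n w] by blast
  have "len n w = length js" unfolding len_def
  proof (rule Least_equality)
    fix t assume "\<exists>ks. set ks \<subseteq> vertices n \<and> word_prod ks = w \<and> length ks = t"
    then show "length js \<le> t" using card_inv_pairs_word_le[OF n] js(3) by fastforce
  qed (use js in blast)
  then show ?thesis using js by simp
qed

lemma len_word_le: "set js \<subseteq> vertices n \<Longrightarrow> len n (word_prod js) \<le> length js"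
  unfolding len_def by (rule Least_le) blast

lemma reduced_word_exists:
  assumes "2 \<le> n" "w \<in> weyl n"
  obtains js where "reduced_word n js w"
proof -
  obtain js where js: "set js \<subseteq> vertices n" "word_prod js = w" "2 * length js = card (inv_pairs n w)"
    using weyl_word_exists[OF assms] by blast
  then have "reduced_word n js w" using len_eq_card_inv_pairs[OF assms] by (simp add: reduced_word_def)
  then show ?thesis by (rule that)
qed

lemma reduced_word_weyl: "\<lbrakk>2 \<le> n; reduced_word n js w\<rbrakk> \<Longrightarrow> w \<in> weyl n"
  using word_prod_weyl by (auto simp: reduced_word_def)

lemma len_comp_simple_refl:
  assumes "2 \<le> n" "w \<in> weyl n" "j \<in> vertices n"
  shows "len n (w \<circ> simple_refl j) + (if ascent w j then 0 else 1) = len n w + (if ascent w j then 1 else 0)"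
  using card_inv_pairs_ascent[OF assms] card_inv_pairs_descent[OF assms]
    len_eq_card_inv_pairs[OF assms(1,2)] len_eq_card_inv_pairs[OF assms(1) weyl_comp_simple_refl[OF assms]]
  by auto

lemma word_prod_rev:
  "set js \<subseteq> vertices n \<Longrightarrow> word_prod (rev js) \<circ> word_prod js = id \<and> word_prod js \<circ> word_prod (rev js) = id"
proof (induction js)
  case (Cons j js)
  then have j: "simple_refl j (simple_refl j a) = a" for a
    using vertices_cases[of j n] simple_refl_involutive by simp
  have "word_prod (rev js) (word_prod js a) = a \<and> word_prod js (word_prod (rev js) a) = a" for a
    using Cons by (simp add: fun_eq_iff)
  then show ?case by (simp add: word_prod_append fun_eq_iff j)
qed simp

lemma inv_word_prod: "set js \<subseteq> vertices n \<Longrightarrow> inv_into UNIV (word_prod js) = word_prod (rev js)"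
  using word_prod_rev[of js n] by (intro inv_unique_comp) auto

lemma weyl_inv:
  assumes "2 \<le> n" "w \<in> weyl n"
  shows "inv_into UNIV w \<in> weyl n" "len n (inv_into UNIV w) = len n w"
proof -
  have *: "inv_into UNIV w \<in> weyl n \<and> len n (inv_into UNIV w) \<le> len n w" if w: "w \<in> weyl n" for w
  proof -
    obtain js where js: "reduced_word n js w" using reduced_word_exists[OF assms(1) w] .
    then have 1: "set js \<subseteq> vertices n" "word_prod js = w" "length js = len n w" by (auto simp: reduced_word_def)
    have "inv_into UNIV w = word_prod (rev js)" using inv_word_prod 1 by auto
    then show ?thesis using word_prod_weyl[OF assms(1), of "rev js"] len_word_le[of "rev js" n] 1 by simp
  qed
  show "inv_into UNIV w \<in> weyl n" using * assms by simp
  have "bij w" using weyl_permutes[OF assms(2)] permutes_bij by blast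
  then have "inv_into UNIV (inv_into UNIV w) = w" by (rule inv_inv_eq)
  then show "len n (inv_into UNIV w) = len n w" using *[OF assms(2)] *[of "inv_into UNIV w"] by simp
qed

text \<open>Lengths are controlled under right multiplication, so the first letter is moved to the
  right by taking inverses, which preserve the length.\<close>

lemma left_descent_of_reduced_word:
  assumes n: "2 \<le> n" and red: "reduced_word n (j # js) w"
  shows "reduced_word n js (word_prod js)" "len n w = Suc (len n (word_prod js))" "\<not> ascent (inv_into UNIV w) j"
proof -
  let ?v = "word_prod js"
  have js: "set js \<subseteq> vertices n" "j \<in> vertices n" "w = simple_refl j \<circ> ?v" "Suc (length js) = len n w"
    using red by (auto simp: reduced_word_def)
  have v: "?v \<in> weyl n" and w: "w \<in> weyl n" using word_prod_weyl[OF n] js reduced_word_weyl[OF n red] by auto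
  have "inv_into UNIV w = word_prod (rev (j # js))" using inv_word_prod[of "j # js" n] js by simp
  then have iw: "inv_into UNIV w = inv_into UNIV ?v \<circ> simple_refl j" using inv_word_prod[of js n] js by (simp add: word_prod_snoc)
  have "len n w \<le> Suc (len n ?v)"
    using len_comp_simple_refl[OF n weyl_inv(1)[OF n v] js(2)] weyl_inv(2)[OF n v] weyl_inv(2)[OF n w] iw
    by (auto split: if_splits)
  then show l: "len n w = Suc (len n ?v)" using len_word_le[OF js(1)] js(4) by simp
  then show "reduced_word n js ?v" using js by (auto simp: reduced_word_def)
  have "inv_into UNIV ?v = inv_into UNIV w \<circ> simple_refl j"
    using iw simple_refl_comp_self[OF vertices_cases[OF js(2)]] by (simp add: comp_assoc)
  then show "\<not> ascent (inv_into UNIV w) j"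
    using len_comp_simple_refl[OF n weyl_inv(1)[OF n w] js(2)] weyl_inv(2)[OF n v] weyl_inv(2)[OF n w] l
    by (auto split: if_splits)
qed

text \<open>Minimal coset representatives modulo the parabolic subgroup generated by the
  \<open>simple_refl j\<close> with \<open>j \<noteq> l\<close>. Unlike join-irreducibility, this
  includes the identity and passes to the suffixes of a reduced word, as the induction
  requires.\<close>

definition grassmannian :: "int \<Rightarrow> int \<Rightarrow> (int \<Rightarrow> int) \<Rightarrow> bool" where
  "grassmannian n l w \<longleftrightarrow> w \<in> weyl n \<and> (\<forall>j\<in>vertices n - {l}. ascent w j)"

text \<open>For a descent \<open>i \<noteq> l\<close> of the suffix \<open>v\<close>, the element
  \<open>w s_i = s_j (v s_i)\<close> would have length at most \<open>len n v\<close>, although it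
  is longer than \<open>w\<close>.\<close>

lemma grassmannian_left_factor:
  assumes n: "2 \<le> n" and red: "reduced_word n (j # js) w" and w: "grassmannian n l w"
  shows "grassmannian n l (word_prod js)"
proof -
  let ?v = "word_prod js"
  have js: "set js \<subseteq> vertices n" "j \<in> vertices n" "w = simple_refl j \<circ> ?v"
    using red by (auto simp: reduced_word_def)
  have v: "?v \<in> weyl n" using word_prod_weyl[OF n] js by auto
  have "ascent ?v i" if i: "i \<in> vertices n - {l}" for i
  proof (rule ccontr)
    assume d: "\<not> ascent ?v i"
    have iv: "i \<in> vertices n" using i by simp
    have u: "?v \<circ> simple_refl i \<in> weyl n" by (rule weyl_comp_simple_refl[OF n v iv])
    obtain ks where ks: "reduced_word n ks (?v \<circ> simple_refl i)" using reduced_word_exists[OF n u] .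
    have "w \<circ> simple_refl i = word_prod (j # ks)"
      using js(3) ks by (auto simp: reduced_word_def comp_assoc)
    then have "len n (w \<circ> simple_refl i) \<le> Suc (length ks)"
      using len_word_le[of "j # ks" n] ks js by (auto simp: reduced_word_def)
    moreover have "Suc (length ks) = len n ?v"
      using len_comp_simple_refl[OF n v iv] d ks by (simp add: reduced_word_def)
    moreover have "len n (w \<circ> simple_refl i) = Suc (len n w)"
      using len_comp_simple_refl[OF n _ iv, of w] w i by (simp add: grassmannian_def)
    ultimately show False using left_descent_of_reduced_word(2)[OF n red] by simp
  qed
  then show ?thesis using v by (simp add: grassmannian_def)
qed

section \<open>Covers in the weak order\<close>

lemma len_zero: "\<lbrakk>2 \<le> n; w \<in> weyl n; len n w = 0\<rbrakk> \<Longrightarrow> w = id"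
  using reduced_word_exists[of n w] by (auto simp: reduced_word_def)

lemma inv_comp_weyl:
  assumes "2 \<le> n" "u \<in> weyl n" "v \<in> weyl n"
  shows "inv_into UNIV u \<circ> v \<in> weyl n"
proof -
  obtain js ks where "reduced_word n js (inv_into UNIV u)" "reduced_word n ks v"
    using reduced_word_exists weyl_inv assms by metis
  then show ?thesis
    using word_prod_weyl[of n "js @ ks"] assms by (auto simp: word_prod_append reduced_word_def)
qed

text \<open>The two lengths differ by 1, so for any element in between one of the two quotients has
  length 0 and is therefore the identity.\<close>

lemma descent_covers:
  assumes n: "2 \<le> n" and w: "w \<in> weyl n" and j: "j \<in> vertices n" and d: "\<not> ascent w j"
  shows "covers n w (w \<circ> simple_refl j)"
proof -
  let ?s = "simple_refl j"
  have bij: "bij u" if "u \<in> weyl n" for u using weyl_permutes[OF that] permutes_bij by blast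
  have v: "w \<circ> ?s \<in> weyl n" by (rule weyl_comp_simple_refl[OF n w j])
  have l: "len n w = Suc (len n (w \<circ> ?s))" using len_comp_simple_refl[OF n w j] d by simp
  have "inv_into UNIV (w \<circ> ?s) \<circ> w = ?s"
  proof -
    have "inv_into UNIV (w \<circ> ?s) \<circ> (w \<circ> ?s) = id" using bij[OF v] by (simp add: bij_is_inj)
    then have "(inv_into UNIV (w \<circ> ?s) \<circ> (w \<circ> ?s)) \<circ> ?s = ?s" by (metis id_comp)
    then show ?thesis using simple_refl_comp_self[OF vertices_cases[OF j]] by (simp add: comp_assoc)
  qed
  moreover have "len n ?s = 1"
    using len_comp_simple_refl[OF n id_weyl j] len_eq_card_inv_pairs[OF n id_weyl] vertices_cases[OF j]
    by (auto simp: ascent_def split: if_splits)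
  ultimately have "weak_le n (w \<circ> ?s) w" using l by (simp add: weak_le_def)
  moreover have "x = w \<circ> ?s \<or> x = w" if x: "x \<in> weyl n" "weak_le n (w \<circ> ?s) x" "weak_le n x w" for x
  proof -
    have eq: "b = a" if "a \<in> weyl n" "b \<in> weyl n" "len n (inv_into UNIV a \<circ> b) = 0" for a b
    proof -
      have "inv_into UNIV a \<circ> b = id" using len_zero[OF n inv_comp_weyl[OF n]] that by blast
      then have "a \<circ> (inv_into UNIV a \<circ> b) = a" by simp
      moreover have "a \<circ> inv_into UNIV a = id" using bij_is_surj[OF bij[OF that(1)]] surj_iff by blast
      ultimately show ?thesis by (metis comp_assoc id_comp)
    qed
    have "len n (inv_into UNIV (w \<circ> ?s) \<circ> x) = 0 \<or> len n (inv_into UNIV x \<circ> w) = 0"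
      using x l by (auto simp: weak_le_def)
    then show ?thesis using eq[OF v x(1)] eq[OF x(1) w] by auto
  qed
  moreover have "w \<circ> ?s \<noteq> w" using l by (metis n_not_Suc_n)
  ultimately show ?thesis using v w by (auto simp: covers_def)
qed

lemma simple_refl_inject:
  assumes "i = -1 \<or> 1 \<le> i" "j = -1 \<or> 1 \<le> j" "simple_refl i = simple_refl j"
  shows "i = j"
proof -
  have e: "simple_refl i a = simple_refl j a" for a using assms by simp
  show ?thesis
    using e[of i] e[of 1] e[of 2] assms(1,2) unfolding simple_refl_def
    by (auto simp: transpose_def split: if_splits)
qed

text \<open>Every descent produces a covered element, and different reflections produce different
  ones; uniqueness leaves no descent besides \<open>l\<close>.\<close>

lemma join_irreducible_grassmannian:
  assumes n: "2 \<le> n" and l: "l \<in> vertices n" and ji: "join_irreducible n w" and ty: "of_type n l w"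
  shows "grassmannian n l w"
proof -
  have w: "w \<in> weyl n" using ji by (simp add: join_irreducible_def)
  have "ascent w j" if j: "j \<in> vertices n - {l}" for j
  proof (rule ccontr)
    assume "\<not> ascent w j"
    then have "covers n w (w \<circ> simple_refl j)" using descent_covers[OF n w] j by simp
    then have "w \<circ> simple_refl j = w \<circ> simple_refl l"
      using ji ty by (auto simp: join_irreducible_def of_type_def)
    then have "simple_refl j = simple_refl l"
      using weyl_inj[OF w] by (auto simp: fun_eq_iff)
    then show False using simple_refl_inject[OF vertices_cases vertices_cases] j l by blast
  qed
  then show ?thesis using w by (simp add: grassmannian_def)
qed

section \<open>Left modules and ideal products\<close>

context left_module
begin

lemma smult_l_zero: "x \<in> carrier M \<Longrightarrow> \<zero> \<odot>\<^bsub>M\<^esub> x = \<zero>\<^bsub>M\<^esub>"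
  using smult_l_distr[of "\<zero>" "\<zero>" x] smult_closed[of "\<zero>" x]
  by simp

lemma smult_l_minus: "\<lbrakk>a \<in> carrier R; x \<in> carrier M\<rbrakk> \<Longrightarrow> (\<ominus> a) \<odot>\<^bsub>M\<^esub> x = \<ominus>\<^bsub>M\<^esub> (a \<odot>\<^bsub>M\<^esub> x)"
  using smult_l_distr[of "\<ominus> a" a x] smult_l_zero[of x] smult_closed
  by (simp add: R.l_neg M.minus_equality)

lemma smult_l_diff:
  "\<lbrakk>a \<in> carrier R; b \<in> carrier R; x \<in> carrier M\<rbrakk> \<Longrightarrow>
    (a \<ominus> b) \<odot>\<^bsub>M\<^esub> x = (a \<odot>\<^bsub>M\<^esub> x) \<ominus>\<^bsub>M\<^esub> (b \<odot>\<^bsub>M\<^esub> x)"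
  by (simp add: a_minus_def smult_l_distr smult_l_minus)

lemma left_submoduleI:
  assumes "T \<subseteq> carrier M" "\<zero>\<^bsub>M\<^esub> \<in> T"
    and add: "\<And>x y. \<lbrakk>x \<in> T; y \<in> T\<rbrakk> \<Longrightarrow> x \<oplus>\<^bsub>M\<^esub> y \<in> T"
    and smult: "\<And>a x. \<lbrakk>a \<in> carrier R; x \<in> T\<rbrakk> \<Longrightarrow> a \<odot>\<^bsub>M\<^esub> x \<in> T"
  shows "submodule T R M"
proof -
  have "\<ominus>\<^bsub>M\<^esub> x \<in> T" if "x \<in> T" for x
  proof -
    have "\<ominus>\<^bsub>M\<^esub> x = (\<ominus> \<one>) \<odot>\<^bsub>M\<^esub> x"
      using that assms(1) by (subst smult_l_minus) (auto simp: smult_one)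
    then show ?thesis using smult[OF _ that] by simp
  qed
  then show ?thesis
    using assms by (intro submodule.intro subgroup.intro submodule_axioms.intro) (auto simp: a_inv_def)
qed

lemma submodule_abelian_subgroup:
  assumes "submodule N R M"
  shows "abelian_subgroup N M"
  using submodule.axioms(1)[OF assms] by (intro abelian_subgroupI3 additive_subgroupI M.abelian_group_axioms)

text \<open>The ring elements carrying \<open>K'\<close> into \<open>K\<close> form a two-sided
  ideal, because both are submodules; it contains \<open>c\<close> and hence the ideal generated by
  \<open>c\<close>.\<close>

lemma annihilating_ideal_prod:
  assumes K': "submodule K' R M" and K: "submodule K R M" and g: "g \<in> carrier M"
    and I: "\<And>a. a \<in> I \<Longrightarrow> a \<in> carrier R \<and> a \<odot>\<^bsub>M\<^esub> g \<in> K'"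
    and c: "c \<in> carrier R" "\<And>x. x \<in> K' \<Longrightarrow> c \<odot>\<^bsub>M\<^esub> x \<in> K"
    and a: "a \<in> ideal_prod R (Idl {c}) I"
  shows "a \<odot>\<^bsub>M\<^esub> g \<in> K"
proof -
  interpret K': abelian_subgroup K' M by (rule submodule_abelian_subgroup[OF K'])
  interpret K: abelian_subgroup K M by (rule submodule_abelian_subgroup[OF K])
  let ?A = "{p \<in> carrier R. \<forall>x\<in>K'. p \<odot>\<^bsub>M\<^esub> x \<in> K}"
  have carr: "x \<in> K' \<Longrightarrow> x \<in> carrier M" "x \<in> K \<Longrightarrow> x \<in> carrier M" for x by auto
  have "ideal ?A R"
  proof (rule idealI[OF R.ring_axioms])
    show "subgroup ?A (add_monoid R)"
    proof (rule R.add.subgroupI)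
      show "?A \<noteq> {}" using c by blast
      show "\<ominus> p \<in> ?A" if "p \<in> ?A" for p
        using that carr smult_l_minus[of p] by auto
      show "p \<oplus> q \<in> ?A" if "p \<in> ?A" "q \<in> ?A" for p q
        using that carr smult_l_distr[of p q] by auto
    qed auto
    show "x \<otimes> p \<in> ?A" if "p \<in> ?A" "x \<in> carrier R" for p x
      using that carr smult_assoc1[of x p] submodule.smult_closed[OF K] by auto
    show "p \<otimes> x \<in> ?A" if "p \<in> ?A" "x \<in> carrier R" for p x
      using that carr smult_assoc1[of p x] submodule.smult_closed[OF K'] by auto
  qed
  moreover have "{c} \<subseteq> ?A" using c by simp
  ultimately have A: "Idl {c} \<subseteq> ?A" by (rule R.genideal_minimal)
  have "a \<in> carrier R \<and> a \<odot>\<^bsub>M\<^esub> g \<in> K"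
    using a
  proof (induction rule: ideal_prod.induct)
    case (prod p q)
    then have "p \<in> ?A" using A by blast
    then show ?case using I[OF prod(2)] g smult_assoc1[of p q g] by auto
  next
    case (sum s t)
    then show ?case using g smult_l_distr[of s t g] by auto
  qed
  then show ?thesis by simp
qed

text \<open>With \<open>c = 1 - e\<^sub>j\<close>, this is the inductive step for \<open>I(s\<^sub>j w) e = I\<^sub>j I(w) e\<close>: if \<open>I(w) e\<close> is the
  preimage of \<open>K'\<close> under \<open>a \<mapsto> a g\<close>, then \<open>I\<^sub>j I(w) e\<close> is the preimage of the submodule generated
  by \<open>c K'\<close>.\<close>

lemma ideal_prod_step:
  assumes I: "ideal I R" and g: "g \<in> carrier M" and e: "e \<in> carrier R" "e \<odot>\<^bsub>M\<^esub> g = g"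
    and gen: "\<And>x. x \<in> carrier M \<Longrightarrow> \<exists>a\<in>carrier R. a \<odot>\<^bsub>M\<^esub> g = x"
    and faithful: "\<And>a. \<lbrakk>a \<in> carrier R; a \<odot>\<^bsub>M\<^esub> g = \<zero>\<^bsub>M\<^esub>\<rbrakk> \<Longrightarrow> a \<otimes> e = \<zero>"
    and K': "submodule K' R M" and K: "submodule K R M"
    and IK': "\<And>a. a \<in> carrier R \<Longrightarrow> a \<otimes> e \<in> I \<longleftrightarrow> a \<odot>\<^bsub>M\<^esub> g \<in> K'"
    and c: "c \<in> carrier R" "\<And>x. x \<in> K' \<Longrightarrow> c \<odot>\<^bsub>M\<^esub> x \<in> K"
    and min: "\<And>T. \<lbrakk>submodule T R M; \<And>x. x \<in> K' \<Longrightarrow> c \<odot>\<^bsub>M\<^esub> x \<in> T\<rbrakk> \<Longrightarrow> K \<subseteq> T"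
    and a: "a \<in> carrier R"
  shows "a \<otimes> e \<in> ideal_prod R (Idl {c}) I \<longleftrightarrow> a \<odot>\<^bsub>M\<^esub> g \<in> K"
proof
  interpret I: ideal I R by (rule I)
  let ?P = "ideal_prod R (Idl {c}) I"
  have "ideal (Idl {c}) R" using c(1) by (intro R.genideal_ideal) simp
  then have P: "ideal ?P R" using I by (rule R.ideal_prod_is_ideal)
  interpret P: ideal ?P R by (rule P)
  have ge: "(a \<otimes> e) \<odot>\<^bsub>M\<^esub> g = a \<odot>\<^bsub>M\<^esub> g" if "a \<in> carrier R" for a
    using that e g smult_assoc1 by simp
  {
    assume "a \<otimes> e \<in> ?P"
    moreover have "b \<in> carrier R \<and> b \<odot>\<^bsub>M\<^esub> g \<in> K'" if "b \<in> I" for b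
      using IK'[of b] that e(1) I.I_r_closed by auto
    ultimately have "(a \<otimes> e) \<odot>\<^bsub>M\<^esub> g \<in> K"
      using annihilating_ideal_prod[OF K' K g _ c] by blast
    then show "a \<odot>\<^bsub>M\<^esub> g \<in> K" using ge[OF a] by simp
  }
  {
    assume aK: "a \<odot>\<^bsub>M\<^esub> g \<in> K"
    \<comment> \<open>The image of the product ideal is a submodule containing \<open>c K'\<close>,
      so minimality of \<open>K\<close> puts \<open>a g\<close> into it. Faithfulness then lifts
      \<open>a g = p g\<close> to \<open>a e = p e\<close>.\<close>
    let ?T = "(\<lambda>p. p \<odot>\<^bsub>M\<^esub> g) ` ?P"
    have "submodule ?T R M"
    proof (rule left_submoduleI)
      show "?T \<subseteq> carrier M" using P.a_Hcarr g smult_closed by auto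
      show "\<zero>\<^bsub>M\<^esub> \<in> ?T" using P.zero_closed smult_l_zero[OF g] by (metis imageI)
      show "x \<oplus>\<^bsub>M\<^esub> y \<in> ?T" if xy: "x \<in> ?T" "y \<in> ?T" for x y
      proof -
        obtain p q where pq: "p \<in> ?P" "q \<in> ?P" "x = p \<odot>\<^bsub>M\<^esub> g" "y = q \<odot>\<^bsub>M\<^esub> g" using xy by blast
        then have "x \<oplus>\<^bsub>M\<^esub> y = (p \<oplus> q) \<odot>\<^bsub>M\<^esub> g" using g smult_l_distr P.a_Hcarr by simp
        then show ?thesis using P.a_closed[OF pq(1,2)] by blast
      qed
      show "b \<odot>\<^bsub>M\<^esub> x \<in> ?T" if bx: "b \<in> carrier R" "x \<in> ?T" for b x
      proof -
        obtain p where p: "p \<in> ?P" "x = p \<odot>\<^bsub>M\<^esub> g" using bx by blast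
        then have "b \<odot>\<^bsub>M\<^esub> x = (b \<otimes> p) \<odot>\<^bsub>M\<^esub> g" using g smult_assoc1 P.a_Hcarr bx by simp
        then show ?thesis using P.I_l_closed[OF p(1) bx(1)] by blast
      qed
    qed
    moreover have "c \<odot>\<^bsub>M\<^esub> x \<in> ?T" if x: "x \<in> K'" for x
    proof -
      have "x \<in> carrier M" using submodule.axioms(1)[OF K'] x subgroup.mem_carrier by fastforce
      then obtain b where b: "b \<in> carrier R" "b \<odot>\<^bsub>M\<^esub> g = x" using gen by blast
      then have "b \<otimes> e \<in> I" using IK' x by simp
      moreover have "c \<in> Idl {c}" using c(1) R.genideal_self' by simp
      ultimately have "c \<otimes> (b \<otimes> e) \<in> ?P" by (intro ideal_prod.prod)
      moreover have "(c \<otimes> (b \<otimes> e)) \<odot>\<^bsub>M\<^esub> g = c \<odot>\<^bsub>M\<^esub> x"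
        using b c(1) e g smult_assoc1 ge by simp
      ultimately show ?thesis by (metis imageI)
    qed
    ultimately have "K \<subseteq> ?T" by (rule min)
    then obtain p where p: "p \<in> ?P" "a \<odot>\<^bsub>M\<^esub> g = p \<odot>\<^bsub>M\<^esub> g" using aK by blast
    have pc: "p \<in> carrier R" using p P.a_Hcarr by simp
    have "(a \<ominus> p) \<odot>\<^bsub>M\<^esub> g = \<zero>\<^bsub>M\<^esub>"
      using p(2) a pc g smult_closed by (simp add: smult_l_diff M.minus_eq M.r_neg)
    then have "(a \<ominus> p) \<otimes> e = \<zero>" using faithful a pc by simp
    then have "a \<otimes> e \<ominus> p \<otimes> e = \<zero>"
      using a pc e(1) by (simp add: R.minus_eq R.l_distr R.l_minus)
    then have "a \<otimes> e = p \<otimes> e" using R.minus_equality[of "a \<otimes> e" "\<ominus> (p \<otimes> e)"] a pc e(1) by (simp add: R.minus_eq)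
    then show "a \<otimes> e \<in> ?P" using P.I_r_closed[OF p(1) e(1)] by simp
  }
qed

end

text \<open>The action on cosets is a union over all representatives; since \<open>N\<close> is a
  submodule, each of them contributes the same coset.\<close>

lemma quot_module_smult:
  fixes M :: "('r, 'a) module" and R :: "('r, 'e) ring_scheme"
  assumes M: "left_module R M" and N: "submodule N R M" and a: "a \<in> carrier R" and x: "x \<in> carrier M"
  shows "a \<odot>\<^bsub>quot_module M N\<^esub> (N +>\<^bsub>M\<^esub> x) = N +>\<^bsub>M\<^esub> (a \<odot>\<^bsub>M\<^esub> x)"
proof -
  interpret left_module R M by (rule M)
  interpret N: abelian_subgroup N M by (rule submodule_abelian_subgroup[OF N])
  have "N +>\<^bsub>M\<^esub> (a \<odot>\<^bsub>M\<^esub> y) = N +>\<^bsub>M\<^esub> (a \<odot>\<^bsub>M\<^esub> x)" if y: "y \<in> N +>\<^bsub>M\<^esub> x" for y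
  proof -
    obtain h where h: "h \<in> N" "y = h \<oplus>\<^bsub>M\<^esub> x" using y by (auto simp: a_r_coset_def')
    have hc: "h \<in> carrier M" using h by simp
    have "a \<odot>\<^bsub>M\<^esub> y = (a \<odot>\<^bsub>M\<^esub> h) \<oplus>\<^bsub>M\<^esub> (a \<odot>\<^bsub>M\<^esub> x)" using h(2) hc a x by (simp add: smult_r_distr)
    moreover have "a \<odot>\<^bsub>M\<^esub> h \<in> N" using submodule.smult_closed[OF N a h(1)] .
    ultimately have "a \<odot>\<^bsub>M\<^esub> y \<in> N +>\<^bsub>M\<^esub> (a \<odot>\<^bsub>M\<^esub> x)" by (auto simp: a_r_coset_def')
    then show ?thesis by (rule N.a_repr_independence'[OF _ smult_closed[OF a x], symmetric])
  qed
  then have "(\<Union>y\<in>N +>\<^bsub>M\<^esub> x. N +>\<^bsub>M\<^esub> (a \<odot>\<^bsub>M\<^esub> y)) = (\<Union>y\<in>N +>\<^bsub>M\<^esub> x. N +>\<^bsub>M\<^esub> (a \<odot>\<^bsub>M\<^esub> x))"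
    by simp
  also have "\<dots> = N +>\<^bsub>M\<^esub> (a \<odot>\<^bsub>M\<^esub> x)" using N.a_rcos_self[OF x] by blast
  finally show ?thesis by (simp add: quot_module_def)
qed

lemma quot_module_left_module:
  fixes M :: "('r, 'a) module" and R :: "('r, 'e) ring_scheme"
  assumes M: "left_module R M" and N: "submodule N R M"
  shows "left_module R (quot_module M N)"
proof -
  interpret left_module R M by (rule M)
  interpret N: abelian_subgroup N M by (rule submodule_abelian_subgroup[OF N])
  let ?Q = "quot_module M N"
  have rep: "\<exists>x\<in>carrier M. X = N +>\<^bsub>M\<^esub> x" if "X \<in> carrier ?Q" for X
    using that by (auto simp: quot_module_def A_RCOSETS_def')
  have add: "(N +>\<^bsub>M\<^esub> x) \<oplus>\<^bsub>?Q\<^esub> (N +>\<^bsub>M\<^esub> y) = N +>\<^bsub>M\<^esub> (x \<oplus>\<^bsub>M\<^esub> y)"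
    if "x \<in> carrier M" "y \<in> carrier M" for x y
    using N.a_rcos_sum[OF that] by (simp add: quot_module_def)
  have closed: "N +>\<^bsub>M\<^esub> x \<in> carrier ?Q" if "x \<in> carrier M" for x
    using M.a_rcosetsI[OF N.a_subset that] by (simp add: quot_module_def)
  have zero: "\<zero>\<^bsub>?Q\<^esub> = N +>\<^bsub>M\<^esub> \<zero>\<^bsub>M\<^esub>"
    using M.a_coset_add_zero[OF N.a_subset] by (simp add: quot_module_def)
  have grp: "abelian_group ?Q"
  proof (rule abelian_groupI)
    fix X assume "X \<in> carrier ?Q"
    then obtain x where x: "x \<in> carrier M" "X = N +>\<^bsub>M\<^esub> x" using rep by blast
    show "\<zero>\<^bsub>?Q\<^esub> \<oplus>\<^bsub>?Q\<^esub> X = X" using x by (simp add: zero add)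
    show "\<exists>Y\<in>carrier ?Q. Y \<oplus>\<^bsub>?Q\<^esub> X = \<zero>\<^bsub>?Q\<^esub>"
      by (rule bexI[of _ "N +>\<^bsub>M\<^esub> (\<ominus>\<^bsub>M\<^esub> x)"]) (use x in \<open>simp_all add: zero add closed M.l_neg\<close>)
    fix Y assume "Y \<in> carrier ?Q"
    then obtain y where y: "y \<in> carrier M" "Y = N +>\<^bsub>M\<^esub> y" using rep by blast
    show "X \<oplus>\<^bsub>?Q\<^esub> Y \<in> carrier ?Q" using x y by (simp add: add closed)
    show "X \<oplus>\<^bsub>?Q\<^esub> Y = Y \<oplus>\<^bsub>?Q\<^esub> X" using x y by (simp add: add M.a_comm)
    fix Z assume "Z \<in> carrier ?Q"
    then obtain z where "z \<in> carrier M" "Z = N +>\<^bsub>M\<^esub> z" using rep by blast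
    then show "(X \<oplus>\<^bsub>?Q\<^esub> Y) \<oplus>\<^bsub>?Q\<^esub> Z = X \<oplus>\<^bsub>?Q\<^esub> (Y \<oplus>\<^bsub>?Q\<^esub> Z)"
      using x y by (simp add: add M.a_assoc)
  qed (simp add: zero closed)
  note smult = quot_module_smult[OF M N]
  show ?thesis
  proof (intro left_module.intro left_module_axioms.intro R.ring_axioms grp)
    fix a X assume a: "a \<in> carrier R" and X: "X \<in> carrier ?Q"
    obtain x where x: "x \<in> carrier M" "X = N +>\<^bsub>M\<^esub> x" using X rep by blast
    show "a \<odot>\<^bsub>?Q\<^esub> X \<in> carrier ?Q" using a x by (simp add: smult closed smult_closed)
    show "(a \<oplus>\<^bsub>R\<^esub> b) \<odot>\<^bsub>?Q\<^esub> X = a \<odot>\<^bsub>?Q\<^esub> X \<oplus>\<^bsub>?Q\<^esub> b \<odot>\<^bsub>?Q\<^esub> X" if "b \<in> carrier R" for b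
      using a x that by (simp add: smult add smult_closed smult_l_distr)
    show "(a \<otimes>\<^bsub>R\<^esub> b) \<odot>\<^bsub>?Q\<^esub> X = a \<odot>\<^bsub>?Q\<^esub> (b \<odot>\<^bsub>?Q\<^esub> X)" if "b \<in> carrier R" for b
      using a x that by (simp add: smult smult_closed smult_assoc1)
    fix Y assume "Y \<in> carrier ?Q"
    then obtain y where y: "y \<in> carrier M" "Y = N +>\<^bsub>M\<^esub> y" using rep by blast
    show "a \<odot>\<^bsub>?Q\<^esub> (X \<oplus>\<^bsub>?Q\<^esub> Y) = a \<odot>\<^bsub>?Q\<^esub> X \<oplus>\<^bsub>?Q\<^esub> a \<odot>\<^bsub>?Q\<^esub> Y"
      using a x y by (simp add: smult add smult_closed smult_r_distr)
  next
    fix X assume "X \<in> carrier ?Q"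
    then obtain x where x: "x \<in> carrier M" "X = N +>\<^bsub>M\<^esub> x" using rep by blast
    show "\<one>\<^bsub>R\<^esub> \<odot>\<^bsub>?Q\<^esub> X = X" using x by (simp add: smult smult_one)
  qed
qed

section \<open>The path algebra\<close>

definition supp :: "('a \<Rightarrow> 'b::zero) \<Rightarrow> 'a set" where
  "supp f = {p. f p \<noteq> 0}"

definition path_comp :: "path \<Rightarrow> path \<Rightarrow> path" where
  "path_comp p q = (fst q, snd q @ snd p)"

abbreviation path_mult :: "(path \<Rightarrow> 'k::field) \<Rightarrow> (path \<Rightarrow> 'k) \<Rightarrow> path \<Rightarrow> 'k" where
  "path_mult f g \<equiv> \<lambda>(i, as). \<Sum>t\<le>length as. f (path_end (i, take t as), drop t as) * g (i, take t as)"

lemma path_algebra_carrier: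
  "f \<in> carrier (path_algebra n) \<longleftrightarrow> finite (supp f) \<and> (\<forall>p. f p \<noteq> 0 \<longrightarrow> is_path n p)"
  by (simp add: path_algebra_def supp_def)

lemma path_algebra_is_path: "\<lbrakk>f \<in> carrier (path_algebra n); f p \<noteq> 0\<rbrakk> \<Longrightarrow> is_path n p"
  unfolding path_algebra_carrier by blast

lemma path_algebra_mult [simp]: "f \<otimes>\<^bsub>path_algebra n\<^esub> g = path_mult f g"
  and path_algebra_add [simp]: "f \<oplus>\<^bsub>path_algebra n\<^esub> g = (\<lambda>p. f p + g p)"
  and path_algebra_zero [simp]: "\<zero>\<^bsub>path_algebra n\<^esub> = (\<lambda>p. 0)"
  and path_algebra_one: "\<one>\<^bsub>path_algebra n\<^esub> = (\<lambda>(i, as). if i \<in> vertices n \<and> as = [] then 1 else 0)"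
  by (simp_all add: path_algebra_def fun_eq_iff)

declare path_end.simps [simp del]

lemma path_end_Nil [simp]: "path_end (i, []) = i"
  and path_end_Cons [simp]: "path_end (i, a # as) = path_end (tgt a, as)"
  by (simp_all add: path_end.simps)

lemma path_end_append [simp]: "path_end (i, as @ bs) = path_end (path_end (i, as), bs)"
  by (induction as arbitrary: i) auto

lemma is_path_vertex: "is_path n (i, as) \<Longrightarrow> i \<in> vertices n"
  by (cases as) auto

lemma is_path_append:
  "is_path n (i, as @ bs) \<longleftrightarrow> is_path n (i, as) \<and> is_path n (path_end (i, as), bs)"
  by (induction as arbitrary: i) (auto dest: is_path_vertex)

lemma path_mult_nonzero:
  assumes "path_mult f g p \<noteq> 0"
  obtains q r where "f q \<noteq> 0" "g r \<noteq> 0" "path_end r = fst q" "p = path_comp q r"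
proof -
  obtain i as where p: "p = (i, as)" by force
  have "(\<Sum>t\<le>length as. f (path_end (i, take t as), drop t as) * g (i, take t as)) \<noteq> 0"
    using assms p by simp
  then obtain t where "t \<le> length as" "f (path_end (i, take t as), drop t as) * g (i, take t as) \<noteq> 0"
    by (meson sum.not_neutral_contains_not_neutral atMost_iff)
  then show ?thesis
    by (intro that[of "(path_end (i, take t as), drop t as)" "(i, take t as)"]) (auto simp: p path_comp_def)
qed

lemma path_mult_closed:
  assumes f: "f \<in> carrier (path_algebra n)" and g: "g \<in> carrier (path_algebra n)"
  shows "path_mult f g \<in> carrier (path_algebra n)"
  unfolding path_algebra_carrier
proof (intro conjI allI impI)
  have "supp (path_mult f g) \<subseteq> (\<lambda>(q, r). path_comp q r) ` (supp f \<times> supp g)"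
  proof
    fix p assume "p \<in> supp (path_mult f g)"
    then have "path_mult f g p \<noteq> 0" by (simp add: supp_def)
    then obtain q r where "f q \<noteq> 0" "g r \<noteq> 0" "p = path_comp q r" by (rule path_mult_nonzero)
    then show "p \<in> (\<lambda>(q, r). path_comp q r) ` (supp f \<times> supp g)" by (auto simp: supp_def)
  qed
  then show "finite (supp (path_mult f g))"
    using f g by (rule_tac finite_subset) (auto simp: path_algebra_carrier)
  fix p assume "path_mult f g p \<noteq> 0"
  then obtain q r where qr: "f q \<noteq> 0" "g r \<noteq> 0" "path_end r = fst q" "p = path_comp q r"
    by (rule path_mult_nonzero)
  then have "is_path n q" "is_path n r" using f g path_algebra_is_path by blast+
  then show "is_path n p"
    using qr by (cases q; cases r) (auto simp: path_comp_def is_path_append)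
qed

text \<open>Both sides sum over the ways to cut a path into three pieces. The indices pass from the
  lengths \<open>t\<close>, \<open>s\<close> of the first two pieces to the cuts \<open>t\<close>
  and \<open>u = t + s\<close>.\<close>

lemma path_mult_assoc:
  fixes f g h :: "path \<Rightarrow> 'k::field"
  shows "path_mult (path_mult f g) h = path_mult f (path_mult g h)" (is "?L = ?R")
proof (rule ext)
  fix p :: path
  obtain i as where p: "p = (i, as)" by force
  let ?N = "length as"
  let ?F = "\<lambda>t s. f (path_end (i, take (t + s) as), drop (t + s) as) *
      (g (path_end (i, take t as), take s (drop t as)) * h (i, take t as))"
  have "?L p = (\<Sum>t\<le>?N. \<Sum>s\<le>?N - t. ?F t s)"
    unfolding p by (auto simp: p sum_distrib_right take_add mult.assoc add.commute intro!: sum.cong)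
  also have "\<dots> = (\<Sum>(t, s)\<in>Sigma {..?N} (\<lambda>t. {..?N - t}). ?F t s)"
    by (simp add: sum.Sigma)
  also have "\<dots> = (\<Sum>(u, t)\<in>Sigma {..?N} (\<lambda>u. {..u}). ?F t (u - t))"
    by (rule sum.reindex_bij_witness[where i = "\<lambda>(u, t). (t, u - t)" and j = "\<lambda>(t, s). (t + s, t)"]) auto
  also have "\<dots> = (\<Sum>u\<le>?N. \<Sum>t\<le>u. ?F t (u - t))"
    by (rule sum.Sigma[symmetric]) auto
  also have "\<dots> = ?R p"
    unfolding p by (auto simp: sum_distrib_left min_absorb1 min_absorb2 take_drop intro!: sum.cong)
  finally show "?L p = ?R p" .
qed

lemma finite_vertices: "finite (vertices n)"
  by (simp add: vertices_def)

lemma path_algebra_one_closed: "\<one>\<^bsub>path_algebra n\<^esub> \<in> carrier (path_algebra n)"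
proof -
  have "supp (\<one>\<^bsub>path_algebra n\<^esub> :: path \<Rightarrow> 'a::field) \<subseteq> (\<lambda>i. (i, [])) ` vertices n"
    by (auto simp: supp_def path_algebra_one split: if_splits)
  then have "finite (supp (\<one>\<^bsub>path_algebra n\<^esub> :: path \<Rightarrow> 'a::field))"
    by (rule finite_subset) (simp add: finite_vertices)
  then show ?thesis unfolding path_algebra_carrier by (auto simp: path_algebra_one split: if_splits)
qed

lemma path_algebra_add_closed:
  assumes f: "f \<in> carrier (path_algebra n)" and g: "g \<in> carrier (path_algebra n)"
  shows "(\<lambda>p. f p + g p) \<in> carrier (path_algebra n)"
proof -
  have "supp (\<lambda>p. f p + g p) \<subseteq> supp f \<union> supp g" by (auto simp: supp_def)
  then have "finite (supp (\<lambda>p. f p + g p))" using f g finite_subset by (auto simp: path_algebra_carrier)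
  moreover have "is_path n p" if "f p + g p \<noteq> 0" for p
    using that path_algebra_is_path[OF f, of p] path_algebra_is_path[OF g, of p] by (cases "f p = 0") auto
  ultimately show ?thesis by (auto simp: path_algebra_carrier)
qed

lemma path_algebra_scale_closed:
  assumes f: "f \<in> carrier (path_algebra n)"
  shows "(\<lambda>p. c * f p) \<in> carrier (path_algebra n)"
proof -
  have "supp (\<lambda>p. c * f p) \<subseteq> supp f" by (auto simp: supp_def)
  then show ?thesis using f finite_subset by (auto simp: path_algebra_carrier)
qed

lemma path_algebra_zero_closed: "(\<lambda>p. 0) \<in> carrier (path_algebra n)"
  by (simp add: path_algebra_carrier supp_def)

lemma path_algebra_ring: "ring (path_algebra n :: (path \<Rightarrow> 'k::field) ring)"
proof (rule ringI)
  let ?A = "path_algebra n :: (path \<Rightarrow> 'k) ring"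
  show "abelian_group ?A"
  proof (rule abelian_groupI)
    fix f assume f: "f \<in> carrier ?A"
    show "\<exists>g\<in>carrier ?A. g \<oplus>\<^bsub>?A\<^esub> f = \<zero>\<^bsub>?A\<^esub>"
      by (rule bexI[of _ "\<lambda>p. (-1) * f p"]) (use path_algebra_scale_closed[OF f, of "-1"] in auto)
  qed (auto simp: path_algebra_add_closed path_algebra_zero_closed algebra_simps)
  show "monoid ?A"
  proof (rule monoidI)
    fix f assume f: "f \<in> carrier ?A"
    have path: "f (i, as) = 0" if "\<not> is_path n (i, as)" for i as
      using f that by (auto simp: path_algebra_carrier)
    have nz: "i \<in> vertices n" "path_end (i, as) \<in> vertices n" if "f (i, as) \<noteq> 0" for i as
      using f that is_path_append[of n i as "[]"] by (auto simp: path_algebra_carrier intro: is_path_vertex)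
    show "\<one>\<^bsub>?A\<^esub> \<otimes>\<^bsub>?A\<^esub> f = f"
    proof (rule ext, clarify)
      fix i as
      have "(\<Sum>t\<le>length as. \<one>\<^bsub>?A\<^esub> (path_end (i, take t as), drop t as) * f (i, take t as)) =
          (\<Sum>t\<le>length as. if t = length as then f (i, as) else 0)"
        using nz(2)[of i as] by (intro sum.cong) (auto simp: path_algebra_one)
      then show "(\<one>\<^bsub>?A\<^esub> \<otimes>\<^bsub>?A\<^esub> f) (i, as) = f (i, as)" by simp
    qed
    show "f \<otimes>\<^bsub>?A\<^esub> \<one>\<^bsub>?A\<^esub> = f"
    proof (rule ext, clarify)
      fix i as
      have "(\<Sum>t\<le>length as. f (path_end (i, take t as), drop t as) * \<one>\<^bsub>?A\<^esub> (i, take t as)) =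
          (\<Sum>t\<le>length as. if t = 0 then f (i, as) else 0)"
        using nz(1)[of i as] by (intro sum.cong) (auto simp: path_algebra_one)
      then show "(f \<otimes>\<^bsub>?A\<^esub> \<one>\<^bsub>?A\<^esub>) (i, as) = f (i, as)" by simp
    qed
  qed (simp_all only: path_algebra_mult path_mult_closed path_mult_assoc path_algebra_one_closed)
qed (auto simp: fun_eq_iff sum.distrib algebra_simps)

lemma path_algebra_uminus:
  assumes "f \<in> carrier (path_algebra n)"
  shows "\<ominus>\<^bsub>path_algebra n\<^esub> f = (\<lambda>p. - f p :: 'k::field)"
proof -
  interpret A: ring "path_algebra n :: (path \<Rightarrow> 'k) ring" by (rule path_algebra_ring)
  show ?thesis
    by (rule A.minus_equality) (use path_algebra_scale_closed[OF assms, of "-1"] assms in auto)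
qed

lemma path_algebra_minus:
  assumes "f \<in> carrier (path_algebra n)" "g \<in> carrier (path_algebra n)"
  shows "f \<ominus>\<^bsub>path_algebra n\<^esub> g = (\<lambda>p. f p - g p :: 'k::field)"
  using assms by (simp add: a_minus_def path_algebra_uminus)

lemma path_elt_closed: "is_path n p \<Longrightarrow> path_elt p \<in> carrier (path_algebra n)"
  by (auto simp: path_algebra_carrier path_elt_def supp_def split: if_splits)

text \<open>Computes the action of a product, with \<open>F\<close> the action of single paths.
  Several composable pairs may give the same path, so each coefficient of the product is a sum over
  a fibre, and the fibres are then collected.\<close>

lemma path_mult_sum:
  fixes c d :: "path \<Rightarrow> 'k::field"
  assumes c: "finite (supp c)" and d: "finite (supp d)"
  shows "(\<Sum>r\<in>supp (path_mult c d). path_mult c d r * F r) =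
    (\<Sum>p\<in>supp c. \<Sum>q\<in>supp d. if path_end q = fst p then c p * d q * F (path_comp p q) else 0)"
proof -
  define S where "S = {(p, q) \<in> supp c \<times> supp d. path_end q = fst p}"
  define B where "B = (\<lambda>(p, q). path_comp p q) ` S"
  have S: "finite S" using c d by (auto simp: S_def intro: finite_subset[of _ "supp c \<times> supp d"])
  have val: "path_mult c d r = (\<Sum>(p, q)\<in>{x \<in> S. (\<lambda>(p, q). path_comp p q) x = r}. c p * d q)" for r
  proof -
    obtain i as where r: "r = (i, as)" by force
    let ?g = "\<lambda>t. c (path_end (i, take t as), drop t as) * d (i, take t as)"
    have "sum ?g {..length as} = (\<Sum>(p, q)\<in>{x \<in> S. (\<lambda>(p, q). path_comp p q) x = r}. c p * d q)"
      \<comment> \<open>Cuts with vanishing summand have no counterpart among the pairs in the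
        supports and are set aside.\<close>
      by (rule sum.reindex_bij_witness_not_neutral[where S' = "{t \<in> {..length as}. ?g t = 0}" and T' = "{}"
            and j = "\<lambda>t. ((path_end (i, take t as), drop t as), (i, take t as))"
            and i = "\<lambda>(p, q). length (snd q)"])
        (auto simp: S_def supp_def path_comp_def r)
    then show ?thesis by (simp add: r)
  qed
  have "supp (path_mult c d) \<subseteq> B"
  proof
    fix r assume "r \<in> supp (path_mult c d)"
    then have "path_mult c d r \<noteq> 0" by (simp add: supp_def)
    then obtain p q where "c p \<noteq> 0" "d q \<noteq> 0" "path_end q = fst p" "r = path_comp p q"
      by (rule path_mult_nonzero)
    then show "r \<in> B" by (force simp: B_def S_def supp_def)
  qed
  moreover have "finite B" using S by (simp add: B_def)
  ultimately have "(\<Sum>r\<in>supp (path_mult c d). path_mult c d r * F r) = (\<Sum>r\<in>B. path_mult c d r * F r)"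
    by (intro sum.mono_neutral_left) (auto simp: supp_def)
  also have "\<dots> = (\<Sum>r\<in>B. \<Sum>(p, q)\<in>{x \<in> S. (\<lambda>(p, q). path_comp p q) x = r}. c p * d q * F (path_comp p q))"
    by (intro sum.cong refl) (auto simp: val sum_distrib_right intro!: sum.cong)
  also have "\<dots> = (\<Sum>(p, q)\<in>S. c p * d q * F (path_comp p q))"
    by (rule sum.group[OF S \<open>finite B\<close>]) (auto simp: B_def)
  also have "\<dots> = (\<Sum>(p, q)\<in>supp c \<times> supp d. if path_end q = fst p then c p * d q * F (path_comp p q) else 0)"
    by (rule sum.mono_neutral_cong_left) (use c d in \<open>auto simp: S_def split: if_splits\<close>)
  also have "\<dots> = (\<Sum>p\<in>supp c. \<Sum>q\<in>supp d. if path_end q = fst p then c p * d q * F (path_comp p q) else 0)"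
    by (simp add: sum.cartesian_product)
  finally show ?thesis .
qed

section \<open>The preprojective algebra as a quotient\<close>

lemma preproj_relations_closed:
  assumes "4 \<le> n"
  shows "preproj_relations n \<subseteq> carrier (path_algebra n :: (path \<Rightarrow> 'k::field) ring)"
proof -
  interpret A: ring "path_algebra n :: (path \<Rightarrow> 'k) ring" by (rule path_algebra_ring)
  have "is_path n (1, [X 1, Y 2])" "is_path n (-1, [X1', Y2'])" "is_path n (2, [X 2, Y 3])"
    "is_path n (2, [Y 2, X 1])" "is_path n (2, [Y2', X1'])" "is_path n (n-1, [Y (n-1), X (n-2)])"
    "\<And>i. 3 \<le> i \<Longrightarrow> i \<le> n - 2 \<Longrightarrow> is_path n (i, [X i, Y (i+1)])"
    "\<And>i. 3 \<le> i \<Longrightarrow> i \<le> n - 2 \<Longrightarrow> is_path n (i, [Y i, X (i-1)])"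
    using assms by (auto simp: vertices_def arrows_def)
  note p = this[THEN path_elt_closed, where 'a = 'k]
  show ?thesis unfolding preproj_relations_def
    using p by (auto simp del: path_algebra_add)
qed

lemma preproj_ideal_ideal:
  assumes "4 \<le> n"
  shows "ideal (preproj_ideal n) (path_algebra n :: (path \<Rightarrow> 'k::field) ring)"
  unfolding preproj_ideal_def
  by (rule ring.genideal_ideal[OF path_algebra_ring preproj_relations_closed[OF assms]])

lemma preproj_ring: "4 \<le> n \<Longrightarrow> ring (preproj n :: (path \<Rightarrow> 'k::field) set ring)"
  unfolding preproj_def by (rule ideal.quotient_is_ring[OF preproj_ideal_ideal])

section \<open>The representation on the array\<close>

definition linear_map :: "(('e \<Rightarrow> 'k::field) \<Rightarrow> ('f \<Rightarrow> 'k)) \<Rightarrow> bool" where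
  "linear_map T \<longleftrightarrow> (\<forall>f g. T (\<lambda>e. f e + g e) = (\<lambda>e. T f e + T g e)) \<and> (\<forall>c f. T (\<lambda>e. c * f e) = (\<lambda>e. c * T f e))"

lemma linear_map_add: "linear_map T \<Longrightarrow> T (\<lambda>e. f e + g e) = (\<lambda>e. T f e + T g e)"
  and linear_map_scale: "linear_map T \<Longrightarrow> T (\<lambda>e. c * f e) = (\<lambda>e. c * T f e)"
  by (simp_all add: linear_map_def)

lemma linear_map_zero: "linear_map T \<Longrightarrow> T (\<lambda>e. 0) = (\<lambda>e. 0)"
  using linear_map_scale[of T 0 "\<lambda>e. 0"] by simp

lemma linear_map_sum:
  assumes "linear_map T" "finite Q"
  shows "T (\<lambda>e. \<Sum>q\<in>Q. c q * h q e) = (\<lambda>e. \<Sum>q\<in>Q. c q * T (h q) e)"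
  using assms(2)
proof induction
  case (insert q Q)
  have "T (\<lambda>e. c q * h q e + (\<Sum>q\<in>Q. c q * h q e)) = (\<lambda>e. T (\<lambda>e. c q * h q e) e + T (\<lambda>e. \<Sum>q\<in>Q. c q * h q e) e)"
    by (rule linear_map_add[OF assms(1)])
  also have "T (\<lambda>e. c q * h q e) = (\<lambda>e. c q * T (h q) e)"
    by (rule linear_map_scale[OF assms(1)])
  finally show ?case using insert by simp
qed (simp add: linear_map_zero[OF assms(1)])

lemma linear_map_comp: "\<lbrakk>linear_map S; linear_map T\<rbrakk> \<Longrightarrow> linear_map (\<lambda>f. S (T f))"
  by (simp add: linear_map_def)

lemma linear_map_fold: "(\<And>a. linear_map (T a)) \<Longrightarrow> linear_map (fold T as)"
proof (induction as)
  case (Cons a as)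
  then have "linear_map (\<lambda>f. fold T as (T a f))" by (intro linear_map_comp[of "fold T as" "T a"]) auto
  then show ?case by (simp add: comp_def)
qed (simp add: linear_map_def)

lemma linear_map_arrow_act: "linear_map (arrow_act n l \<alpha> \<beta> a)"
  by (auto simp: linear_map_def arrow_act_def fun_eq_iff sum.distrib sum_distrib_left algebra_simps)

lemma linear_map_path_act: "linear_map (path_act n l \<alpha> \<beta> p)"
proof -
  have "linear_map (\<lambda>f e. if entry_vertex e = fst p then f e else (0::'a))"
    by (auto simp: linear_map_def fun_eq_iff)
  then show ?thesis unfolding path_act_def[abs_def]
    by (rule linear_map_comp[OF linear_map_fold[OF linear_map_arrow_act]])
qed

lemma path_algebra_act_eq: "path_algebra_act n l \<alpha> \<beta> c f = (\<lambda>e. \<Sum>p\<in>supp c. c p * path_act n l \<alpha> \<beta> p f e)"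
  by (simp add: path_algebra_act_def supp_def)

text \<open>The supports of sums and multiples vary, so identities are checked over a common finite
  set.\<close>

lemma path_algebra_act_superset:
  assumes "finite B" "supp c \<subseteq> B"
  shows "path_algebra_act n l \<alpha> \<beta> c f e = (\<Sum>p\<in>B. c p * path_act n l \<alpha> \<beta> p f e)"
  unfolding path_algebra_act_eq using assms by (intro sum.mono_neutral_left) (auto simp: supp_def)

lemma path_algebra_act_add:
  assumes "finite (supp c)" "finite (supp d)"
  shows "path_algebra_act n l \<alpha> \<beta> (\<lambda>p. c p + d p) f e = path_algebra_act n l \<alpha> \<beta> c f e + path_algebra_act n l \<alpha> \<beta> d f e"
proof -
  have "supp (\<lambda>p. c p + d p) \<subseteq> supp c \<union> supp d" by (auto simp: supp_def)
  then show ?thesis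
    using path_algebra_act_superset[of "supp c \<union> supp d" "\<lambda>p. c p + d p"]
      path_algebra_act_superset[of "supp c \<union> supp d" c] path_algebra_act_superset[of "supp c \<union> supp d" d] assms
    by (simp add: sum.distrib algebra_simps)
qed

lemma path_algebra_act_scale:
  assumes "finite (supp c)"
  shows "path_algebra_act n l \<alpha> \<beta> (\<lambda>p. r * c p) f e = r * path_algebra_act n l \<alpha> \<beta> c f e"
proof -
  have "supp (\<lambda>p. r * c p) \<subseteq> supp c" by (auto simp: supp_def)
  then show ?thesis
    using path_algebra_act_superset[OF assms, of "\<lambda>p. r * c p"] path_algebra_act_superset[OF assms, of c]
    by (simp add: sum_distrib_left algebra_simps)
qed

lemma path_algebra_act_path_elt: "path_algebra_act n l \<alpha> \<beta> (path_elt p) f = path_act n l \<alpha> \<beta> p f"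
  using path_algebra_act_superset[of "{p}" "path_elt p" n l \<alpha> \<beta> f]
  by (auto simp: supp_def path_elt_def fun_eq_iff)

lemma linear_map_path_algebra_act:
  assumes "finite (supp c)"
  shows "linear_map (path_algebra_act n l \<alpha> \<beta> c)"
proof -
  have "path_act n l \<alpha> \<beta> p (\<lambda>e. f e + g e) = (\<lambda>e. path_act n l \<alpha> \<beta> p f e + path_act n l \<alpha> \<beta> p g e)"
    "path_act n l \<alpha> \<beta> p (\<lambda>e. r * f e) = (\<lambda>e. r * path_act n l \<alpha> \<beta> p f e)" for p f g r
    by (rule linear_map_add[OF linear_map_path_act] linear_map_scale[OF linear_map_path_act])+
  then show ?thesis
    by (simp add: linear_map_def path_algebra_act_eq fun_eq_iff sum.distrib sum_distrib_left algebra_simps)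
qed

section \<open>The path algebra acts on vectors supported in the array\<close>

definition array_vectors :: "int \<Rightarrow> int \<Rightarrow> (entry \<Rightarrow> 'k::field) set" where
  "array_vectors n l = {f. \<forall>e. e \<notin> array n l \<longrightarrow> f e = 0}"

lemma finite_array: "finite (array n l)"
  by (rule finite_subset[of _ "{l..n-1} \<times> {1-n..n-1}"]) (auto simp: array_def)

lemma entry_vertex_in_vertices: "\<lbrakk>2 \<le> l; e \<in> array n l\<rbrakk> \<Longrightarrow> entry_vertex e \<in> vertices n"
  by (cases e) (auto simp: array_def vertices_def)

lemma arrow_act_supported: "arrow_act n l \<alpha> \<beta> a f e \<noteq> 0 \<Longrightarrow> e \<in> array n l \<and> entry_vertex e = tgt a"
  by (auto simp: arrow_act_def split: if_splits)

lemma arrow_act_vectors: "arrow_act n l \<alpha> \<beta> a f \<in> array_vectors n l"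
  by (auto simp: arrow_act_def array_vectors_def)

lemma fold_arrow_act_supported:
  assumes "\<And>e. g e \<noteq> 0 \<Longrightarrow> e \<in> array n l \<and> entry_vertex e = i"
    and "fold (arrow_act n l \<alpha> \<beta>) as g e \<noteq> 0"
  shows "e \<in> array n l \<and> entry_vertex e = path_end (i, as)"
  using assms
proof (induction as arbitrary: g i)
  case (Cons a as)
  have "\<And>e. arrow_act n l \<alpha> \<beta> a g e \<noteq> 0 \<Longrightarrow> e \<in> array n l \<and> entry_vertex e = tgt a"
    using arrow_act_supported by blast
  then show ?case using Cons.IH[of "arrow_act n l \<alpha> \<beta> a g" "tgt a"] Cons.prems(2) by simp
qed auto

lemma path_act_supported:
  assumes "f \<in> array_vectors n l" "path_act n l \<alpha> \<beta> p f e \<noteq> 0"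
  shows "e \<in> array n l" "entry_vertex e = path_end p"
proof -
  have "e \<in> array n l \<and> entry_vertex e = path_end (fst p, snd p)"
    by (rule fold_arrow_act_supported[OF _ assms(2)[unfolded path_act_def]])
      (use assms(1) in \<open>auto simp: array_vectors_def split: if_splits\<close>)
  then show "e \<in> array n l" "entry_vertex e = path_end p" by simp_all
qed

lemma path_act_vectors: "f \<in> array_vectors n l \<Longrightarrow> path_act n l \<alpha> \<beta> p f \<in> array_vectors n l"
  using path_act_supported unfolding array_vectors_def by blast

lemma path_algebra_act_vectors:
  "f \<in> array_vectors n l \<Longrightarrow> path_algebra_act n l \<alpha> \<beta> c f \<in> array_vectors n l"
  using path_act_vectors[of f n l \<alpha> \<beta>] by (auto simp: array_vectors_def path_algebra_act_def)

text \<open>The result of following a path lives on its end vertex, so the projection at the start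
  of the next path either changes nothing or gives 0.\<close>

lemma path_act_comp:
  assumes f: "f \<in> array_vectors n l"
  shows "path_act n l \<alpha> \<beta> p (path_act n l \<alpha> \<beta> q f) =
    (if path_end q = fst p then path_act n l \<alpha> \<beta> (path_comp p q) f else (\<lambda>e. 0))"
proof -
  have "(\<lambda>e. if entry_vertex e = fst p then path_act n l \<alpha> \<beta> q f e else 0) =
      (if path_end q = fst p then path_act n l \<alpha> \<beta> q f else (\<lambda>e. 0))"
    using path_act_supported(2)[OF f, of \<alpha> \<beta> q] by (fastforce simp: fun_eq_iff)
  then have "path_act n l \<alpha> \<beta> p (path_act n l \<alpha> \<beta> q f) =
      fold (arrow_act n l \<alpha> \<beta>) (snd p) (if path_end q = fst p then path_act n l \<alpha> \<beta> q f else (\<lambda>e. 0))"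
    by (subst path_act_def) (simp only:)
  also have "\<dots> = (if path_end q = fst p then path_act n l \<alpha> \<beta> (path_comp p q) f else (\<lambda>e. 0))"
    using linear_map_zero[OF linear_map_fold[OF linear_map_arrow_act]]
    by (auto simp: path_act_def path_comp_def)
  finally show ?thesis .
qed

lemma path_algebra_act_mult:
  assumes f: "f \<in> array_vectors n l" and c: "finite (supp c)" and d: "finite (supp d)"
  shows "path_algebra_act n l \<alpha> \<beta> (path_mult c d) f = path_algebra_act n l \<alpha> \<beta> c (path_algebra_act n l \<alpha> \<beta> d f)"
proof
  fix e
  let ?P = "path_act n l \<alpha> \<beta>"
  have "path_algebra_act n l \<alpha> \<beta> (path_mult c d) f e =
      (\<Sum>p\<in>supp c. \<Sum>q\<in>supp d. if path_end q = fst p then c p * d q * ?P (path_comp p q) f e else 0)"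
    unfolding path_algebra_act_eq by (rule path_mult_sum[OF c d])
  also have "\<dots> = (\<Sum>p\<in>supp c. c p * (\<Sum>q\<in>supp d. d q * ?P p (?P q f) e))"
    unfolding sum_distrib_left by (intro sum.cong refl) (simp add: path_act_comp[OF f] algebra_simps)
  also have "\<dots> = path_algebra_act n l \<alpha> \<beta> c (path_algebra_act n l \<alpha> \<beta> d f) e"
    unfolding path_algebra_act_eq linear_map_sum[OF linear_map_path_act d] ..
  finally show "path_algebra_act n l \<alpha> \<beta> (path_mult c d) f e =
    path_algebra_act n l \<alpha> \<beta> c (path_algebra_act n l \<alpha> \<beta> d f) e" .
qed

lemma path_algebra_act_one:
  fixes f :: "entry \<Rightarrow> 'k::field"
  assumes f: "f \<in> array_vectors n l" and l: "2 \<le> l"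
  shows "path_algebra_act n l \<alpha> \<beta> \<one>\<^bsub>path_algebra n\<^esub> f = f"
proof
  fix e
  have "supp (\<one>\<^bsub>path_algebra n\<^esub> :: path \<Rightarrow> 'k) = (\<lambda>i. (i, [])) ` vertices n"
    by (auto simp: supp_def path_algebra_one split: if_splits)
  then have "path_algebra_act n l \<alpha> \<beta> \<one>\<^bsub>path_algebra n\<^esub> f e =
      (\<Sum>i\<in>vertices n. if i = entry_vertex e then f e else 0)"
    unfolding path_algebra_act_eq
    by (auto simp: sum.reindex inj_on_def path_algebra_one path_act_def intro!: sum.cong)
  also have "\<dots> = f e"
  proof (cases "e \<in> array n l")
    case True
    then show ?thesis using entry_vertex_in_vertices[OF l] by (simp add: finite_vertices)
  next
    case False
    then have "f e = 0" using f unfolding array_vectors_def by blast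
    then show ?thesis by (simp add: finite_vertices)
  qed
  finally show "path_algebra_act n l \<alpha> \<beta> \<one>\<^bsub>path_algebra n\<^esub> f e = f e" .
qed

locale array_rep =
  fixes n l :: int and \<alpha> \<beta> :: "'k::field"
  assumes n4: "4 \<le> n" and l2: "2 \<le> l" and ln: "l \<le> n - 1" and sum1: "\<alpha> + \<beta> = 1"
begin

abbreviation "E \<equiv> array n l"
abbreviation "V \<equiv> array_vectors n l :: (entry \<Rightarrow> 'k) set"
abbreviation "arr \<equiv> arrow_act n l \<alpha> \<beta>"
abbreviation "act \<equiv> path_algebra_act n l \<alpha> \<beta>"
abbreviation "A \<equiv> path_algebra n :: (path \<Rightarrow> 'k) ring"

lemma array_iff: "(m, v) \<in> E \<longleftrightarrow> l \<le> m \<and> m \<le> n - 1 \<and> m - l + 1 - n \<le> v \<and> v \<le> m \<and> v \<noteq> 0"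
  by (simp add: array_def)

lemma upper_pred: "upper l (m - 1) = - upper l m" and upper_succ: "upper l (m + 1) = - upper l m"
  by (auto simp: upper_def)

lemma upper_cases: "upper l m = 1 \<or> upper l m = -1"
  by (simp add: upper_def)

lemma V_zero: "\<lbrakk>f \<in> V; e \<notin> E\<rbrakk> \<Longrightarrow> f e = 0"
  unfolding array_vectors_def by blast

text \<open>\<open>P\<close> may contain pairs outside the array, because \<open>f\<close> vanishes
  there; the possible sources can thus be listed uniformly.\<close>

lemma arrow_act_candidates:
  assumes f: "f \<in> V" and e': "e' \<in> E" "entry_vertex e' = tgt a"
    and P: "finite P" "\<And>e. e \<in> P \<Longrightarrow> entry_vertex e = src a"
      "\<And>e. \<lbrakk>entry_vertex e = src a; scalar l \<alpha> \<beta> e e' \<noteq> 0\<rbrakk> \<Longrightarrow> e \<in> P"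
  shows "arr a f e' = (\<Sum>e\<in>P. scalar l \<alpha> \<beta> e e' * f e)"
proof -
  have "arr a f e' = (\<Sum>e | e \<in> E \<and> entry_vertex e = src a. scalar l \<alpha> \<beta> e e' * f e)"
    using e' by (simp add: arrow_act_def)
  also have "\<dots> = (\<Sum>e\<in>P. scalar l \<alpha> \<beta> e e' * f e)"
    by (rule sum.mono_neutral_cong)
      (use P V_zero[OF f] finite_array[of n l] in \<open>auto simp del: scalar.simps entry_vertex.simps\<close>)
  finally show ?thesis .
qed

text \<open>Vectors vanish outside the array, so the boundary of the array needs no case distinction here.\<close>

fun arrow_formula :: "arrow \<Rightarrow> (entry \<Rightarrow> 'k) \<Rightarrow> int \<Rightarrow> int \<Rightarrow> 'k" where
  "arrow_formula (X i) f m v =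
    (if i = 1 then
       (if v = 2 then (if upper l m = -1 then \<alpha> else \<beta>) * f (m - 1, 1)
        else if v = -2 then (if upper l m = 1 then 1 else -1) * f (m, 1) else 0)
     else (if v = i + 1 then f (m - 1, i) else if v = - (i + 1) then f (m, - i) else 0))"
| "arrow_formula X1' f m v =
    (if v = 2 then (if upper l m = 1 then \<alpha> else \<beta>) * f (m - 1, -1)
     else if v = -2 then (if upper l m = -1 then 1 else -1) * f (m, -1) else 0)"
| "arrow_formula (Y i) f m v =
    (if i = 2 then (if v = 1 then f (m, 2) + (if upper l m = 1 then \<beta> else - \<alpha>) * f (m - 1, -2) else 0)
     else (if v = i - 1 then f (m, i) else if v = - (i - 1) then f (m - 1, - i) else 0))"
| "arrow_formula Y2' f m v =
    (if v = -1 then f (m, 2) + (if upper l m = -1 then \<beta> else - \<alpha>) * f (m - 1, -2) else 0)"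

lemma arrow_act_formula:
  assumes f: "f \<in> V" and a: "a \<in> arrows n"
  shows "arr a f (m, v) = (if (m, v) \<in> E then arrow_formula a f m v else 0)"
proof (cases "(m, v) \<in> E \<and> entry_vertex (m, v) = tgt a")
  case False
  have "arr a f (m, v) = 0" using False by (auto simp: arrow_act_def)
  moreover have "arrow_formula a f m v = 0" if "(m, v) \<in> E"
    using False that a by (cases a) (auto simp: arrows_def split: if_splits)
  ultimately show ?thesis by simp
next
  case True
  note cand = arrow_act_candidates[OF f, of "(m, v)" a]
  have eq: "arr a f (m, v) = (\<Sum>e\<in>P. scalar l \<alpha> \<beta> e (m, v) * f e)"
    if "finite P" "\<forall>m' v'. (m', v') \<in> P \<longrightarrow> entry_vertex (m', v') = src a"
      "\<forall>m' v'. entry_vertex (m', v') = src a \<and> (h_arrow (m', v') (m, v) \<or> v_arrow (m', v') (m, v)) \<longrightarrow> (m', v') \<in> P" for P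
    by (rule cand) (use True that in \<open>auto simp del: entry_vertex.simps split: if_splits\<close>)
  have v: "v \<noteq> 0" using True by (auto simp: array_iff)
  show ?thesis
  proof (cases a)
    case (X i)
    then have i: "1 \<le> i" "i \<le> n - 2" using a by (auto simp: arrows_def)
    have "v = i + 1 \<or> v = - (i + 1)" using True X i by (auto split: if_splits)
    then show ?thesis
    proof
      assume v: "v = i + 1"
      have "arr a f (m, v) = (\<Sum>e\<in>{(m - 1, i)}. scalar l \<alpha> \<beta> e (m, v) * f e)"
        by (rule eq) (use X i v in \<open>auto simp: h_arrow_def v_arrow_def split: if_splits\<close>)
      then show ?thesis
        using True X i v upper_cases[of m] by (auto simp: upper_pred h_arrow_def v_arrow_def single_def)
    next
      assume v: "v = - (i + 1)"
      have "arr a f (m, v) = (\<Sum>e\<in>{(m, if i = 1 then 1 else - i)}. scalar l \<alpha> \<beta> e (m, v) * f e)"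
        by (rule eq) (use X i v in \<open>auto simp: h_arrow_def v_arrow_def split: if_splits\<close>)
      then show ?thesis
        using True X i v upper_cases[of m] by (auto simp: upper_pred h_arrow_def v_arrow_def single_def)
    qed
  next
    case X1'
    have "v = 2 \<or> v = -2" using True X1' by (auto split: if_splits)
    then show ?thesis
    proof
      assume v: "v = 2"
      have "arr a f (m, v) = (\<Sum>e\<in>{(m - 1, -1)}. scalar l \<alpha> \<beta> e (m, v) * f e)"
        by (rule eq) (use X1' v in \<open>auto simp: h_arrow_def v_arrow_def split: if_splits\<close>)
      then show ?thesis
        using True X1' v upper_cases[of m] by (auto simp: upper_pred h_arrow_def v_arrow_def single_def)
    next
      assume v: "v = -2"
      have "arr a f (m, v) = (\<Sum>e\<in>{(m, -1)}. scalar l \<alpha> \<beta> e (m, v) * f e)"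
        by (rule eq) (use X1' v in \<open>auto simp: h_arrow_def v_arrow_def split: if_splits\<close>)
      then show ?thesis
        using True X1' v upper_cases[of m] by (auto simp: upper_pred h_arrow_def v_arrow_def single_def)
    qed
  next
    case (Y i)
    then have i: "2 \<le> i" "i \<le> n - 1" using a by (auto simp: arrows_def)
    have "v = i - 1 \<or> (3 \<le> i \<and> v = - (i - 1))" using True Y i by (auto split: if_splits)
    then show ?thesis
    proof
      assume v: "v = i - 1"
      have "arr a f (m, v) = (\<Sum>e\<in>(if i = 2 then {(m, 2), (m - 1, -2)} else {(m, i)}). scalar l \<alpha> \<beta> e (m, v) * f e)"
        by (rule eq) (use Y i v in \<open>auto simp: h_arrow_def v_arrow_def split: if_splits\<close>)
      then show ?thesis
        using True Y i v upper_cases[of m] by (auto simp: upper_pred h_arrow_def v_arrow_def single_def)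
    next
      assume v: "3 \<le> i \<and> v = - (i - 1)"
      have "arr a f (m, v) = (\<Sum>e\<in>{(m - 1, - i)}. scalar l \<alpha> \<beta> e (m, v) * f e)"
        by (rule eq) (use Y i v in \<open>auto simp: h_arrow_def v_arrow_def split: if_splits\<close>)
      then show ?thesis
        using True Y i v upper_cases[of m] by (auto simp: upper_pred h_arrow_def v_arrow_def single_def)
    qed
  next
    case Y2'
    have v: "v = -1" using True Y2' v by (auto split: if_splits)
    have "arr a f (m, v) = (\<Sum>e\<in>{(m, 2), (m - 1, -2)}. scalar l \<alpha> \<beta> e (m, v) * f e)"
      by (rule eq) (use Y2' v in \<open>auto simp: h_arrow_def v_arrow_def split: if_splits\<close>)
    then show ?thesis
      using True Y2' v upper_cases[of m] by (auto simp: upper_pred h_arrow_def v_arrow_def single_def)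
  qed
qed

lemma path_act_two:
  assumes "f \<in> V" "src a = i"
  shows "path_act n l \<alpha> \<beta> (i, [a, b]) f = arr b (arr a f)"
proof -
  have "arr a (\<lambda>e. if entry_vertex e = i then f e else 0) = arr a f"
    by (auto simp: arrow_act_def assms(2) fun_eq_iff intro!: sum.cong)
  then show ?thesis by (simp add: path_act_def)
qed

lemma arr_V: "arr a f \<in> V"
  by (rule arrow_act_vectors)

text \<open>With the arrow formulas each relation becomes a comparison of coordinates. In the third
  one, the routes from an entry \<open>2\<close> to the next row through 1 and -1 carry
  \<open>\<alpha>\<close> and \<open>\<beta>\<close> and must add up to the route through 3; this is
  where \<open>\<alpha> + \<beta> = 1\<close> enters.\<close>

lemma relation_vanishes:
  assumes f: "f \<in> V"
  shows "arr (Y 2) (arr (X 1) f) = (\<lambda>e. 0)"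
    and "arr Y2' (arr X1' f) = (\<lambda>e. 0)"
    and "arr (Y 3) (arr (X 2) f) e = arr (X 1) (arr (Y 2) f) e + arr X1' (arr Y2' f) e"
    and "arr (X (n - 2)) (arr (Y (n - 1)) f) = (\<lambda>e. 0)"
    and "\<lbrakk>3 \<le> i; i \<le> n - 2\<rbrakk> \<Longrightarrow> arr (Y (i + 1)) (arr (X i) f) = arr (X (i - 1)) (arr (Y i) f)"
proof -
  have arrows: "X 1 \<in> arrows n" "X 2 \<in> arrows n" "X (n - 2) \<in> arrows n" "X1' \<in> arrows n" "Y 2 \<in> arrows n"
    "Y 3 \<in> arrows n" "Y (n - 1) \<in> arrows n" "Y2' \<in> arrows n"
    using n4 by (auto simp: arrows_def)
  note formula = arrow_act_formula[OF f] arrow_act_formula[OF arr_V]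
  have out: "f (m, v) = 0" if "\<not> (l \<le> m \<and> m \<le> n - 1 \<and> m - l + 1 - n \<le> v \<and> v \<le> m \<and> v \<noteq> 0)" for m v
    using V_zero[OF f, of "(m, v)"] that by (simp add: array_iff)
  have \<beta>: "\<beta> * x = x - \<alpha> * x" for x
    using sum1 by (metis add_diff_cancel_left' mult_1 distrib_right)
  show "arr (Y 2) (arr (X 1) f) = (\<lambda>e. 0)"
    using l2 n4 ln upper_cases by (auto simp: fun_eq_iff formula arrows upper_pred array_iff out)
  show "arr Y2' (arr X1' f) = (\<lambda>e. 0)"
    using l2 n4 ln upper_cases by (auto simp: fun_eq_iff formula arrows upper_pred array_iff out)
  show "arr (X (n - 2)) (arr (Y (n - 1)) f) = (\<lambda>e. 0)"
    using l2 n4 ln by (auto simp: fun_eq_iff formula arrows upper_pred array_iff out)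
  show "arr (Y 3) (arr (X 2) f) e = arr (X 1) (arr (Y 2) f) e + arr X1' (arr Y2' f) e"
    using l2 n4 ln upper_cases
    by (cases e) (auto simp: formula arrows upper_pred array_iff out \<beta> algebra_simps)
  show "arr (Y (i + 1)) (arr (X i) f) = arr (X (i - 1)) (arr (Y i) f)" if i: "3 \<le> i" "i \<le> n - 2"
  proof -
    have "X i \<in> arrows n" "X (i - 1) \<in> arrows n" "Y i \<in> arrows n" "Y (i + 1) \<in> arrows n"
      using i by (auto simp: arrows_def)
    then show ?thesis
      using l2 n4 ln i by (auto simp: fun_eq_iff formula array_iff out)
  qed
qed


section \<open>The array as a module over the preprojective algebra\<close>

abbreviation "N \<equiv> preproj_ideal n :: (path \<Rightarrow> 'k) set"
abbreviation "PP \<equiv> preproj n :: (path \<Rightarrow> 'k) set ring"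
abbreviation "M \<equiv> array_module n l \<alpha> \<beta>"
abbreviation "cls c \<equiv> N +>\<^bsub>A\<^esub> c"

definition unit_vec :: "int \<Rightarrow> int \<Rightarrow> entry \<Rightarrow> 'k" where
  "unit_vec m v = (\<lambda>e. if e = (m, v) then 1 else 0)"

lemma supp_finite: "c \<in> carrier A \<Longrightarrow> finite (supp c)"
  by (simp add: path_algebra_carrier)

lemma act_diff:
  assumes "c \<in> carrier A" "d \<in> carrier A"
  shows "act (c \<ominus>\<^bsub>A\<^esub> d) f e = act c f e - act d f e"
proof -
  have "act (\<lambda>p. c p + (-1) * d p) f e = act c f e + act (\<lambda>p. (-1) * d p) f e"
    using assms path_algebra_scale_closed by (intro path_algebra_act_add supp_finite)
  also have "act (\<lambda>p. (-1) * d p) f e = (-1) * act d f e"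
    using assms by (intro path_algebra_act_scale supp_finite)
  finally show ?thesis by (simp add: path_algebra_minus[OF assms])
qed

text \<open>The elements acting as zero form an ideal, so the generating relations decide.\<close>

lemma preproj_ideal_annihilates:
  assumes "c \<in> N" "f \<in> V"
  shows "act c f = (\<lambda>e. 0)"
proof -
  interpret R: ring A by (rule path_algebra_ring)
  let ?K = "{c \<in> carrier A. \<forall>f\<in>V. act c f = (\<lambda>e. 0)}"
  have "ideal ?K A"
  proof (rule idealI[OF R.ring_axioms])
    show "subgroup ?K (add_monoid A)"
    proof (rule R.add.subgroupI)
      have "act (\<lambda>p. 0) f = (\<lambda>e. 0)" for f by (simp add: path_algebra_act_def)
      then show "?K \<noteq> {}" using path_algebra_zero_closed by blast
      show "\<ominus>\<^bsub>A\<^esub> c \<in> ?K" if "c \<in> ?K" for c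
      proof -
        have c: "c \<in> carrier A" using that by simp
        have "act (\<ominus>\<^bsub>A\<^esub> c) f e = (-1) * act c f e" for f e
          using path_algebra_act_scale[OF supp_finite[OF c], of n l \<alpha> \<beta> "-1"]
          by (simp add: path_algebra_uminus[OF c])
        then show ?thesis using that R.a_inv_closed[OF c] by auto
      qed
      show "c \<oplus>\<^bsub>A\<^esub> d \<in> ?K" if "c \<in> ?K" "d \<in> ?K" for c d
        using that path_algebra_add_closed[of c n d] path_algebra_act_add[of c d n l \<alpha> \<beta>] supp_finite
        by (auto simp: fun_eq_iff)
    qed auto
    show "d \<otimes>\<^bsub>A\<^esub> c \<in> ?K" if "c \<in> ?K" "d \<in> carrier A" for c d
      using that R.m_closed[of d c] path_algebra_act_mult[of _ n l d c \<alpha> \<beta>] supp_finite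
        linear_map_zero[OF linear_map_path_algebra_act[OF supp_finite[OF that(2)]]]
      by auto
    show "c \<otimes>\<^bsub>A\<^esub> d \<in> ?K" if "c \<in> ?K" "d \<in> carrier A" for c d
      using that R.m_closed[of c d] path_algebra_act_mult[of _ n l c d \<alpha> \<beta>] supp_finite path_algebra_act_vectors[of _ n l \<alpha> \<beta> d]
      by auto
  qed
  moreover have "preproj_relations n \<subseteq> ?K"
  proof
    fix r assume r: "r \<in> (preproj_relations n :: (path \<Rightarrow> 'k) set)"
    have rA: "r \<in> carrier A" using r preproj_relations_closed[OF n4] by blast
    have "act r f = (\<lambda>e. 0)" if f: "f \<in> V" for f
    proof -
      have p: "is_path n (2, [X 2, Y 3])" "is_path n (2, [Y 2, X 1])" "is_path n (2, [Y2', X1'])"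
        using n4 by (auto simp: vertices_def arrows_def)
      note pc = p[THEN path_elt_closed, where 'a = 'k]
      consider "r = path_elt (1, [X 1, Y 2])" | "r = path_elt (-1, [X1', Y2'])"
        | "r = path_elt (2, [X 2, Y 3]) \<ominus>\<^bsub>A\<^esub> (path_elt (2, [Y 2, X 1]) \<oplus>\<^bsub>A\<^esub> path_elt (2, [Y2', X1']))"
        | "r = path_elt (n-1, [Y (n-1), X (n-2)])"
        | i where "3 \<le> i" "i \<le> n - 2" "r = path_elt (i, [X i, Y (i+1)]) \<ominus>\<^bsub>A\<^esub> path_elt (i, [Y i, X (i-1)])"
        using r unfolding preproj_relations_def by blast
      then show ?thesis
      proof cases
        case 3
        have "act r f e = act (path_elt (2, [X 2, Y 3])) f e -
          (act (path_elt (2, [Y 2, X 1])) f e + act (path_elt (2, [Y2', X1'])) f e)" for e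
          unfolding 3 using pc
          by (subst act_diff) (simp_all add: R.a_closed path_algebra_add_closed path_algebra_act_add supp_finite)
        then show ?thesis
          using relation_vanishes(3)[OF f] by (simp add: fun_eq_iff path_algebra_act_path_elt path_act_two[OF f])
      next
        case (5 i)
        have "is_path n (i, [X i, Y (i+1)])" "is_path n (i, [Y i, X (i-1)])"
          using 5 by (auto simp: vertices_def arrows_def)
        note ic = this[THEN path_elt_closed, where 'a = 'k]
        show ?thesis unfolding 5(3)
          using relation_vanishes(5)[OF f 5(1,2)]
          by (simp add: fun_eq_iff act_diff[OF ic] path_algebra_act_path_elt path_act_two[OF f])
      qed (use relation_vanishes[OF f] in \<open>simp_all add: path_algebra_act_path_elt path_act_two[OF f]\<close>)
    qed
    then show "r \<in> ?K" using rA by blast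
  qed
  ultimately have "N \<subseteq> ?K" unfolding preproj_ideal_def by (rule R.genideal_minimal)
  then show ?thesis using assms by blast
qed

lemma A_abelian_group: "abelian_group A"
  by (rule ring.is_abelian_group[OF path_algebra_ring])

lemma N_ideal: "ideal N A"
  by (rule preproj_ideal_ideal[OF n4])

lemma PP_rep: "x \<in> carrier PP \<Longrightarrow> \<exists>c\<in>carrier A. x = cls c"
  by (auto simp: preproj_def FactRing_def A_RCOSETS_def')

lemma cls_closed: "c \<in> carrier A \<Longrightarrow> cls c \<in> carrier PP"
  by (auto simp: preproj_def FactRing_def A_RCOSETS_def')

lemma cls_mult: "\<lbrakk>c \<in> carrier A; d \<in> carrier A\<rbrakk> \<Longrightarrow> cls c \<otimes>\<^bsub>PP\<^esub> cls d = cls (c \<otimes>\<^bsub>A\<^esub> d)"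
  using ideal.rcoset_mult_add[OF N_ideal] by (simp add: preproj_def FactRing_def)

lemma cls_add: "\<lbrakk>c \<in> carrier A; d \<in> carrier A\<rbrakk> \<Longrightarrow> cls c \<oplus>\<^bsub>PP\<^esub> cls d = cls (c \<oplus>\<^bsub>A\<^esub> d)"
  using abelian_subgroup.a_rcos_sum[OF abelian_subgroupI3[OF ideal.axioms(1)[OF N_ideal] A_abelian_group]]
  by (simp add: preproj_def FactRing_def)

lemma cls_one: "cls \<one>\<^bsub>A\<^esub> = \<one>\<^bsub>PP\<^esub>"
  by (simp add: preproj_def FactRing_def)

lemma M_simps [simp]: "carrier M = V" "f \<oplus>\<^bsub>M\<^esub> g = (\<lambda>e. f e + g e)" "\<zero>\<^bsub>M\<^esub> = (\<lambda>e. 0)"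
  by (simp_all add: array_module_def array_vectors_def)

text \<open>All members of a coset act alike, so the image set is a singleton and
  \<open>the_elem\<close> picks its element.\<close>

lemma smult_cls:
  assumes c: "c \<in> carrier A" and f: "f \<in> V"
  shows "cls c \<odot>\<^bsub>M\<^esub> f = act c f"
proof -
  have "act d f = act c f" if d: "d \<in> cls c" for d
  proof -
    obtain h where h: "h \<in> N" "d = h \<oplus>\<^bsub>A\<^esub> c" using d by (auto simp: a_r_coset_def')
    have "h \<in> carrier A" using ideal.Icarr[OF N_ideal h(1)] .
    then have "act d f e = act h f e + act c f e" for e
      unfolding h(2) using c by (simp add: path_algebra_act_add supp_finite)
    then show ?thesis using preproj_ideal_annihilates[OF h(1) f] by (simp add: fun_eq_iff)
  qed
  moreover have "c \<in> cls c"
    by (rule abelian_subgroup.a_rcos_self[OF abelian_subgroupI3[OF ideal.axioms(1)[OF N_ideal] A_abelian_group] c])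
  ultimately have "(\<lambda>c. act c f) ` cls c = {act c f}" by blast
  then show ?thesis by (simp add: array_module_def)
qed

lemma V_add: "\<lbrakk>f \<in> V; g \<in> V\<rbrakk> \<Longrightarrow> (\<lambda>e. f e + g e) \<in> V"
  and V_scale: "f \<in> V \<Longrightarrow> (\<lambda>e. r * f e) \<in> V"
  and V_0: "(\<lambda>e. 0) \<in> V"
  by (simp_all add: array_vectors_def)

lemma PP_ring: "ring PP"
  by (rule preproj_ring[OF n4])

lemma array_left_module: "left_module PP M"
proof -
  interpret R: ring A by (rule path_algebra_ring)
  have "abelian_group M"
  proof (rule abelian_groupI)
    fix f assume "f \<in> carrier M"
    then show "\<exists>g\<in>carrier M. g \<oplus>\<^bsub>M\<^esub> f = \<zero>\<^bsub>M\<^esub>"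
      by (intro bexI[of _ "\<lambda>e. (-1) * f e"]) (use V_scale[of f "-1"] in auto)
  qed (auto simp: V_add V_0 algebra_simps)
  then show ?thesis
  proof (intro left_module.intro left_module_axioms.intro PP_ring)
    fix x f assume x: "x \<in> carrier PP" and f: "f \<in> carrier M"
    obtain c where c: "c \<in> carrier A" "x = cls c" using PP_rep[OF x] by blast
    show "x \<odot>\<^bsub>M\<^esub> f \<in> carrier M" using c f by (simp add: smult_cls path_algebra_act_vectors)
    {
      fix y assume "y \<in> carrier PP"
      then obtain d where d: "d \<in> carrier A" "y = cls d" using PP_rep by blast
      show "(x \<oplus>\<^bsub>PP\<^esub> y) \<odot>\<^bsub>M\<^esub> f = x \<odot>\<^bsub>M\<^esub> f \<oplus>\<^bsub>M\<^esub> y \<odot>\<^bsub>M\<^esub> f"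
        using c d f smult_cls[of "\<lambda>p. c p + d p" f] path_algebra_add_closed[of c n d]
        by (simp add: cls_add smult_cls path_algebra_act_add supp_finite fun_eq_iff)
      show "(x \<otimes>\<^bsub>PP\<^esub> y) \<odot>\<^bsub>M\<^esub> f = x \<odot>\<^bsub>M\<^esub> (y \<odot>\<^bsub>M\<^esub> f)"
        using c d f smult_cls[of "path_mult c d" f] path_mult_closed[of c n d]
        by (simp add: cls_mult smult_cls path_algebra_act_mult supp_finite path_algebra_act_vectors)
    }
    fix g assume "g \<in> carrier M"
    then show "x \<odot>\<^bsub>M\<^esub> (f \<oplus>\<^bsub>M\<^esub> g) = x \<odot>\<^bsub>M\<^esub> f \<oplus>\<^bsub>M\<^esub> x \<odot>\<^bsub>M\<^esub> g"
      using c f linear_map_add[OF linear_map_path_algebra_act[OF supp_finite[OF c(1)]]]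
      by (simp add: smult_cls V_add)
  next
    fix f assume "f \<in> carrier M"
    then show "\<one>\<^bsub>PP\<^esub> \<odot>\<^bsub>M\<^esub> f = f"
      using smult_cls[OF path_algebra_one_closed] path_algebra_act_one[OF _ l2] by (simp flip: cls_one)
  qed
qed

lemma idem_eq: "idem n i = cls (path_elt (i, []))"
  by (simp add: idem_def)

lemma idem_closed: "i \<in> vertices n \<Longrightarrow> idem n i \<in> carrier PP"
  unfolding idem_eq by (intro cls_closed path_elt_closed) simp

lemma idem_smult:
  assumes "i \<in> vertices n" "f \<in> V"
  shows "idem n i \<odot>\<^bsub>M\<^esub> f = (\<lambda>e. if entry_vertex e = i then f e else 0)"
  unfolding idem_eq using assms by (simp add: smult_cls path_elt_closed path_algebra_act_path_elt path_act_def)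

lemma co_idem_smult:
  assumes "i \<in> vertices n" "f \<in> V"
  shows "(\<one>\<^bsub>PP\<^esub> \<ominus>\<^bsub>PP\<^esub> idem n i) \<odot>\<^bsub>M\<^esub> f = (\<lambda>e. if entry_vertex e = i then 0 else f e)"
proof -
  interpret left_module PP M by (rule array_left_module)
  let ?g = "\<lambda>e. if entry_vertex e = i then f e else 0" and ?h = "\<lambda>e. if entry_vertex e = i then 0 else f e"
  have g: "?g \<in> V" and h: "?h \<in> V" using assms(2) by (auto simp: array_vectors_def)
  have "(\<lambda>e. - ?g e) \<in> V" using V_scale[OF g, of "-1"] by simp
  then have "\<ominus>\<^bsub>M\<^esub> ?g = (\<lambda>e. - ?g e)" using g by (intro M.minus_equality) auto
  then have "f \<ominus>\<^bsub>M\<^esub> ?g = ?h" by (auto simp: a_minus_def)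
  then show ?thesis
    using assms idem_closed[OF assms(1)] by (simp add: smult_l_diff smult_one idem_smult)
qed

text \<open>An arrow with nonzero scalar that starts outside \<open>S\<close> also ends outside
  \<open>S\<close>, and arrows with scalar 0 contribute nothing to the action.\<close>

lemma complement_span_submodule:
  assumes S: "scalar_predecessor_closed n l \<alpha> \<beta> S"
  shows "submodule (complement_span n l S) PP M"
proof -
  interpret left_module PP M by (rule array_left_module)
  let ?K = "complement_span n l S :: (entry \<Rightarrow> 'k) set"
  have K: "f \<in> ?K \<longleftrightarrow> (\<forall>e. e \<notin> E - S \<longrightarrow> f e = 0)" for f by (simp only: complement_span_def mem_Collect_eq)
  have KV: "?K \<subseteq> V" by (auto simp: complement_span_def array_vectors_def)
  have arrK: "arr a f \<in> ?K" if f: "f \<in> ?K" for a f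
    unfolding K
  proof (intro allI impI)
    fix e' assume e': "e' \<notin> E - S"
    have "scalar l \<alpha> \<beta> e e' * f e = 0" if "e \<in> E" "e' \<in> E" for e
    proof (cases "scalar l \<alpha> \<beta> e e' = 0")
      case False
      then have "h_arrow e e' \<or> v_arrow e e'" by (cases e; cases e') (auto split: if_splits)
      then have "e \<in> S" using S that e' False unfolding scalar_predecessor_closed_def by blast
      then have "e \<notin> E - S" by blast
      then have "f e = 0" using f unfolding K by blast
      then show ?thesis by simp
    qed simp
    then show "arr a f e' = 0" by (auto simp: arrow_act_def intro!: sum.neutral)
  qed
  have foldK: "fold arr as f \<in> ?K" if "f \<in> ?K" for as f
    using that by (induction as arbitrary: f) (auto simp: arrK)
  have projK: "(\<lambda>e. if entry_vertex e = i then f e else 0) \<in> ?K" if "f \<in> ?K" for i f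
    using that unfolding K by auto
  have "path_act n l \<alpha> \<beta> p f \<in> ?K" if "f \<in> ?K" for p f
    unfolding path_act_def by (intro foldK projK that)
  then have "act c f \<in> ?K" if "f \<in> ?K" for c f
    using that unfolding K path_algebra_act_def by simp
  then have "x \<odot>\<^bsub>M\<^esub> f \<in> ?K" if "x \<in> carrier PP" "f \<in> ?K" for x f
    using PP_rep[OF that(1)] that(2) KV by (auto simp: smult_cls)
  moreover have "(\<lambda>e. f e + g e) \<in> ?K" if "f \<in> ?K" "g \<in> ?K" for f g
    using that unfolding K by auto
  moreover have "(\<lambda>e. 0) \<in> ?K" by (simp add: K)
  ultimately show ?thesis using KV by (intro left_submoduleI) auto
qed

section \<open>Submodules generated by entries\<close>

lemma submodule_arrow:
  assumes T: "submodule T PP M" and f: "f \<in> T" and a: "a \<in> arrows n"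
  shows "arr a f \<in> T"
proof -
  have fV: "f \<in> V" using subgroup.mem_carrier[OF submodule.axioms(1)[OF T] f] by simp
  have p: "is_path n (src a, [a])" using a n4 by (auto simp: arrows_def vertices_def)
  have "arr a (\<lambda>e. if entry_vertex e = src a then f e else 0) = arr a f"
    by (auto simp: arrow_act_def fun_eq_iff intro!: sum.cong)
  then have "cls (path_elt (src a, [a])) \<odot>\<^bsub>M\<^esub> f = arr a f"
    by (simp add: smult_cls[OF path_elt_closed[OF p] fV] path_algebra_act_path_elt path_act_def)
  then show ?thesis
    using submodule.smult_closed[OF T cls_closed[OF path_elt_closed[OF p]] f] by simp
qed

lemma submodule_add: "\<lbrakk>submodule T PP M; f \<in> T; g \<in> T\<rbrakk> \<Longrightarrow> (\<lambda>e. f e + g e) \<in> T"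
  using subgroup.m_closed[OF submodule.axioms(1)] by fastforce

lemma submodule_zero: "submodule T PP M \<Longrightarrow> (\<lambda>e. 0) \<in> T"
  using subgroup.one_closed[OF submodule.axioms(1)] by fastforce

text \<open>Submodules are closed under the ring action; a field scalar \<open>r\<close> acts as the
  ring element \<open>r\<close> times the identity.\<close>

lemma submodule_scale:
  assumes T: "submodule T PP M" and f: "f \<in> T"
  shows "(\<lambda>e. r * f e) \<in> T"
proof -
  have fV: "f \<in> V" using subgroup.mem_carrier[OF submodule.axioms(1)[OF T] f] by simp
  have c: "(\<lambda>p. r * \<one>\<^bsub>A\<^esub> p) \<in> carrier A" by (rule path_algebra_scale_closed[OF path_algebra_one_closed])
  have "cls (\<lambda>p. r * \<one>\<^bsub>A\<^esub> p) \<odot>\<^bsub>M\<^esub> f = (\<lambda>e. r * f e)"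
    unfolding smult_cls[OF c fV]
    using path_algebra_act_scale[OF supp_finite[OF path_algebra_one_closed]] path_algebra_act_one[OF fV l2]
    by (simp add: fun_eq_iff)
  then show ?thesis using submodule.smult_closed[OF T cls_closed[OF c] f] by simp
qed

lemma submodule_span:
  assumes T: "submodule T PP M" and f: "\<And>m v. f (m, v) \<noteq> 0 \<Longrightarrow> (m, v) \<in> E \<and> unit_vec m v \<in> T"
  shows "f \<in> T"
proof -
  have sum: "(\<lambda>e. \<Sum>x\<in>Q. f x * unit_vec (fst x) (snd x) e) \<in> T" if "finite Q" "Q \<subseteq> {x. f x \<noteq> 0}" for Q
    using that
  proof induction
    case (insert x Q)
    have "unit_vec (fst x) (snd x) \<in> T" using f[of "fst x" "snd x"] insert by simp
    then have "(\<lambda>e. f x * unit_vec (fst x) (snd x) e + (\<Sum>x\<in>Q. f x * unit_vec (fst x) (snd x) e)) \<in> T"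
      using insert by (intro submodule_add[OF T] submodule_scale[OF T]) auto
    then show ?case using insert by simp
  qed (simp add: submodule_zero[OF T])
  have fin: "finite {x. f x \<noteq> 0}"
    by (rule finite_subset[OF _ finite_array[of n l]]) (use f in auto)
  have "(\<lambda>e. \<Sum>x | f x \<noteq> 0. f x * unit_vec (fst x) (snd x) e) = f"
  proof
    fix e
    have "(\<Sum>x | f x \<noteq> 0. f x * unit_vec (fst x) (snd x) e) = (\<Sum>x | f x \<noteq> 0. if x = e then f e else 0)"
      by (intro sum.cong) (auto simp: unit_vec_def)
    then show "(\<Sum>x | f x \<noteq> 0. f x * unit_vec (fst x) (snd x) e) = f e" using fin by simp
  qed
  then show ?thesis using sum[OF fin] by simp
qed

lemma unit_vec_V: "(m, v) \<in> E \<Longrightarrow> unit_vec m v \<in> V"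
  by (auto simp: unit_vec_def array_vectors_def)


lemma unit_vec_apply: "unit_vec m v (m', v') = (if m' = m \<and> v' = v then 1 else 0)"
  by (simp add: unit_vec_def)

lemma submodule_cong: "\<lbrakk>f \<in> T; f = g\<rbrakk> \<Longrightarrow> g \<in> T"
  by simp

lemma unit_vec_below_row:
  assumes T: "submodule T PP M" and t: "unit_vec m m \<in> T" and m: "(m, m) \<in> E" "m + 1 \<le> n - 1"
  shows "unit_vec (m + 1) (m + 1) \<in> T"
proof (rule submodule_cong[OF submodule_arrow[OF T t]])
  have m2: "2 \<le> m" using m l2 by (simp add: array_iff)
  show a: "X m \<in> arrows n" using m m2 by (auto simp: arrows_def)
  show "arr (X m) (unit_vec m m) = unit_vec (m + 1) (m + 1)"
    using m m2 by (auto simp: fun_eq_iff arrow_act_formula[OF unit_vec_V[OF m(1)] a] unit_vec_apply array_iff)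
qed

text \<open>The arrow out of 1 or -1 gives the entry \<open>-2\<close> up to sign, plus a multiple
  of the entry \<open>2\<close> in the next row. So \<open>-2\<close> can be isolated if that entry
  is available, absent, or has scalar 0.\<close>

lemma unit_vec_spur:
  assumes T: "submodule T PP M" and t: "unit_vec m s \<in> T" and m: "(m, s) \<in> E" and s: "s = 1 \<or> s = -1"
    and r: "(m + 1, 2) \<in> E \<Longrightarrow> scalar l \<alpha> \<beta> (m, s) (m + 1, 2) \<noteq> 0 \<Longrightarrow> unit_vec (m + 1) 2 \<in> T"
  shows "unit_vec m (-2) \<in> T"
proof -
  define a where "a = (if s = 1 then X 1 else X1')"
  have a: "a \<in> arrows n" using n4 by (auto simp: a_def arrows_def)
  define \<gamma> where "\<gamma> = scalar l \<alpha> \<beta> (m, s) (m + 1, 2)"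
  \<comment> \<open>The sign of the horizontal arrow; \<open>h * h = 1\<close> is used at the end to
    solve for \<open>-2\<close>.\<close>
  define h :: 'k where "h = (if upper l m = s then 1 else -1)"
  have \<gamma>: "\<gamma> = (if upper l m = s then \<alpha> else \<beta>)"
    using s by (auto simp: \<gamma>_def single_def h_arrow_def v_arrow_def)
  have "arr a (unit_vec m s) = (\<lambda>e. h * unit_vec m (-2) e + (if (m + 1, 2) \<in> E then \<gamma> else 0) * unit_vec (m + 1) 2 e)"
  proof
    fix e :: entry
    obtain m' v' where e: "e = (m', v')" by force
    have E2: "(m, -2) \<in> E" using m l2 n4 ln by (auto simp: array_iff)
    have "arr a (unit_vec m s) (m', v') = (if (m', v') \<in> E then
        if v' = 2 \<and> m' = m + 1 then \<gamma> else if v' = -2 \<and> m' = m then h else 0 else 0)"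
      unfolding arrow_act_formula[OF unit_vec_V[OF m] a] using s upper_cases[of m]
      by (elim disjE) (simp_all add: a_def unit_vec_apply \<gamma> h_def upper_succ eq_diff_eq cong: if_cong)
    then show "arr a (unit_vec m s) e =
        h * unit_vec m (-2) e + (if (m + 1, 2) \<in> E then \<gamma> else 0) * unit_vec (m + 1) 2 e"
      using E2 by (simp add: e unit_vec_apply)
  qed
  then have p1: "(\<lambda>e. h * unit_vec m (-2) e + (if (m + 1, 2) \<in> E then \<gamma> else 0) * unit_vec (m + 1) 2 e) \<in> T"
    using submodule_arrow[OF T t a] by simp
  have p2: "(\<lambda>e. (- (if (m + 1, 2) \<in> E then \<gamma> else 0)) * unit_vec (m + 1) 2 e) \<in> T"
  proof (cases "(m + 1, 2) \<in> E \<and> \<gamma> \<noteq> 0")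
    case True
    then have "unit_vec (m + 1) 2 \<in> T" using r unfolding \<gamma>_def by blast
    then show ?thesis by (rule submodule_scale[OF T])
  next
    case False
    then have "(\<lambda>e. (- (if (m + 1, 2) \<in> E then \<gamma> else 0)) * unit_vec (m + 1) 2 e) = (\<lambda>e. 0)" by auto
    then show ?thesis using submodule_zero[OF T] by simp
  qed
  have "(\<lambda>e. h * ((h * unit_vec m (-2) e + (if (m + 1, 2) \<in> E then \<gamma> else 0) * unit_vec (m + 1) 2 e) +
      (- (if (m + 1, 2) \<in> E then \<gamma> else 0)) * unit_vec (m + 1) 2 e)) \<in> T"
    by (rule submodule_scale[OF T submodule_add[OF T p1 p2]])
  moreover have "h * ((h * x + c * z) + (- c) * z) = x" for x c z
  proof -
    have "h * h = 1" by (simp add: h_def)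
    then show ?thesis by (simp add: mult.assoc[symmetric])
  qed
  ultimately show ?thesis by (simp only:)
qed

lemma unit_vec_right:
  assumes T: "submodule T PP M" and t: "unit_vec m v \<in> T" and m: "(m, v) \<in> E" "(m, v - 1) \<in> E" and v: "3 \<le> v \<or> v \<le> -2"
  shows "unit_vec m (v - 1) \<in> T"
proof (rule submodule_cong[OF submodule_arrow[OF T t]])
  let ?a = "if 3 \<le> v then Y v else X (- v)"
  show a: "?a \<in> arrows n" using m v l2 ln by (auto simp: arrows_def array_iff)
  show "arr ?a (unit_vec m v) = unit_vec m (v - 1)"
    using m v by (auto simp: fun_eq_iff arrow_act_formula[OF unit_vec_V[OF m(1)] a] unit_vec_apply array_iff)
qed

lemma unit_vec_fork:
  assumes T: "submodule T PP M" and t: "unit_vec m 2 \<in> T" and m: "(m, 2) \<in> E" and s: "s = 1 \<or> s = -1"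
  shows "unit_vec m s \<in> T"
proof (rule submodule_cong[OF submodule_arrow[OF T t]])
  let ?a = "if s = 1 then Y 2 else Y2'"
  show a: "?a \<in> arrows n" using n4 by (auto simp: arrows_def)
  show "arr ?a (unit_vec m 2) = unit_vec m s"
    using m s l2 n4 ln by (auto simp: fun_eq_iff arrow_act_formula[OF unit_vec_V[OF m(1)] a] unit_vec_apply array_iff)
qed

text \<open>A horizontal step yields the next unit vector alone, except into \<open>-2\<close>,
  where the next row interferes; hence the premise on the entry \<open>2\<close>.\<close>

lemma unit_vec_h_arrow:
  assumes T: "submodule T PP M" and m: "(m, v') \<in> E" "(m, v) \<in> E" "h_arrow (m, v') (m, v)"
    and t: "unit_vec m v' \<in> T"
    and r: "v = -2 \<Longrightarrow> (m + 1, 2) \<in> E \<Longrightarrow> scalar l \<alpha> \<beta> (m, v') (m + 1, 2) \<noteq> 0 \<Longrightarrow> unit_vec (m + 1) 2 \<in> T"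
  shows "unit_vec m v \<in> T"
proof -
  have "v' \<noteq> 0" "v \<noteq> 0" using m by (auto simp: array_iff)
  moreover have "column (m, v) = column (m, v') + 1" using m(3) by (simp only: h_arrow_def)
  ultimately have "v = v' - 1 \<and> (3 \<le> v' \<or> v' \<le> -2) \<or> v' = 2 \<and> (v = 1 \<or> v = -1) \<or> v = -2 \<and> (v' = 1 \<or> v' = -1)"
    unfolding column.simps by (cases "1 \<le> v"; cases "1 \<le> v'"; cases "v = -1"; cases "v' = -1"; simp; presburger?)
  then consider "v = v' - 1" "3 \<le> v' \<or> v' \<le> -2" | "v' = 2" "v = 1 \<or> v = -1" | "v = -2" "v' = 1 \<or> v' = -1"
    by blast
  then show ?thesis
  proof cases
    case 1 then show ?thesis using unit_vec_right[OF T t m(1)] m(2) by simp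
  next
    case 2 then show ?thesis using unit_vec_fork[OF T, of m v] t m by simp
  next
    case 3 then show ?thesis using unit_vec_spur[OF T t m(1)] r by simp
  qed
qed

definition gen_vec :: "entry \<Rightarrow> 'k" where "gen_vec = unit_vec l l"

lemma gen_vec_V: "gen_vec \<in> V"
  unfolding gen_vec_def using l2 ln by (intro unit_vec_V) (simp add: array_iff)

text \<open>The left column is reached by the arrows \<open>X\<close>, the rest of each row from the
  left. All entries \<open>2\<close> come before the entries \<open>-2\<close>, which depend on the
  \<open>2\<close> of the next row.\<close>

lemma gen_vec_generates:
  assumes T: "submodule T PP M" and g: "gen_vec \<in> T"
  shows "V \<subseteq> T"
proof -
  have diag: "unit_vec m m \<in> T" if "l \<le> m" "m \<le> n - 1" for m
    using that
  proof (induction rule: int_ge_induct)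
    case base then show ?case using g by (simp add: gen_vec_def)
  next
    case (step m)
    then show ?case using unit_vec_below_row[OF T, of m] l2 n4 ln by (simp add: array_iff)
  qed
  have ge2: "unit_vec m v \<in> T" if m: "l \<le> m" "m \<le> n - 1" and v: "v \<le> m" "2 \<le> v" for m v
    using v
  proof (induction rule: int_le_induct)
    case base then show ?case using diag m by simp
  next
    case (step v)
    then show ?case using unit_vec_right[OF T, of m v] m l2 n4 ln by (simp add: array_iff)
  qed
  have one: "unit_vec m s \<in> T" if "l \<le> m" "m \<le> n - 1" "s = 1 \<or> s = -1" for m s
    using unit_vec_fork[OF T ge2[of m 2]] that l2 n4 ln by (simp add: array_iff)
  have neg2: "unit_vec m (-2) \<in> T" if "l \<le> m" "m \<le> n - 1" for m
    by (rule unit_vec_spur[OF T one[of m 1]]) (use that ge2[of "m + 1" 2] l2 n4 ln in \<open>auto simp: array_iff\<close>)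
  have neg: "unit_vec m v \<in> T" if m: "l \<le> m" "m \<le> n - 1" and v: "v \<le> -2" "m - l + 1 - n \<le> v" for m v
    using v
  proof (induction rule: int_le_induct)
    case base then show ?case using neg2 m by simp
  next
    case (step v)
    then show ?case using unit_vec_right[OF T, of m v] m l2 n4 ln by (simp add: array_iff)
  qed
  have all: "unit_vec m v \<in> T" if "(m, v) \<in> E" for m v
  proof -
    have m: "l \<le> m" "m \<le> n - 1" "v \<le> m" "m - l + 1 - n \<le> v" "v \<noteq> 0" using that by (auto simp: array_iff)
    consider "2 \<le> v" | "v = 1 \<or> v = -1" | "v \<le> -2" using m(5) by linarith
    then show ?thesis by cases (use ge2 one neg m in auto)
  qed
  show ?thesis
  proof
    fix f assume f: "f \<in> V"
    have "(m, v) \<in> E" if "f (m, v) \<noteq> 0" for m v using V_zero[OF f, of "(m, v)"] that by blast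
    then show "f \<in> T" using all by (intro submodule_span[OF T]) blast
  qed
qed

text \<open>The orbit of the generator is a submodule containing it.\<close>

lemma gen_vec_orbit:
  assumes f: "f \<in> V"
  shows "\<exists>x\<in>carrier PP. x \<odot>\<^bsub>M\<^esub> gen_vec = f"
proof -
  interpret left_module PP M by (rule array_left_module)
  have g: "gen_vec \<in> carrier M" using gen_vec_V by simp
  let ?T = "(\<lambda>x. x \<odot>\<^bsub>M\<^esub> gen_vec) ` carrier PP"
  have "submodule ?T PP M"
  proof (rule left_submoduleI)
    show "?T \<subseteq> carrier M" using smult_closed[OF _ g] by blast
    show "\<zero>\<^bsub>M\<^esub> \<in> ?T" using smult_l_zero[OF g] R.zero_closed by (metis imageI)
    show "x \<oplus>\<^bsub>M\<^esub> y \<in> ?T" if "x \<in> ?T" "y \<in> ?T" for x y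
      using that smult_l_distr[OF _ _ g, symmetric] R.a_closed by (auto simp del: M_simps)
    show "a \<odot>\<^bsub>M\<^esub> x \<in> ?T" if "a \<in> carrier PP" "x \<in> ?T" for a x
      using that smult_assoc1[OF _ _ g, symmetric] R.m_closed by (auto simp del: M_simps)
  qed
  moreover have "gen_vec \<in> ?T" using smult_one[OF g] R.one_closed by (metis imageI)
  ultimately have "V \<subseteq> ?T" by (rule gen_vec_generates)
  then show ?thesis using f by blast
qed

end

section \<open>The array representation is isomorphic to P\<close>

context array_rep
begin

definition arrow_mult :: "arrow \<Rightarrow> (path \<Rightarrow> 'k) \<Rightarrow> path \<Rightarrow> 'k" where
  "arrow_mult a c = path_mult (path_elt (src a, [a])) c"

text \<open>Congruence modulo the relations, with membership in the path algebra built in; the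
  calculations below use coefficient functions in place of cosets.\<close>

definition eqv :: "(path \<Rightarrow> 'k) \<Rightarrow> (path \<Rightarrow> 'k) \<Rightarrow> bool" (infix "\<approx>" 50) where
  "c \<approx> d \<longleftrightarrow> c \<in> carrier A \<and> d \<in> carrier A \<and> (\<lambda>p. c p - d p) \<in> N"

lemma arrow_is_path: "a \<in> arrows n \<Longrightarrow> is_path n (src a, [a])"
  using n4 by (auto simp: arrows_def vertices_def)

lemma N_carrier: "c \<in> N \<Longrightarrow> c \<in> carrier A"
  by (rule ideal.Icarr[OF N_ideal])

lemma N_mult: "\<lbrakk>c \<in> carrier A; d \<in> N\<rbrakk> \<Longrightarrow> path_mult c d \<in> N" "\<lbrakk>c \<in> N; d \<in> carrier A\<rbrakk> \<Longrightarrow> path_mult c d \<in> N"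
  using ideal.I_l_closed[OF N_ideal] ideal.I_r_closed[OF N_ideal] by fastforce+

lemma N_add: "\<lbrakk>c \<in> N; d \<in> N\<rbrakk> \<Longrightarrow> (\<lambda>p. c p + d p) \<in> N"
  using additive_subgroup.a_closed[OF ideal.axioms(1)[OF N_ideal]] by fastforce

lemma N_zero: "(\<lambda>p. 0) \<in> N"
  using additive_subgroup.zero_closed[OF ideal.axioms(1)[OF N_ideal]] by simp

lemma path_mult_scale_one:
  assumes "d \<in> carrier A"
  shows "path_mult (\<lambda>p. r * \<one>\<^bsub>A\<^esub> p) d = (\<lambda>p. r * d p)"
proof -
  have "path_mult (\<lambda>p. r * \<one>\<^bsub>A\<^esub> p) d = (\<lambda>p. r * path_mult \<one>\<^bsub>A\<^esub> d p)"
    by (auto simp: fun_eq_iff sum_distrib_left mult.assoc)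
  also have "path_mult \<one>\<^bsub>A\<^esub> d = d"
    using monoid.l_one[OF ring.is_monoid[OF path_algebra_ring] assms] by simp
  finally show ?thesis .
qed

lemma N_scale: "c \<in> N \<Longrightarrow> (\<lambda>p. r * c p) \<in> N"
  using N_mult(1)[OF path_algebra_scale_closed[OF path_algebra_one_closed], of c r]
  by (simp add: path_mult_scale_one[OF N_carrier])

lemma linear_map_path_mult: "linear_map (path_mult (c :: path \<Rightarrow> 'k))"
  by (auto simp: linear_map_def fun_eq_iff sum.distrib sum_distrib_left algebra_simps)

lemma linear_map_arrow_mult: "linear_map (arrow_mult a)"
  unfolding arrow_mult_def[abs_def] by (rule linear_map_path_mult)

lemma linear_map_diff:
  assumes "linear_map T"
  shows "T (\<lambda>e. f e - r * g e) = (\<lambda>e. T f e - r * T g e)"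
proof -
  have "T (\<lambda>e. f e + (- r) * g e) = (\<lambda>e. T f e + T (\<lambda>e. (- r) * g e) e)" by (rule linear_map_add[OF assms])
  then show ?thesis unfolding linear_map_scale[OF assms] by simp
qed

lemma arrow_mult_closed: "\<lbrakk>a \<in> arrows n; c \<in> carrier A\<rbrakk> \<Longrightarrow> arrow_mult a c \<in> carrier A"
  unfolding arrow_mult_def by (intro path_mult_closed path_elt_closed arrow_is_path)

lemma eqv_refl: "c \<in> carrier A \<Longrightarrow> c \<approx> c"
  by (simp add: eqv_def N_zero)

lemma eqv_sym: "c \<approx> d \<Longrightarrow> d \<approx> c"
  using N_scale[of "\<lambda>p. c p - d p" "-1"] by (simp add: eqv_def)

lemma eqv_trans [trans]: "\<lbrakk>c \<approx> d; d \<approx> e\<rbrakk> \<Longrightarrow> c \<approx> e"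
  using N_add[of "\<lambda>p. c p - d p" "\<lambda>p. d p - e p"] by (simp add: eqv_def)

lemma eqv_add: "\<lbrakk>c \<approx> d; c' \<approx> d'\<rbrakk> \<Longrightarrow> (\<lambda>p. c p + c' p) \<approx> (\<lambda>p. d p + d' p)"
  using N_add[of "\<lambda>p. c p - d p" "\<lambda>p. c' p - d' p"]
    path_algebra_add_closed[of c n c'] path_algebra_add_closed[of d n d']
  by (simp add: eqv_def algebra_simps)

lemma eqv_scale: "c \<approx> d \<Longrightarrow> (\<lambda>p. r * c p) \<approx> (\<lambda>p. r * d p)"
  using N_scale[of "\<lambda>p. c p - d p" r] path_algebra_scale_closed[of c n r] path_algebra_scale_closed[of d n r]
  by (simp add: eqv_def algebra_simps)

lemma eqv_diff: "\<lbrakk>c \<approx> d; c' \<approx> d'\<rbrakk> \<Longrightarrow> (\<lambda>p. c p - c' p) \<approx> (\<lambda>p. d p - d' p)"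
  using eqv_add[of c d "\<lambda>p. (-1) * c' p" "\<lambda>p. (-1) * d' p"] eqv_scale[of c' d' "-1"] by simp

lemma eqv_sum: "(\<And>q. q \<in> Q \<Longrightarrow> c q \<approx> d q) \<Longrightarrow> finite Q \<Longrightarrow> (\<lambda>p. \<Sum>q\<in>Q. r q * c q p) \<approx> (\<lambda>p. \<Sum>q\<in>Q. r q * d q p)"
proof (induction Q rule: infinite_finite_induct)
  case (insert q Q)
  then show ?case
    using eqv_add[OF eqv_scale[of "c q" "d q" "r q"], of "\<lambda>p. \<Sum>q\<in>Q. r q * c q p" "\<lambda>p. \<Sum>q\<in>Q. r q * d q p"] by simp
qed (auto simp: eqv_def N_zero path_algebra_zero_closed)

lemma eqv_arrow:
  assumes a: "a \<in> arrows n" and cd: "c \<approx> d"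
  shows "arrow_mult a c \<approx> arrow_mult a d"
proof -
  have "arrow_mult a (\<lambda>p. c p - d p) = (\<lambda>p. arrow_mult a c p - arrow_mult a d p)"
    using linear_map_diff[OF linear_map_arrow_mult, of a c 1 d] by simp
  moreover have "arrow_mult a (\<lambda>p. c p - d p) \<in> N"
    using cd unfolding arrow_mult_def eqv_def by (intro N_mult(1) path_elt_closed arrow_is_path a) simp
  ultimately show ?thesis using cd arrow_mult_closed[OF a] by (simp add: eqv_def)
qed

lemma eqv_zero_iff: "c \<approx> (\<lambda>p. 0) \<longleftrightarrow> c \<in> N"
  using N_carrier by (auto simp: eqv_def path_algebra_zero_closed)

section \<open>Products with single paths and the relations in the path algebra\<close>

lemma path_mult_path_elt: "path_mult (path_elt q) c (i, as) =
    (if \<exists>bs. as = bs @ snd q \<and> path_end (i, bs) = fst q then c (i, take (length as - length (snd q)) as) else (0::'k))"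
proof -
  have "path_mult (path_elt q) c (i, as) =
      (\<Sum>t\<le>length as. if (path_end (i, take t as), drop t as) = q then c (i, take t as) else 0)"
    unfolding path_elt_def by (auto intro!: sum.cong)
  also have "\<dots> = (if \<exists>bs. as = bs @ snd q \<and> path_end (i, bs) = fst q
      then c (i, take (length as - length (snd q)) as) else 0)"
  proof (cases "\<exists>bs. as = bs @ snd q \<and> path_end (i, bs) = fst q")
    case True
    then obtain bs where bs: "as = bs @ snd q" "path_end (i, bs) = fst q" by blast
    have "(path_end (i, take t as), drop t as) = q \<longleftrightarrow> t = length bs" if "t \<le> length as" for t
    proof
      assume "(path_end (i, take t as), drop t as) = q"
      then have "length (drop t as) = length (snd q)" by (metis snd_conv)
      then show "t = length bs" using bs that by simp
    qed (use bs in auto)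
    then have "(\<Sum>t\<le>length as. if (path_end (i, take t as), drop t as) = q then c (i, take t as) else 0) =
        (\<Sum>t\<le>length as. if t = length bs then c (i, take t as) else 0)"
      by (intro sum.cong refl) simp
    then show ?thesis using bs by simp
  next
    case False
    then have "(path_end (i, take t as), drop t as) \<noteq> q" for t by (metis append_take_drop_id fst_conv snd_conv)
    then show ?thesis unfolding if_not_P[OF False] by simp
  qed
  finally show ?thesis .
qed

lemma path_mult_path_elts:
  "path_mult (path_elt q) (path_elt r) = (if path_end r = fst q then path_elt (path_comp q r) else (\<lambda>p. 0 :: 'k))"
proof
  fix p :: path
  obtain i as where p: "p = (i, as)" by force
  obtain j bs where r: "r = (j, bs)" by force
  show "path_mult (path_elt q) (path_elt r) p = (if path_end r = fst q then path_elt (path_comp q r) else (\<lambda>p. 0 :: 'k)) p"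
    unfolding p path_mult_path_elt by (auto simp: path_elt_def path_comp_def r)
qed

lemma arrow_mult_two:
  assumes "tgt a = src b"
  shows "arrow_mult b (arrow_mult a c) = path_mult (path_elt (src a, [a, b])) c"
proof -
  have "path_mult (path_elt (src b, [b])) (path_elt (src a, [a])) = (if path_end (src a, [a]) = fst (src b, [b])
      then path_elt (path_comp (src b, [b]) (src a, [a])) else (\<lambda>p. 0 :: 'k))"
    by (rule path_mult_path_elts)
  also have "\<dots> = path_elt (src a, [a, b])" using assms by (simp add: path_comp_def)
  finally have "path_mult (path_elt (src b, [b])) (path_elt (src a, [a])) = (path_elt (src a, [a, b]) :: path \<Rightarrow> 'k)" .
  then show ?thesis unfolding arrow_mult_def path_mult_assoc[symmetric] by simp
qed

lemma relation_N: "r \<in> preproj_relations n \<Longrightarrow> r \<in> N"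
  unfolding preproj_ideal_def using ring.genideal_self[OF path_algebra_ring preproj_relations_closed[OF n4]] by blast

lemma path_mult_diff_left: "path_mult (\<lambda>p. c p - d p) e = (\<lambda>p. path_mult c e p - path_mult d e p :: 'k)"
  by (auto simp: fun_eq_iff sum_subtractf algebra_simps)

lemma arrow_relations:
  assumes c: "c \<in> carrier A"
  shows "arrow_mult (Y 2) (arrow_mult (X 1) c) \<approx> (\<lambda>p. 0)"
    and "arrow_mult Y2' (arrow_mult X1' c) \<approx> (\<lambda>p. 0)"
    and "arrow_mult (Y 3) (arrow_mult (X 2) c) \<approx> (\<lambda>p. arrow_mult (X 1) (arrow_mult (Y 2) c) p + arrow_mult X1' (arrow_mult Y2' c) p)"
    and "arrow_mult (X (n - 2)) (arrow_mult (Y (n - 1)) c) \<approx> (\<lambda>p. 0)"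
    and "\<lbrakk>3 \<le> i; i \<le> n - 2\<rbrakk> \<Longrightarrow> arrow_mult (Y (i + 1)) (arrow_mult (X i) c) \<approx> arrow_mult (X (i - 1)) (arrow_mult (Y i) c)"
proof -
  have ar: "X 1 \<in> arrows n" "X 2 \<in> arrows n" "X1' \<in> arrows n" "Y 2 \<in> arrows n" "Y 3 \<in> arrows n" "Y2' \<in> arrows n"
    using n4 by (auto simp: arrows_def)
  note closed = arrow_mult_closed[OF _ arrow_mult_closed[OF _ c]]
  have "path_elt (1, [X 1, Y 2]) \<in> N" "path_elt (-1, [X1', Y2']) \<in> N" "path_elt (n-1, [Y (n-1), X (n-2)]) \<in> N"
    by (rule relation_N, simp add: preproj_relations_def)+
  from this[THEN N_mult(2), OF c]
  show "arrow_mult (Y 2) (arrow_mult (X 1) c) \<approx> (\<lambda>p. 0)" "arrow_mult Y2' (arrow_mult X1' c) \<approx> (\<lambda>p. 0)"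
    "arrow_mult (X (n - 2)) (arrow_mult (Y (n - 1)) c) \<approx> (\<lambda>p. 0)"
    by (simp_all add: eqv_zero_iff arrow_mult_two)
  have p: "is_path n (2, [X 2, Y 3])" "is_path n (2, [Y 2, X 1])" "is_path n (2, [Y2', X1'])"
    using n4 by (auto simp: vertices_def arrows_def)
  note pc = p[THEN path_elt_closed, where 'a = 'k]
  have "path_elt (2, [X 2, Y 3]) \<ominus>\<^bsub>A\<^esub> (path_elt (2, [Y 2, X 1]) \<oplus>\<^bsub>A\<^esub> path_elt (2, [Y2', X1'])) \<in> N"
    by (rule relation_N) (simp add: preproj_relations_def)
  then have "(\<lambda>p. path_elt (2, [X 2, Y 3]) p - (path_elt (2, [Y 2, X 1]) p + path_elt (2, [Y2', X1']) p)) \<in> N"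
    using pc by (simp add: path_algebra_minus path_algebra_add_closed)
  note three = N_mult(2)[OF this c]
  have eq: "path_mult (\<lambda>p. x p - (y p + z p)) c = (\<lambda>p. path_mult x c p - (path_mult y c p + path_mult z c p))" for x y z
    by (auto simp: fun_eq_iff sum_subtractf sum.distrib algebra_simps)
  show "arrow_mult (Y 3) (arrow_mult (X 2) c) \<approx> (\<lambda>p. arrow_mult (X 1) (arrow_mult (Y 2) c) p + arrow_mult X1' (arrow_mult Y2' c) p)"
    using three closed[of "Y 3" "X 2"] path_algebra_add_closed[OF closed[of "X 1" "Y 2"] closed[of X1' Y2']] ar
    unfolding eq eqv_def by (simp add: arrow_mult_two)
  show "arrow_mult (Y (i + 1)) (arrow_mult (X i) c) \<approx> arrow_mult (X (i - 1)) (arrow_mult (Y i) c)"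
    if i: "3 \<le> i" "i \<le> n - 2"
  proof -
    have ar: "X i \<in> arrows n" "Y (i + 1) \<in> arrows n" "Y i \<in> arrows n" "X (i - 1) \<in> arrows n"
      using i by (auto simp: arrows_def)
    have p: "is_path n (i, [X i, Y (i+1)])" "is_path n (i, [Y i, X (i-1)])"
      using i by (auto simp: vertices_def arrows_def)
    note pc = p[THEN path_elt_closed, where 'a = 'k]
    have "path_elt (i, [X i, Y (i+1)]) \<ominus>\<^bsub>A\<^esub> path_elt (i, [Y i, X (i-1)]) \<in> N"
      by (rule relation_N) (use i in \<open>auto simp: preproj_relations_def\<close>)
    then have "(\<lambda>p. path_elt (i, [X i, Y (i+1)]) p - path_elt (i, [Y i, X (i-1)]) p) \<in> N"
      using pc by (simp add: path_algebra_minus)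
    from N_mult(2)[OF this c] show ?thesis
      using closed[of "Y (i + 1)" "X i"] closed[of "X (i - 1)" "Y i"] ar
      by (simp add: eqv_def path_mult_diff_left arrow_mult_two)
  qed
qed


lemma eq_eqv_trans [trans]: "c = d \<Longrightarrow> d \<approx> e \<Longrightarrow> c \<approx> e"
  and eqv_eq_trans [trans]: "c \<approx> d \<Longrightarrow> d = e \<Longrightarrow> c \<approx> e"
  by simp_all

section \<open>Preimages of the entries in the path algebra\<close>

definition row_path :: "int \<Rightarrow> path" where
  "row_path m = (l, map X [l..m-1])"

lemma row_path_step: "l \<le> m \<Longrightarrow> row_path (m + 1) = path_comp (m, [X m]) (row_path m)"
  by (simp add: row_path_def path_comp_def upto_rec2[of l m])

lemma row_path_valid:
  assumes "l \<le> m" "m \<le> n - 1"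
  shows "path_end (row_path m) = m" "is_path n (row_path m)"
proof -
  have "path_end (row_path m) = m \<and> is_path n (row_path m)"
    using assms
  proof (induction rule: int_ge_induct)
    case base
    then show ?case using l2 ln by (simp add: row_path_def vertices_def)
  next
    case (step m)
    obtain as where as: "row_path m = (l, as)" by (simp add: row_path_def)
    then show ?case
      using step l2 by (simp add: row_path_step path_comp_def is_path_append arrows_def vertices_def)
  qed
  then show "path_end (row_path m) = m" "is_path n (row_path m)" by auto
qed

text \<open>The value 0 outside the rows of the array makes \<open>psi\<close> vanish below the last
  row, so that vertical arrows out of row \<open>n - 1\<close> fit the general formulas.\<close>

definition row_elt :: "int \<Rightarrow> path \<Rightarrow> 'k" where
  "row_elt m = (if l \<le> m \<and> m \<le> n - 1 then path_elt (row_path m) else (\<lambda>p. 0))"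

text \<open>The index \<open>k\<close> counts the steps to the right from the beginning of the row,
  so this is the preimage of the entry \<open>m - k\<close>.\<close>

primrec psi_down :: "int \<Rightarrow> nat \<Rightarrow> path \<Rightarrow> 'k" where
  "psi_down m 0 = row_elt m"
| "psi_down m (Suc k) = arrow_mult (Y (m - int k)) (psi_down m k)"

definition spur_in :: "int \<Rightarrow> arrow" where "spur_in s = (if s = 1 then X 1 else X1')"
definition spur_out :: "int \<Rightarrow> arrow" where "spur_out s = (if s = 1 then Y 2 else Y2')"

definition psi_nonneg :: "int \<Rightarrow> int \<Rightarrow> path \<Rightarrow> 'k" where
  "psi_nonneg m v = (if v = -1 then arrow_mult Y2' (psi_down m (nat (m - 2))) else psi_down m (nat (m - v)))"

text \<open>\<open>psi_left m 0\<close> is the preimage of the entry \<open>-2\<close>, found by solving \<open>x \<cdot> upper = (-2) + \<alpha> \<cdot> 2\<close>,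
  with the \<open>2\<close> of the next row, for \<open>-2\<close>.\<close>

primrec psi_left :: "int \<Rightarrow> nat \<Rightarrow> path \<Rightarrow> 'k" where
  "psi_left m 0 = (\<lambda>p. arrow_mult (spur_in (upper l m)) (psi_nonneg m (upper l m)) p - \<alpha> * psi_nonneg (m + 1) 2 p)"
| "psi_left m (Suc k) = arrow_mult (X (int k + 2)) (psi_left m k)"

definition psi :: "int \<Rightarrow> int \<Rightarrow> path \<Rightarrow> 'k" where
  "psi m v = (if v \<le> -2 then psi_left m (nat (- v - 2)) else psi_nonneg m v)"

lemma psi_Y: "\<lbrakk>2 \<le> v; v \<le> m\<rbrakk> \<Longrightarrow> arrow_mult (Y v) (psi m v) = psi m (v - 1)"
proof -
  assume v: "2 \<le> v" "v \<le> m"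
  then have "nat (m - (v - 1)) = Suc (nat (m - v))" by simp
  then show ?thesis using v by (simp add: psi_def psi_nonneg_def)
qed

lemma psi_spur_out: "\<lbrakk>s = 1 \<or> s = -1; 2 \<le> m\<rbrakk> \<Longrightarrow> arrow_mult (spur_out s) (psi m 2) = psi m s"
  using psi_Y[of 2 m] by (auto simp: spur_out_def) (simp add: psi_def psi_nonneg_def)

lemma psi_X_left: "v \<le> -2 \<Longrightarrow> arrow_mult (X (- v)) (psi m v) = psi m (v - 1)"
proof -
  assume v: "v \<le> -2"
  then have "nat (- (v - 1) - 2) = Suc (nat (- v - 2))" by simp
  then show ?thesis using v by (simp add: psi_def)
qed

lemma psi_turn: "psi m (-2) = (\<lambda>p. arrow_mult (spur_in (upper l m)) (psi m (upper l m)) p - \<alpha> * psi (m + 1) 2 p)"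
  using upper_cases[of m] by (auto simp: psi_def)

lemma psi_start: "1 \<le> m \<Longrightarrow> psi m m = row_elt m"
  by (simp add: psi_def psi_nonneg_def)

lemma arrow_mult_zero [simp]: "arrow_mult a (\<lambda>p. 0) = (\<lambda>p. 0)"
  by (rule linear_map_zero[OF linear_map_arrow_mult])

lemma psi_beyond: "n \<le> m \<Longrightarrow> psi m v = (\<lambda>p. 0)"
proof -
  assume m: "n \<le> m"
  have d: "psi_down m k = (\<lambda>p. 0)" if "n \<le> m" for m k
    using that by (induction k) (simp_all add: row_elt_def)
  then have "psi_nonneg m v = (\<lambda>p. 0)" if "n \<le> m" for m v using that by (simp add: psi_nonneg_def)
  then have "psi_left m k = (\<lambda>p. 0)" for k using m by (induction k) simp_all
  then show ?thesis using m d by (simp add: psi_def psi_nonneg_def)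
qed

lemma spur_arrows: "spur_in s \<in> arrows n" "spur_out s \<in> arrows n"
  using n4 by (auto simp: spur_in_def spur_out_def arrows_def)

lemma psi_closed:
  assumes m: "l \<le> m" and v: "1 - n \<le> v" "v \<le> m" "v \<noteq> 0"
  shows "psi m v \<in> carrier A"
proof (cases "n \<le> m")
  case True
  then show ?thesis by (simp add: psi_beyond path_algebra_zero_closed)
next
  case False
  have pos: "psi m v \<in> carrier A" if "v \<le> m" "1 \<le> v" "l \<le> m" "m \<le> n - 1" for v m
    using that
  proof (induction rule: int_le_induct)
    case base
    then show ?case
      using l2 row_path_valid[of m] path_elt_closed by (simp add: psi_start row_elt_def)
  next
    case (step v)
    have "Y v \<in> arrows n" using step by (auto simp: arrows_def)
    then show ?case using arrow_mult_closed[of "Y v" "psi m v"] step psi_Y[of v m] by simp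
  qed
  have one: "psi m s \<in> carrier A" if "s = 1 \<or> s = -1" "l \<le> m" "m \<le> n - 1" for m s
    using arrow_mult_closed[OF spur_arrows(2)[of s] pos[of 2 m]] psi_spur_out[of s m] that l2 by simp
  have two: "psi (m + 1) 2 \<in> carrier A"
    using pos[of 2 "m + 1"] psi_beyond[of "m + 1"] l2 m path_algebra_zero_closed by (cases "m + 1 \<le> n - 1") auto
  have neg: "psi m v \<in> carrier A" if "v \<le> -2" "1 - n \<le> v" for v
    using that
  proof (induction rule: int_le_induct)
    case base
    have "arrow_mult (spur_in (upper l m)) (psi m (upper l m)) \<in> carrier A"
      using one[of "upper l m" m] upper_cases[of m] m False by (intro arrow_mult_closed spur_arrows) auto
    from path_algebra_add_closed[OF this path_algebra_scale_closed[OF two, of "- \<alpha>"]]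
    show ?case by (simp add: psi_turn)
  next
    case (step v)
    have "X (- v) \<in> arrows n" using step by (auto simp: arrows_def)
    then show ?case using arrow_mult_closed[of "X (- v)" "psi m v"] step psi_X_left[of v m] by simp
  qed
  consider "1 \<le> v" | "v = -1" | "v \<le> -2" using v(3) by linarith
  then show ?thesis by cases (use pos one neg m v False in auto)
qed

text \<open>Moving right along the row, the commutation relations carry the statement from
  \<open>v\<close> to \<open>v - 1\<close>. It starts at the beginning of the row if there is a next
  row; in the last row it starts at \<open>n - 2\<close>, where the final relation makes the left
  side congruent to 0.\<close>

lemma psi_X_up:
  assumes m: "l \<le> m" "m \<le> n - 1" and v: "2 \<le> v" "v \<le> m" "v \<le> n - 2"
  shows "arrow_mult (X v) (psi m v) \<approx> psi (m + 1) (v + 1)"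
proof -
  have "v \<le> min m (n - 2)" using v by simp
  then show ?thesis
    using v(1)
  proof (induction rule: int_le_induct)
    case base
    show ?case
    proof (cases "m \<le> n - 2")
      case True
      then have "arrow_mult (X m) (psi m m) = psi (m + 1) (m + 1)"
        using m l2 row_path_valid(1)[of m] row_path_step[of m]
        by (simp add: psi_start row_elt_def arrow_mult_def path_mult_path_elts del: path_algebra_mult)
      then show ?thesis using True psi_closed[of "m + 1" "m + 1"] m l2 eqv_refl by simp
    next
      case False
      then have m: "m = n - 1" using m by simp
      have "psi m (n - 2) = arrow_mult (Y (n - 1)) (psi m (n - 1))" using psi_Y[of "n - 1" m] n4 m by simp
      then show ?thesis
        using arrow_relations(4)[OF psi_closed[of m "n - 1"]] m n4 ln by (simp add: psi_beyond)
    qed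
  next
    case (step v)
    then have v: "3 \<le> v" "v \<le> m" "v \<le> n - 2" by auto
    have c: "psi m v \<in> carrier A" using psi_closed[of m v] m v n4 by simp
    have "arrow_mult (X (v - 1)) (psi m (v - 1)) = arrow_mult (X (v - 1)) (arrow_mult (Y v) (psi m v))"
      using psi_Y[of v m] v by simp
    also have "\<dots> \<approx> arrow_mult (Y (v + 1)) (arrow_mult (X v) (psi m v))"
      using arrow_relations(5)[OF c v(1,3)] by (rule eqv_sym)
    also have "\<dots> \<approx> arrow_mult (Y (v + 1)) (psi (m + 1) (v + 1))"
      using step v by (intro eqv_arrow) (auto simp: arrows_def)
    also have "\<dots> = psi (m + 1) v" using psi_Y[of "v + 1" "m + 1"] v by simp
    finally show ?case by simp
  qed
qed

lemma spur_relation: "c \<in> carrier A \<Longrightarrow> s = 1 \<or> s = -1 \<Longrightarrow> arrow_mult (spur_out s) (arrow_mult (spur_in s) c) \<approx> (\<lambda>p. 0)"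
  using arrow_relations(1,2)[of c] by (auto simp: spur_in_def spur_out_def)

lemma middle_relation:
  assumes "c \<in> carrier A" "s = 1 \<or> s = -1"
  shows "arrow_mult (Y 3) (arrow_mult (X 2) c) \<approx>
    (\<lambda>p. arrow_mult (spur_in s) (arrow_mult (spur_out s) c) p + arrow_mult (spur_in (- s)) (arrow_mult (spur_out (- s)) c) p)"
  using arrow_relations(3)[OF assms(1)] assms(2) by (auto simp: spur_in_def spur_out_def add.commute)

context
  fixes m assumes m: "l \<le> m" "m \<le> n - 1"
begin

lemma psi_spurs: "s = 1 \<or> s = -1 \<Longrightarrow> psi m s \<in> carrier A" "psi m 2 \<in> carrier A" "psi (m + 1) 2 \<in> carrier A" "psi m (-2) \<in> carrier A"
  by (rule psi_closed; use m l2 n4 in auto)+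

lemma psi_upper: "arrow_mult (spur_in (upper l m)) (psi m (upper l m)) \<approx> (\<lambda>p. psi m (-2) p + \<alpha> * psi (m + 1) 2 p)"
proof -
  have "arrow_mult (spur_in (upper l m)) (psi m (upper l m)) = (\<lambda>p. psi m (-2) p + \<alpha> * psi (m + 1) 2 p)"
    by (simp add: psi_turn)
  then show ?thesis
    using eqv_refl[OF arrow_mult_closed[OF spur_arrows(1)[of "upper l m"] psi_spurs(1)[OF upper_cases[of m]]]] by simp
qed

text \<open>By the relation at vertex 2, the images of the entries 1 and -1 add up to the entry
  \<open>2\<close> of the next row. Subtracting the upper one leaves the coefficient
  \<open>1 - \<alpha> = \<beta>\<close>.\<close>

lemma psi_lower: "arrow_mult (spur_in (- upper l m)) (psi m (- upper l m)) \<approx> (\<lambda>p. \<beta> * psi (m + 1) 2 p - psi m (-2) p)"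
proof -
  let ?u = "upper l m"
  have X2: "X 2 \<in> arrows n" and Y3: "Y 3 \<in> arrows n" using n4 by (auto simp: arrows_def)
  have u: "- ?u = 1 \<or> - ?u = -1" using upper_cases[of m] by auto
  have out: "arrow_mult (spur_out s) (psi m 2) = psi m s" if "s = 1 \<or> s = -1" for s
    using psi_spur_out[OF that, of m] m l2 by simp
  have "psi (m + 1) 2 = arrow_mult (Y 3) (psi (m + 1) 3)" using psi_Y[of 3 "m + 1"] m l2 by simp
  also have "\<dots> \<approx> arrow_mult (Y 3) (arrow_mult (X 2) (psi m 2))"
    using psi_X_up[of m 2] m l2 n4 by (intro eqv_arrow[OF Y3]) (rule eqv_sym, simp)
  also have "\<dots> \<approx> (\<lambda>p. arrow_mult (spur_in ?u) (psi m ?u) p + arrow_mult (spur_in (- ?u)) (psi m (- ?u)) p)"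
    using middle_relation[OF psi_spurs(2) upper_cases[of m]] out[OF upper_cases] out[OF u] by simp
  finally have sum: "psi (m + 1) 2 \<approx> (\<lambda>p. arrow_mult (spur_in ?u) (psi m ?u) p + arrow_mult (spur_in (- ?u)) (psi m (- ?u)) p)" .
  have "(\<lambda>p. psi (m + 1) 2 p - arrow_mult (spur_in ?u) (psi m ?u) p) \<approx> arrow_mult (spur_in (- ?u)) (psi m (- ?u))"
    using eqv_diff[OF sum eqv_refl[OF arrow_mult_closed[OF spur_arrows(1)[of ?u] psi_spurs(1)[OF upper_cases[of m]]]]] by simp
  then have "arrow_mult (spur_in (- ?u)) (psi m (- ?u)) \<approx> (\<lambda>p. psi (m + 1) 2 p - arrow_mult (spur_in ?u) (psi m ?u) p)"
    by (rule eqv_sym)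
  also have "\<dots> \<approx> (\<lambda>p. psi (m + 1) 2 p - (psi m (-2) p + \<alpha> * psi (m + 1) 2 p))"
    by (rule eqv_diff[OF eqv_refl[OF psi_spurs(3)] psi_upper])
  also have "\<dots> = (\<lambda>p. \<beta> * psi (m + 1) 2 p - psi m (-2) p)"
  proof
    fix p
    let ?x = "psi (m + 1) 2 p"
    have e: "\<beta> * ?x + \<alpha> * ?x = ?x" using sum1 by (metis add.commute distrib_right mult_1)
    have "(\<beta> * ?x + \<alpha> * ?x) - (psi m (-2) p + \<alpha> * ?x) = \<beta> * ?x - psi m (-2) p" by simp
    then show "?x - (psi m (-2) p + \<alpha> * ?x) = \<beta> * ?x - psi m (-2) p" by (simp only: e)
  qed
  finally show ?thesis .
qed

text \<open>Going from a spur into vertex 2 and back is zero, so only the term with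
  \<open>\<alpha>\<close> in the definition of the preimage of \<open>-2\<close> survives. In row
  \<open>m + 1\<close> the entry reached is the lower one.\<close>

lemma psi_out_upper: "arrow_mult (spur_out (upper l m)) (psi m (-2)) \<approx> (\<lambda>p. - \<alpha> * psi (m + 1) (upper l m) p)"
proof -
  let ?u = "upper l m"
  have out: "arrow_mult (spur_out ?u) (psi (m + 1) 2) = psi (m + 1) ?u"
    using psi_spur_out[OF upper_cases[of m], of "m + 1"] m l2 by simp
  have "psi m (-2) = (\<lambda>p. arrow_mult (spur_in ?u) (psi m ?u) p - \<alpha> * psi (m + 1) 2 p)" by (rule psi_turn)
  then have "arrow_mult (spur_out ?u) (psi m (-2)) =
      (\<lambda>p. arrow_mult (spur_out ?u) (arrow_mult (spur_in ?u) (psi m ?u)) p - \<alpha> * psi (m + 1) ?u p)"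
    using linear_map_diff[OF linear_map_arrow_mult] by (simp add: out)
  also have "\<dots> \<approx> (\<lambda>p. 0 - \<alpha> * psi (m + 1) ?u p)"
    using spur_relation[OF psi_spurs(1)[OF upper_cases] upper_cases] psi_closed[of "m + 1" ?u] upper_cases[of m] m l2 n4
    by (intro eqv_diff eqv_scale eqv_refl) auto
  finally show ?thesis by simp
qed

text \<open>Solves \<open>psi_lower\<close> for \<open>-2\<close>; again the spur relation leaves
  only the multiple of the entry \<open>2\<close>.\<close>

lemma psi_out_lower: "arrow_mult (spur_out (- upper l m)) (psi m (-2)) \<approx> (\<lambda>p. \<beta> * psi (m + 1) (- upper l m) p)"
proof -
  let ?u = "- upper l m"
  have u: "?u = 1 \<or> ?u = -1" using upper_cases[of m] by auto
  have out: "arrow_mult (spur_out ?u) (psi (m + 1) 2) = psi (m + 1) ?u"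
    using psi_spur_out[OF u, of "m + 1"] m l2 by simp
  have c1: "psi (m + 1) ?u \<in> carrier A" using psi_closed[of "m + 1" ?u] u m l2 n4 by auto
  have "(\<lambda>p. \<beta> * psi (m + 1) 2 p - (\<beta> * psi (m + 1) 2 p - psi m (-2) p)) \<approx>
      (\<lambda>p. \<beta> * psi (m + 1) 2 p - arrow_mult (spur_in ?u) (psi m ?u) p)"
    by (intro eqv_diff eqv_scale eqv_refl psi_spurs(3) eqv_sym[OF psi_lower])
  then have "arrow_mult (spur_out ?u) (psi m (-2)) \<approx>
      arrow_mult (spur_out ?u) (\<lambda>p. \<beta> * psi (m + 1) 2 p - arrow_mult (spur_in ?u) (psi m ?u) p)"
    by (intro eqv_arrow spur_arrows) simp
  also have "\<dots> = (\<lambda>p. \<beta> * psi (m + 1) ?u p - arrow_mult (spur_out ?u) (arrow_mult (spur_in ?u) (psi m ?u)) p)"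
    using linear_map_diff[OF linear_map_arrow_mult, of "spur_out ?u" "\<lambda>p. \<beta> * psi (m + 1) 2 p" 1]
      linear_map_scale[OF linear_map_arrow_mult, of "spur_out ?u" \<beta> "psi (m + 1) 2"] out by simp
  also have "\<dots> \<approx> (\<lambda>p. \<beta> * psi (m + 1) ?u p - 0)"
    by (intro eqv_diff eqv_scale eqv_refl c1 spur_relation psi_spurs(1) u)
  finally show ?thesis by simp
qed

end

text \<open>At \<open>k = 2\<close> the relation at vertex 2 splits the route through
  \<open>-3\<close> into the two spurs; the multiples of the entry \<open>2\<close> in row
  \<open>m + 2\<close> cancel, and \<open>\<alpha> + \<beta>\<close> times the entry
  \<open>-2\<close> remains. Larger \<open>k\<close> follow by commutation.\<close>

lemma psi_Y_left:
  assumes m: "l \<le> m" "m \<le> n - 1" and k: "2 \<le> k" "k \<le> n - 2"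
  shows "arrow_mult (Y (k + 1)) (psi m (- (k + 1))) \<approx> psi (m + 1) (- k)"
  using k
proof (induction rule: int_ge_induct)
  case base
  let ?u = "upper l m"
  have u: "?u = 1 \<or> ?u = -1" "- ?u = 1 \<or> - ?u = -1" using upper_cases[of m] by auto
  have X2: "X 2 \<in> arrows n" and Y3: "Y 3 \<in> arrows n" using n4 by (auto simp: arrows_def)
  note c = psi_spurs[OF m]
  have c1: "psi (m + 1) s \<in> carrier A" if "s = 1 \<or> s = -1 \<or> s = 2 \<or> s = -2" for s
    using psi_closed[of "m + 1" s] that m l2 n4 by auto
  have c2: "psi (m + 2) 2 \<in> carrier A"
    using psi_closed[of "m + 2" 2] m l2 n4 by auto
  have lin: "arrow_mult a (\<lambda>p. r * f p) = (\<lambda>p. r * arrow_mult a f p)" for a r f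
    by (rule linear_map_scale[OF linear_map_arrow_mult])
  \<comment> \<open>In row \<open>m + 1\<close> the upper and lower spurs are exchanged, because
    \<open>upper\<close> alternates; past the last row both congruences read
    \<open>0 \<approx> 0\<close>.\<close>
  have "(arrow_mult (spur_in (- ?u)) (psi (m + 1) (- ?u)) \<approx> (\<lambda>p. psi (m + 1) (-2) p + \<alpha> * psi (m + 2) 2 p)) \<and> (arrow_mult (spur_in ?u) (psi (m + 1) ?u) \<approx> (\<lambda>p. \<beta> * psi (m + 2) 2 p - psi (m + 1) (-2) p))"
  proof (cases "m + 1 \<le> n - 1")
    case True
    have "m + 1 + 1 = m + 2" by simp
    then show ?thesis
      using psi_upper[of "m + 1"] psi_lower[of "m + 1"] m True by (simp add: upper_succ add.commute[of m 2])
  next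
    case False
    then have "psi (m + 1) v = (\<lambda>p. 0)" "psi (m + 2) v = (\<lambda>p. 0)" for v using psi_beyond by simp_all
    then show ?thesis using eqv_refl[OF path_algebra_zero_closed] by simp
  qed
  then have up: "arrow_mult (spur_in (- ?u)) (psi (m + 1) (- ?u)) \<approx> (\<lambda>p. psi (m + 1) (-2) p + \<alpha> * psi (m + 2) 2 p)"
    and low: "arrow_mult (spur_in ?u) (psi (m + 1) ?u) \<approx> (\<lambda>p. \<beta> * psi (m + 2) 2 p - psi (m + 1) (-2) p)" by blast+
  have "arrow_mult (Y 3) (psi m (-3)) = arrow_mult (Y 3) (arrow_mult (X 2) (psi m (-2)))"
    using psi_X_left[of "-2" m] by simp
  also have "\<dots> \<approx> (\<lambda>p. arrow_mult (spur_in ?u) (arrow_mult (spur_out ?u) (psi m (-2))) p +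
      arrow_mult (spur_in (- ?u)) (arrow_mult (spur_out (- ?u)) (psi m (-2))) p)"
    by (rule middle_relation[OF c(4) u(1)])
  also have "\<dots> \<approx> (\<lambda>p. arrow_mult (spur_in ?u) (\<lambda>p. - \<alpha> * psi (m + 1) ?u p) p +
      arrow_mult (spur_in (- ?u)) (\<lambda>p. \<beta> * psi (m + 1) (- ?u) p) p)"
    by (intro eqv_add eqv_arrow spur_arrows psi_out_upper psi_out_lower m)
  also have "\<dots> = (\<lambda>p. - \<alpha> * arrow_mult (spur_in ?u) (psi (m + 1) ?u) p +
      \<beta> * arrow_mult (spur_in (- ?u)) (psi (m + 1) (- ?u)) p)"
    unfolding lin ..
  also have "\<dots> \<approx> (\<lambda>p. - \<alpha> * (\<beta> * psi (m + 2) 2 p - psi (m + 1) (-2) p) +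
      \<beta> * (psi (m + 1) (-2) p + \<alpha> * psi (m + 2) 2 p))"
    by (intro eqv_add eqv_scale low up)
  also have "\<dots> = psi (m + 1) (-2)"
  proof
    fix p
    have "- \<alpha> * (\<beta> * psi (m + 2) 2 p - psi (m + 1) (-2) p) + \<beta> * (psi (m + 1) (-2) p + \<alpha> * psi (m + 2) 2 p) =
      (\<alpha> + \<beta>) * psi (m + 1) (-2) p" by (simp add: algebra_simps)
    then show "- \<alpha> * (\<beta> * psi (m + 2) 2 p - psi (m + 1) (-2) p) + \<beta> * (psi (m + 1) (-2) p + \<alpha> * psi (m + 2) 2 p) =
      psi (m + 1) (-2) p" using sum1 by simp
  qed
  finally show ?case by simp
next
  case (step k)
  then have k: "2 \<le> k" "k + 1 \<le> n - 2" by auto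
  have c: "psi m (- (k + 1)) \<in> carrier A" using psi_closed[of m "- (k + 1)"] m k l2 by simp
  have "arrow_mult (Y (k + 1 + 1)) (psi m (- (k + 1 + 1))) = arrow_mult (Y (k + 2)) (arrow_mult (X (k + 1)) (psi m (- (k + 1))))"
    using psi_X_left[of "- (k + 1)" m] k by (simp add: algebra_simps)
  also have "\<dots> \<approx> arrow_mult (X k) (arrow_mult (Y (k + 1)) (psi m (- (k + 1))))"
    using arrow_relations(5)[OF c, of "k + 1"] k by (simp add: algebra_simps)
  also have "\<dots> \<approx> arrow_mult (X k) (psi (m + 1) (- k))"
    using step k by (intro eqv_arrow) (auto simp: arrows_def)
  also have "\<dots> = psi (m + 1) (- (k + 1))" using psi_X_left[of "- k" "m + 1"] k by simp
  finally show ?case .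
qed

text \<open>\<open>m - l - n\<close> is the first value past the end of the row. Row
  \<open>l\<close> ends on vertex \<open>n - 1\<close>, where no arrow leads on, so the induction
  begins with row \<open>l + 1\<close>: there the last relation gives 0, and commutation passes this
  from each row to the next.\<close>

lemma psi_row_end:
  assumes "l + 1 \<le> m" "m \<le> n - 1"
  shows "psi m (m - l - n) \<approx> (\<lambda>p. 0)"
  using assms
proof (induction rule: int_ge_induct)
  case base
  have c: "psi l (1 - n) \<in> carrier A" using psi_closed[of l "1 - n"] l2 n4 by simp
  have "psi (l + 1) (l + 1 - l - n) = arrow_mult (X (n - 2)) (psi (l + 1) (- (n - 2)))"
    using psi_X_left[of "- (n - 2)" "l + 1"] n4 by simp
  also have "\<dots> \<approx> arrow_mult (X (n - 2)) (arrow_mult (Y (n - 1)) (psi l (1 - n)))"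
    by (rule eqv_arrow[OF _ eqv_sym]) (use psi_Y_left[of l "n - 2"] ln n4 in \<open>auto simp: arrows_def\<close>)
  also have "\<dots> \<approx> (\<lambda>p. 0)" by (rule arrow_relations(4)[OF c])
  finally show ?case .
next
  case (step m)
  define k where "k = n - 1 - (m - l)"
  have k: "3 \<le> k" "k \<le> n - 2" using step l2 by (auto simp: k_def)
  have c: "psi m (- k) \<in> carrier A" using psi_closed[of m "- k"] k step l2 by simp
  have e: "m + 1 - l - n = - (k - 1) - 1" "m - l - n = - k - 1" by (simp_all add: k_def)
  have "psi (m + 1) (m + 1 - l - n) = arrow_mult (X (k - 1)) (psi (m + 1) (- (k - 1)))"
    using psi_X_left[of "- (k - 1)" "m + 1"] k unfolding e by simp
  also have "\<dots> \<approx> arrow_mult (X (k - 1)) (arrow_mult (Y k) (psi m (- k)))"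
    by (rule eqv_arrow[OF _ eqv_sym]) (use psi_Y_left[of m "k - 1"] step k in \<open>auto simp: arrows_def\<close>)
  also have "\<dots> \<approx> arrow_mult (Y (k + 1)) (arrow_mult (X k) (psi m (- k)))"
    by (rule eqv_sym[OF arrow_relations(5)[OF c k]])
  also have "arrow_mult (Y (k + 1)) (arrow_mult (X k) (psi m (- k))) = arrow_mult (Y (k + 1)) (psi m (m - l - n))"
    using psi_X_left[of "- k" m] k unfolding e by simp
  also have "\<dots> \<approx> arrow_mult (Y (k + 1)) (\<lambda>p. 0)"
    using step k by (intro eqv_arrow) (auto simp: arrows_def)
  finally show ?case by simp
qed


section \<open>The map back from the array to the path algebra\<close>

definition theta :: "(entry \<Rightarrow> 'k) \<Rightarrow> path \<Rightarrow> 'k" where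
  "theta f = (\<lambda>p. \<Sum>e\<in>E. f e * psi (fst e) (snd e) p)"

lemma linear_map_theta: "linear_map theta"
  by (auto simp: linear_map_def theta_def fun_eq_iff sum.distrib sum_distrib_left algebra_simps)

text \<open>Just past the end of a row \<open>psi\<close> is in general only congruent to 0, so the
  cut-off is made explicit.\<close>

definition psi_or_zero :: "int \<Rightarrow> int \<Rightarrow> path \<Rightarrow> 'k" where
  "psi_or_zero m v = (if (m, v) \<in> E then psi m v else (\<lambda>p. 0))"

lemma psi_array_closed: "(m, v) \<in> E \<Longrightarrow> psi m v \<in> carrier A"
  using l2 by (intro psi_closed) (auto simp: array_iff)

lemma psi_or_zero_beyond: "\<lbrakk>l \<le> m; m - l + 1 - n \<le> v; v \<le> m; v \<noteq> 0\<rbrakk> \<Longrightarrow> psi_or_zero m v = psi m v"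
  using psi_beyond[of m v] by (auto simp: psi_or_zero_def array_iff)

lemma theta_unit_vec: "(m, v) \<in> E \<Longrightarrow> theta (unit_vec m v) = psi m v"
proof -
  assume "(m, v) \<in> E"
  have "theta (unit_vec m v) = (\<lambda>p. \<Sum>e\<in>E. if e = (m, v) then psi m v p else 0)"
    unfolding theta_def unit_vec_def by (auto intro!: sum.cong)
  then show ?thesis using \<open>(m, v) \<in> E\<close> finite_array by simp
qed

text \<open>A quiver arrow takes an entry to a combination of at most two entries; simpler cases are
  padded with coefficient 0.\<close>

lemma theta_arrow_unit:
  assumes mv: "(m, v) \<in> E" and a: "a \<in> arrows n"
    and f: "\<And>m' v'. (m', v') \<in> E \<Longrightarrow> arrow_formula a (unit_vec m v) m' v' =
      (if m' = m1 \<and> v' = v1 then c else 0) + (if m' = m2 \<and> v' = v2 then d else 0)"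
  shows "theta (arr a (unit_vec m v)) = (\<lambda>p. c * psi_or_zero m1 v1 p + d * psi_or_zero m2 v2 p)"
proof
  fix p
  have "theta (arr a (unit_vec m v)) p =
    (\<Sum>e\<in>E. (if e = (m1, v1) then c * psi m1 v1 p else 0) + (if e = (m2, v2) then d * psi m2 v2 p else 0))"
    unfolding theta_def
  proof (intro sum.cong refl)
    fix e assume e: "e \<in> E"
    obtain m' v' where e': "e = (m', v')" by force
    show "arr a (unit_vec m v) e * psi (fst e) (snd e) p =
      (if e = (m1, v1) then c * psi m1 v1 p else 0) + (if e = (m2, v2) then d * psi m2 v2 p else 0)"
      using e f[of m' v'] unfolding e' arrow_act_formula[OF unit_vec_V[OF mv] a] by (auto simp: algebra_simps)
  qed
  also have "\<dots> = c * psi_or_zero m1 v1 p + d * psi_or_zero m2 v2 p"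
    using finite_array[of n l] by (simp add: sum.distrib psi_or_zero_def)
  finally show "theta (arr a (unit_vec m v)) p = c * psi_or_zero m1 v1 p + d * psi_or_zero m2 v2 p" .
qed

lemma arrow_theta_unit:
  assumes mv: "(m, v) \<in> E" and a: "a \<in> arrows n" and s: "src a = entry_vertex (m, v)"
  shows "arrow_mult a (psi m v) \<approx> theta (arr a (unit_vec m v))"
proof -
  note th = theta_arrow_unit[OF mv a]
  have bounds: "l \<le> m" "m \<le> n - 1" "m - l + 1 - n \<le> v" "v \<le> m" "v \<noteq> 0"
    using mv by (auto simp: array_iff)
  note simps = unit_vec_apply array_iff
  consider (X_right) "2 \<le> v" "a = X v" | (Y_right) "2 \<le> v" "a = Y v" | (Y2') "v = 2" "a = Y2'"
    | (spur) "v = 1 \<or> v = -1" "a = spur_in v" | (turn) s where "v = -2" "s = 1 \<or> s = -1" "a = spur_out s"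
    | (X_left) "v \<le> -2" "a = X (- v)" | (Y_left) "v \<le> -3" "a = Y (- v)"
  proof -
    have "(2 \<le> v \<and> a = X v) \<or> (2 \<le> v \<and> a = Y v) \<or> (v = 2 \<and> a = Y2') \<or> ((v = 1 \<or> v = -1) \<and> a = spur_in v)
      \<or> (v = -2 \<and> (a = spur_out 1 \<or> a = spur_out (-1))) \<or> (v \<le> -2 \<and> a = X (- v)) \<or> (v \<le> -3 \<and> a = Y (- v))"
      using s a bounds(5) by (cases a) (auto simp: arrows_def spur_in_def spur_out_def split: if_splits)
    then show ?thesis using that by blast
  qed
  then show ?thesis
  proof cases
    case X_right
    then have v: "v \<le> n - 2" using a by (auto simp: arrows_def)
    have "theta (arr a (unit_vec m v)) = (\<lambda>p. 1 * psi_or_zero (m + 1) (v + 1) p + 0 * psi_or_zero (m + 1) (v + 1) p)"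
      by (rule th) (use X_right bounds in \<open>auto simp: simps\<close>)
    moreover have "psi_or_zero (m + 1) (v + 1) = psi (m + 1) (v + 1)"
      using X_right bounds n4 l2 by (intro psi_or_zero_beyond) auto
    ultimately show ?thesis using psi_X_up[OF bounds(1,2) X_right(1) bounds(4) v] X_right by simp
  next
    case Y_right
    then have E': "(m, v - 1) \<in> E" using bounds l2 n4 by (simp add: array_iff)
    have "theta (arr a (unit_vec m v)) = (\<lambda>p. 1 * psi_or_zero m (v - 1) p + 0 * psi_or_zero m (v - 1) p)"
      by (rule th) (use Y_right bounds in \<open>auto simp: simps\<close>)
    then show ?thesis
      using psi_Y[OF Y_right(1) bounds(4)] Y_right E' eqv_refl[OF psi_array_closed[OF E']] by (simp add: psi_or_zero_def)
  next
    case Y2'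
    then have E': "(m, -1) \<in> E" using bounds l2 n4 by (simp add: array_iff)
    have "theta (arr a (unit_vec m v)) = (\<lambda>p. 1 * psi_or_zero m (-1) p + 0 * psi_or_zero m (-1) p)"
      by (rule th) (use Y2' bounds in \<open>auto simp: simps\<close>)
    then show ?thesis
      using psi_spur_out[of "-1" m] bounds Y2' E' eqv_refl[OF psi_array_closed[OF E']]
      by (simp add: psi_or_zero_def spur_out_def)
  next
    case spur
    define h :: 'k where "h = (if upper l m = v then 1 else -1)"
    define \<gamma> where "\<gamma> = (if upper l m = v then \<alpha> else \<beta>)"
    have E': "(m, -2) \<in> E" using bounds l2 n4 ln by (simp add: array_iff)
    have "theta (arr a (unit_vec m v)) = (\<lambda>p. h * psi_or_zero m (-2) p + \<gamma> * psi_or_zero (m + 1) 2 p)"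
      by (rule th) (use spur bounds upper_cases[of m] in \<open>auto simp: simps spur_in_def h_def \<gamma>_def upper_succ eq_diff_eq\<close>)
    moreover have "psi_or_zero (m + 1) 2 = psi (m + 1) 2"
      using bounds n4 l2 by (intro psi_or_zero_beyond) auto
    ultimately have t: "theta (arr a (unit_vec m v)) = (\<lambda>p. h * psi m (-2) p + \<gamma> * psi (m + 1) 2 p)"
      using E' by (simp add: psi_or_zero_def)
    show ?thesis
    proof (cases "upper l m = v")
      case True
      then show ?thesis unfolding t using psi_upper[OF bounds(1,2)] spur by (simp add: h_def \<gamma>_def)
    next
      case False
      then have "- upper l m = v" using upper_cases[of m] spur(1) by auto
      then show ?thesis
        unfolding t using psi_lower[OF bounds(1,2)] spur False by (simp add: h_def \<gamma>_def algebra_simps)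
    qed
  next
    case (turn s)
    define \<gamma> where "\<gamma> = (if upper l m = s then - \<alpha> else \<beta>)"
    have "theta (arr a (unit_vec m v)) = (\<lambda>p. \<gamma> * psi_or_zero (m + 1) s p + 0 * psi_or_zero (m + 1) s p)"
      by (rule th) (use turn bounds upper_cases[of m] in \<open>auto simp: simps spur_out_def \<gamma>_def upper_succ eq_diff_eq\<close>)
    moreover have "psi_or_zero (m + 1) s = psi (m + 1) s"
      using bounds n4 l2 turn by (intro psi_or_zero_beyond) auto
    ultimately have t: "theta (arr a (unit_vec m v)) = (\<lambda>p. \<gamma> * psi (m + 1) s p)" by simp
    show ?thesis
    proof (cases "upper l m = s")
      case True
      then show ?thesis unfolding t using psi_out_upper[OF bounds(1,2)] turn by (simp add: \<gamma>_def)
    next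
      case False
      then have "- upper l m = s" using upper_cases[of m] turn(2) by auto
      then show ?thesis unfolding t using psi_out_lower[OF bounds(1,2)] turn False by (simp add: \<gamma>_def)
    qed
  next
    case X_left
    have t: "theta (arr a (unit_vec m v)) = (\<lambda>p. 1 * psi_or_zero m (v - 1) p + 0 * psi_or_zero m (v - 1) p)"
      by (rule th) (use X_left bounds in \<open>auto simp: simps\<close>)
    have e: "arrow_mult a (psi m v) = psi m (v - 1)" using psi_X_left[OF X_left(1)] X_left by simp
    show ?thesis
    proof (cases "(m, v - 1) \<in> E")
      case True
      then show ?thesis using t e eqv_refl[OF psi_array_closed[OF True]] by (simp add: psi_or_zero_def)
    next
      case False
      then have v: "v = m - l + 1 - n" using bounds X_left by (simp add: array_iff)
      \<comment> \<open>In row \<open>l\<close> the entry would be \<open>1 - n\<close>, but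
        \<open>X (n - 1)\<close> is not an arrow.\<close>
      then have m: "l + 1 \<le> m" using a X_left bounds by (auto simp: arrows_def)
      have vm: "v - 1 = m - l - n" using v by simp
      have "theta (arr a (unit_vec m v)) = (\<lambda>p. 0)" using t False by (simp add: psi_or_zero_def)
      then show ?thesis using e psi_row_end[OF m bounds(2)] unfolding vm by simp
    qed
  next
    case Y_left
    have t: "theta (arr a (unit_vec m v)) = (\<lambda>p. 1 * psi_or_zero (m + 1) (v + 1) p + 0 * psi_or_zero (m + 1) (v + 1) p)"
      by (rule th) (use Y_left bounds in \<open>auto simp: simps\<close>)
    moreover have "psi_or_zero (m + 1) (v + 1) = psi (m + 1) (v + 1)"
      using bounds n4 l2 Y_left by (intro psi_or_zero_beyond) auto
    moreover have "arrow_mult (Y (- v)) (psi m v) \<approx> psi (m + 1) (v + 1)"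
      using psi_Y_left[OF bounds(1,2), of "- v - 1"] Y_left bounds l2 by (simp add: add.commute)
    ultimately show ?thesis using Y_left by simp
  qed
qed

lemma arrow_theta:
  assumes a: "a \<in> arrows n" and g: "g \<in> V" "\<And>e. g e \<noteq> 0 \<Longrightarrow> entry_vertex e = src a"
  shows "arrow_mult a (theta g) \<approx> theta (arr a g)"
proof -
  let ?Q = "{e \<in> E. g e \<noteq> 0}" and ?u = "\<lambda>e. unit_vec (fst e) (snd e)"
  have fin: "finite ?Q" using finite_array by simp
  have g_sum: "g = (\<lambda>x. \<Sum>e\<in>?Q. g e * ?u e x)"
  proof
    fix x
    have "(\<Sum>e\<in>?Q. g e * ?u e x) = (\<Sum>e\<in>?Q. if e = x then g x else 0)"
      by (intro sum.cong) (auto simp: unit_vec_def)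
    also have "\<dots> = g x" using fin V_zero[OF g(1), of x] by auto
    finally show "g x = (\<Sum>e\<in>?Q. g e * ?u e x)" by simp
  qed
  have "theta g = (\<lambda>p. \<Sum>e\<in>?Q. g e * psi (fst e) (snd e) p)"
    unfolding theta_def using finite_array[of n l] by (intro ext sum.mono_neutral_cong_right) auto
  then have "arrow_mult a (theta g) = (\<lambda>p. \<Sum>e\<in>?Q. g e * arrow_mult a (psi (fst e) (snd e)) p)"
    using linear_map_sum[OF linear_map_arrow_mult fin] by simp
  also have "\<dots> \<approx> (\<lambda>p. \<Sum>e\<in>?Q. g e * theta (arr a (?u e)) p)"
  proof (rule eqv_sum[OF _ fin])
    fix e assume e: "e \<in> ?Q"
    then show "arrow_mult a (psi (fst e) (snd e)) \<approx> theta (arr a (?u e))"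
      using g(2)[of e] by (intro arrow_theta_unit a) auto
  qed
  also have "\<dots> = theta (\<lambda>x. \<Sum>e\<in>?Q. g e * arr a (?u e) x)"
    using linear_map_sum[OF linear_map_theta fin] by simp
  also have "(\<lambda>x. \<Sum>e\<in>?Q. g e * arr a (?u e) x) = arr a (\<lambda>x. \<Sum>e\<in>?Q. g e * ?u e x)"
    by (rule linear_map_sum[OF linear_map_arrow_act fin, symmetric])
  also have "(\<lambda>x. \<Sum>e\<in>?Q. g e * ?u e x) = g" by (rule g_sum[symmetric])
  finally show ?thesis .
qed

text \<open>Paths are extended at their end, since the last arrow acts last; the vector before it
  lives on its source, as \<open>arrow_theta\<close> requires.\<close>

lemma path_theta: "is_path n (l, as) \<Longrightarrow> path_elt (l, as) \<approx> theta (path_act n l \<alpha> \<beta> (l, as) gen_vec)"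
proof (induction as rule: rev_induct)
  case Nil
  have ll: "(l, l) \<in> E" using l2 ln by (simp add: array_iff)
  have "path_act n l \<alpha> \<beta> (l, []) gen_vec = unit_vec l l"
    using l2 by (auto simp: path_act_def gen_vec_def unit_vec_def fun_eq_iff)
  moreover have "psi l l = path_elt (l, [])"
    using l2 ln by (simp add: psi_start row_elt_def row_path_def)
  ultimately show ?case using theta_unit_vec[OF ll] eqv_refl[OF path_elt_closed[OF Nil]] by simp
next
  case (snoc a as)
  then have p: "is_path n (l, as)" "a \<in> arrows n" "src a = path_end (l, as)" by (auto simp: is_path_append)
  have "path_mult (path_elt (src a, [a])) (path_elt (l, as)) = (if path_end (l, as) = fst (src a, [a])
      then path_elt (path_comp (src a, [a]) (l, as)) else (\<lambda>p. 0 :: 'k))"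
    by (rule path_mult_path_elts)
  also have "\<dots> = path_elt (l, as @ [a])" using p by (simp add: path_comp_def)
  finally have "path_elt (l, as @ [a]) = arrow_mult a (path_elt (l, as))" by (simp only: arrow_mult_def)
  also have "\<dots> \<approx> arrow_mult a (theta (path_act n l \<alpha> \<beta> (l, as) gen_vec))"
    using snoc.IH p by (intro eqv_arrow) auto
  also have "\<dots> \<approx> theta (arr a (path_act n l \<alpha> \<beta> (l, as) gen_vec))"
    using p path_act_vectors[OF gen_vec_V] path_act_supported(2)[OF gen_vec_V] by (intro arrow_theta) auto
  also have "arr a (path_act n l \<alpha> \<beta> (l, as) gen_vec) = path_act n l \<alpha> \<beta> (l, as @ [a]) gen_vec"
    by (simp add: path_act_def)
  finally show ?case .
qed

text \<open>Paths that do not start at \<open>l\<close> give 0 on both sides, so linearity reduces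
  this to \<open>path_theta\<close>.\<close>

lemma path_algebra_theta:
  assumes c: "c \<in> carrier A"
  shows "path_mult c (path_elt (l, [])) \<approx> theta (act c gen_vec)"
proof -
  let ?p = "\<lambda>p. if fst p = l then path_elt p else (\<lambda>q. 0)"
  have fin: "finite (supp c)" by (rule supp_finite[OF c])
  have "path_mult c (path_elt (l, [])) = (\<lambda>q. \<Sum>p\<in>supp c. c p * ?p p q)"
  proof
    fix q :: path
    obtain i as where q: "q = (i, as)" by force
    have "path_mult c (path_elt (l, [])) q = (\<Sum>t\<le>length as. if t = 0 then (if i = l then c q else 0) else 0)"
      unfolding q prod.case by (rule sum.cong) (auto simp: path_elt_def)
    also have "\<dots> = (if i = l then c q else 0)" by simp
    also have "\<dots> = (\<Sum>p\<in>supp c. if p = q then (if i = l then c q else 0) else 0)"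
      using fin by (auto simp: supp_def)
    also have "\<dots> = (\<Sum>p\<in>supp c. c p * ?p p q)"
      by (intro sum.cong) (auto simp: q path_elt_def)
    finally show "path_mult c (path_elt (l, [])) q = (\<Sum>p\<in>supp c. c p * ?p p q)" .
  qed
  also have "\<dots> \<approx> (\<lambda>q. \<Sum>p\<in>supp c. c p * theta (path_act n l \<alpha> \<beta> p gen_vec) q)"
  proof (rule eqv_sum[OF _ fin])
    fix p assume p: "p \<in> supp c"
    show "?p p \<approx> theta (path_act n l \<alpha> \<beta> p gen_vec)"
    proof (cases "fst p = l")
      case True
      moreover have "is_path n p" using path_algebra_is_path[OF c] p by (simp add: supp_def)
      ultimately show ?thesis using path_theta[of "snd p"] by (cases p) auto
    next
      case False
      have "(\<lambda>e. if entry_vertex e = fst p then gen_vec e else 0) = (\<lambda>e. 0)"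
        using False l2 by (auto simp: gen_vec_def unit_vec_def)
      then have "path_act n l \<alpha> \<beta> p gen_vec = (\<lambda>e. 0)"
        unfolding path_act_def by (simp add: linear_map_zero[OF linear_map_fold[OF linear_map_arrow_act]])
      then show ?thesis
        using False linear_map_zero[OF linear_map_theta] eqv_refl[OF path_algebra_zero_closed] by simp
    qed
  qed
  also have "\<dots> = theta (act c gen_vec)"
    unfolding path_algebra_act_eq by (rule linear_map_sum[OF linear_map_theta fin, symmetric])
  finally show ?thesis .
qed

lemma N_abelian_subgroup: "abelian_subgroup N A"
  by (rule abelian_subgroupI3[OF ideal.axioms(1)[OF N_ideal] A_abelian_group])

lemma gen_vec_faithful:
  assumes x: "x \<in> carrier PP" "x \<odot>\<^bsub>M\<^esub> gen_vec = \<zero>\<^bsub>M\<^esub>"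
  shows "x \<otimes>\<^bsub>PP\<^esub> idem n l = \<zero>\<^bsub>PP\<^esub>"
proof -
  obtain c where c: "c \<in> carrier A" "x = cls c" using PP_rep[OF x(1)] by blast
  have p: "path_elt (l, []) \<in> carrier A" using l2 ln by (intro path_elt_closed) (simp add: vertices_def)
  have "act c gen_vec = (\<lambda>e. 0)" using x(2) c smult_cls[OF c(1) gen_vec_V] by simp
  then have "path_mult c (path_elt (l, [])) \<approx> (\<lambda>p. 0)"
    using path_algebra_theta[OF c(1)] linear_map_zero[OF linear_map_theta] by simp
  then have "path_mult c (path_elt (l, [])) \<in> N" by (simp only: eqv_zero_iff)
  then have "cls (path_mult c (path_elt (l, []))) = N"
    by (rule abelian_subgroup.a_rcos_const[OF N_abelian_subgroup])
  then show ?thesis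
    using cls_mult[OF c(1) p] c by (simp add: idem_eq preproj_def FactRing_def)
qed

end

section \<open>The subarray of a join-irreducible element\<close>

text \<open>The value \<open>j = -2\<close>, separate in the definition, fits the rule for
  \<open>j \<le> -3\<close>: its lower bound is \<open>j + 1 = -1\<close>, with 0 left out.\<close>

lemma C_iff:
  assumes "j \<noteq> 0" "1 \<le> m"
  shows "v \<in> C m j \<longleftrightarrow> v \<le> m \<and> v \<noteq> 0 \<and>
    (1 \<le> j \<and> j \<le> v \<or> j = -1 \<and> (2 \<le> v \<or> v = -1) \<or> j \<le> -2 \<and> j + 1 \<le> v)"
  using assms unfolding C_def by (cases "j = -2") auto

locale grassmannian_elt =
  fixes n l :: int and w :: "int \<Rightarrow> int"
  assumes n4: "4 \<le> n" and l2: "2 \<le> l" and ln: "l \<le> n - 1" and gr: "grassmannian n l w"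
begin

abbreviation "S \<equiv> subarray n l w"

lemma weyl: "w \<in> weyl n"
  using gr by (simp add: grassmannian_def)

lemma w_step: "\<lbrakk>l + 1 \<le> i; i < n\<rbrakk> \<Longrightarrow> w i < w (i + 1)"
  using gr l2 by (auto simp: grassmannian_def ascent_def vertices_def)

lemma w_mono:
  assumes "l + 1 \<le> i" "i < k" "k \<le> n"
  shows "w i < w k"
proof -
  have "i + 1 \<le> k" using assms by simp
  then show ?thesis using assms(3)
  proof (induction rule: int_ge_induct)
    case base then show ?case using w_step[of i] assms by simp
  next
    case (step k) then show ?case using w_step[of k] assms(1) by simp
  qed
qed

lemma w_range: "1 \<le> i \<Longrightarrow> i \<le> n \<Longrightarrow> w i \<noteq> 0 \<and> - n \<le> w i \<and> w i \<le> n"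
  using weyl_signed_range[OF weyl, of i] by (auto simp: signed_range_def)

lemma w_abs_inj:
  assumes "1 \<le> i" "1 \<le> k" "\<bar>w i\<bar> = \<bar>w k\<bar>"
  shows "i = k"
proof -
  have "w i = w k \<or> w i = w (- k)" using assms weyl_minus[OF weyl, of k] by auto
  then show ?thesis using weyl_inj[OF weyl] assms by auto
qed

lemma w_le: "\<lbrakk>l \<le> m; m \<le> n - 1\<rbrakk> \<Longrightarrow> w (m + 1) \<le> m + 1"
  by (rule increasing_bounded_above[where a = "l + 1" and n = n])
    (use w_step w_range[of n] n4 in auto)

text \<open>Keeps the subarray inside the array: the lowest value \<open>w (m + 1) + 1\<close> of a
  long row does not pass the right end of the row.\<close>

lemma w_ge:
  assumes "l \<le> m" "m \<le> n - 1"
  shows "m - l - n \<le> w (m + 1)"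
  using assms
proof (induction rule: int_ge_induct)
  case base then show ?case using w_range[of "l + 1"] l2 by simp
next
  case (step m) then show ?case using w_step[of "m + 1"] by simp
qed

lemma subarray_iff:
  "(m, v) \<in> S \<longleftrightarrow> l \<le> m \<and> m \<le> n - 1 \<and> v \<le> m \<and> v \<noteq> 0 \<and>
    (1 \<le> w (m + 1) \<and> w (m + 1) \<le> v \<or> w (m + 1) = -1 \<and> (2 \<le> v \<or> v = -1) \<or> w (m + 1) \<le> -2 \<and> w (m + 1) + 1 \<le> v)"
  using C_iff[of "w (m + 1)" m v] w_range[of "m + 1"] l2 by (auto simp: subarray_def)

lemma array_iff': "(m, v) \<in> array n l \<longleftrightarrow> l \<le> m \<and> m \<le> n - 1 \<and> m - l + 1 - n \<le> v \<and> v \<le> m \<and> v \<noteq> 0"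
  by (simp add: array_def)

lemma subarray_subset: "S \<subseteq> array n l"
proof clarify
  fix m v assume "(m, v) \<in> S"
  then show "(m, v) \<in> array n l"
    using w_ge[of m] l2 by (auto simp: subarray_iff array_iff')
qed

text \<open>\<open>bad m\<close>: the rows \<open>m\<close> and \<open>m + 1\<close> violate the closure under one vertical arrow, whose scalar is
  \<open>\<plusminus>\<alpha>\<close> if \<open>alpha_type m\<close> and \<open>\<plusminus>\<beta>\<close> otherwise.\<close>

definition bad :: "int \<Rightarrow> bool" where
  "bad m \<longleftrightarrow> l \<le> m \<and> m \<le> n - 2 \<and>
    (w (m + 1), w (m + 2)) \<in> {(1, 2), (-1, 2), (-2, 1), (-2, -1)}"

definition alpha_type :: "int \<Rightarrow> bool" where
  "alpha_type m \<longleftrightarrow> upper l m = - sgn (w (m + 1) * w (m + 2))"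

lemma v_arrow_cases:
  assumes "v_arrow (m, v) (m', v')" "v \<noteq> 0" "v' \<noteq> 0"
  obtains "m' = m + 1" "v' = v + 1" "2 \<le> v \<or> v \<le> -3" | "m' = m + 1" "v = 1 \<or> v = -1" "v' = 2"
    | "m' = m + 1" "v = -2" "v' = 1 \<or> v' = -1"
proof -
  have c: "column (m', v') = column (m, v)" using assms(1) unfolding v_arrow_def by blast
  have m: "m' = m + 1" using assms(1) unfolding v_arrow_def by simp
  have "v' = v + 1 \<and> (2 \<le> v \<or> v \<le> -3) \<or> (v = 1 \<or> v = -1) \<and> v' = 2 \<or> v = -2 \<and> (v' = 1 \<or> v' = -1)"
    using c assms(2,3) unfolding m column.simps
    by (cases "1 \<le> v"; cases "1 \<le> v'"; cases "v = -1"; cases "v' = -1"; simp; presburger?)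
  then show ?thesis using that m by blast
qed

lemma h_arrow_cases:
  assumes "h_arrow (m, v) (m', v')" "v \<noteq> 0" "v' \<noteq> 0"
  obtains "m' = m" "v' = v - 1" "3 \<le> v \<or> v \<le> -2" | "m' = m" "v = 2" "v' = 1 \<or> v' = -1"
    | "m' = m" "v = 1 \<or> v = -1" "v' = -2"
proof -
  have c: "column (m', v') = column (m, v) + 1" using assms(1) unfolding h_arrow_def by blast
  have m: "m' = m" using assms(1) unfolding h_arrow_def by simp
  have "v' = v - 1 \<and> (3 \<le> v \<or> v \<le> -2) \<or> v = 2 \<and> (v' = 1 \<or> v' = -1) \<or> (v = 1 \<or> v = -1) \<and> v' = -2"
    using c assms(2,3) unfolding m column.simps
    by (cases "1 \<le> v"; cases "1 \<le> v'"; cases "v = -1"; cases "v' = -1"; simp; presburger?)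
  then show ?thesis using that m by blast
qed

lemma h_closed:
  assumes "(m, v) \<in> array n l" "(m', v') \<in> S" "h_arrow (m, v) (m', v')"
  shows "(m, v) \<in> S"
proof -
  have "v \<noteq> 0" "v' \<noteq> 0" "v \<le> m" using assms by (auto simp: array_iff' subarray_iff)
  from h_arrow_cases[OF assms(3) this(1,2)] show ?thesis
    by cases (use assms(2) \<open>v \<le> m\<close> \<open>v \<noteq> 0\<close> in \<open>auto simp: subarray_iff\<close>)
qed

text \<open>Here \<open>j < j'\<close> are the values of \<open>w\<close> that cut off two
  consecutive rows; \<open>v'\<close> lies in the lower row and \<open>v\<close> is missing from the
  upper one. Monotonicity excludes this except around the two-entry positions, where four cases
  remain.\<close>

lemma row_values_cases:
  fixes j j' v v' :: int
  assumes "1 \<le> j' \<and> j' \<le> v' \<or> j' = -1 \<and> (2 \<le> v' \<or> v' = -1) \<or> j' \<le> -2 \<and> j' + 1 \<le> v'"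
    and "\<not> (1 \<le> j \<and> j \<le> v \<or> j = -1 \<and> (2 \<le> v \<or> v = -1) \<or> j \<le> -2 \<and> j + 1 \<le> v)"
    and "j < j'" "j \<noteq> - j'" "j \<noteq> 0" "j' \<noteq> 0"
  shows "v' = v + 1 \<Longrightarrow> 2 \<le> v \<or> v \<le> -3 \<Longrightarrow> False"
    and "v = 1 \<or> v = -1 \<Longrightarrow> v' = 2 \<Longrightarrow> (j = 1 \<and> j' = 2 \<and> v = -1) \<or> (j = -1 \<and> j' = 2 \<and> v = 1)"
    and "v = -2 \<Longrightarrow> v' = 1 \<or> v' = -1 \<Longrightarrow> (j = -2 \<and> j' = 1 \<and> v' = 1) \<or> (j = -2 \<and> j' = -1 \<and> v' = -1)"
  using assms by (smt (verit))+

text \<open>Origin of \<open>alpha_type\<close>: in each of the four cases the sign of the product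
  of the two values, compared with the position of the upper entry, tells whether the offending
  arrow carries \<open>\<alpha>\<close> or \<open>\<beta>\<close>.\<close>

lemma bad_scalar:
  fixes \<alpha> \<beta> :: "'k::field"
  assumes "(j = 1 \<and> j' = 2 \<and> v = -1 \<and> v' = 2) \<or> (j = -1 \<and> j' = 2 \<and> v = 1 \<and> v' = 2) \<or>
      (j = -2 \<and> j' = 1 \<and> v = -2 \<and> v' = 1) \<or> (j = -2 \<and> j' = -1 \<and> v = -2 \<and> v' = -1)"
    and "u = 1 \<or> u = -1"
  shows "(if single v \<and> single v' then 1 else if \<not> single v then if v = u then \<alpha> else \<beta>
       else if v' = - u then \<beta> else - \<alpha>) = 0 \<longleftrightarrow> (if u = - sgn (j * j') then \<alpha> else \<beta>) = 0"
  using assms by (elim disjE conjE) (simp_all add: single_def)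

lemma v_closed_or_bad:
  assumes "(m, v) \<in> array n l" "(m', v') \<in> S" "v_arrow (m, v) (m', v')" "(m, v) \<notin> S"
  shows "bad m" "scalar l \<alpha> \<beta> (m, v) (m', v') = 0 \<longleftrightarrow> (if alpha_type m then \<alpha> else \<beta>) = (0 :: 'k::field)"
proof -
  have v: "v \<noteq> 0" "v \<le> m" and m: "l \<le> m" "m \<le> n - 1" using assms(1) by (simp_all add: array_iff')
  have v'0: "v' \<noteq> 0" and m'n: "m' \<le> n - 1" using assms(2) by (simp_all add: subarray_iff)
  have m': "m' = m + 1" using assms(3) unfolding v_arrow_def by simp
  define j j' where "j = w (m + 1)" and "j' = w (m + 2)"
  have jj: "j < j'" using w_step[of "m + 1"] m m' m'n by (simp add: j_def j'_def add.commute)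
  have ne: "\<bar>j\<bar> \<noteq> \<bar>j'\<bar>" using w_abs_inj[of "m + 1" "m + 2"] m l2 by (auto simp: j_def j'_def)
  have ne': "j \<noteq> j'" "j \<noteq> - j'" using ne by auto
  have nz: "j \<noteq> 0" "j' \<noteq> 0" using w_range[of "m + 1"] w_range[of "m + 2"] m m' m'n l2 by (simp_all add: j_def j'_def)
  have in': "1 \<le> j' \<and> j' \<le> v' \<or> j' = -1 \<and> (2 \<le> v' \<or> v' = -1) \<or> j' \<le> -2 \<and> j' + 1 \<le> v'"
    using assms(2) m' by (simp add: subarray_iff j'_def add.commute)
  have out: "\<not> (1 \<le> j \<and> j \<le> v \<or> j = -1 \<and> (2 \<le> v \<or> v = -1) \<or> j \<le> -2 \<and> j + 1 \<le> v)"
    using assms(4) v m unfolding subarray_iff j_def by blast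
  have cases: "(j = 1 \<and> j' = 2 \<and> v = -1 \<and> v' = 2) \<or> (j = -1 \<and> j' = 2 \<and> v = 1 \<and> v' = 2) \<or>
      (j = -2 \<and> j' = 1 \<and> v = -2 \<and> v' = 1) \<or> (j = -2 \<and> j' = -1 \<and> v = -2 \<and> v' = -1)"
    using v_arrow_cases[OF assms(3) v(1) v'0]
  proof cases
    case 1 then show ?thesis using row_values_cases(1)[OF in' out jj ne'(2) nz] by blast
  next
    case 2 then show ?thesis using row_values_cases(2)[OF in' out jj ne'(2) nz] by blast
  next
    case 3 then show ?thesis using row_values_cases(3)[OF in' out jj ne'(2) nz] by blast
  qed
  show "bad m" unfolding bad_def using cases m m' m'n by (elim disjE conjE) (simp_all flip: j_def j'_def)
  have up: "upper l (m + 1) = - upper l m" "upper l m = 1 \<or> upper l m = -1" by (auto simp: upper_def)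
  have s: "scalar l \<alpha> \<beta> (m, v) (m', v') =
      (if single v \<and> single v' then 1 else if \<not> single v then if v = upper l m then \<alpha> else \<beta>
       else if v' = upper l m' then \<beta> else - \<alpha>)"
    using assms(3) by (auto simp: h_arrow_def v_arrow_def)
  have t: "alpha_type m \<longleftrightarrow> upper l m = - sgn (j * j')" by (simp add: alpha_type_def j_def j'_def)
  show "scalar l \<alpha> \<beta> (m, v) (m', v') = 0 \<longleftrightarrow> (if alpha_type m then \<alpha> else \<beta>) = 0"
    unfolding s t unfolding m' up(1) by (rule bad_scalar[OF cases up(2)])
qed

text \<open>A tail value placed between those of absolute value 1 and 2 would be nonzero of absolute
  value at most 2, hence one of them again. So they are adjacent, and the increasing pairs with
  these absolute values are the four in \<open>bad\<close>.\<close>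

lemma bad_iff: "(\<exists>m. bad m) \<longleftrightarrow> {1, 2} \<subseteq> (\<lambda>m. \<bar>w m\<bar>) ` {l+1..n}"
proof
  assume "\<exists>m. bad m"
  then obtain m where m: "l \<le> m" "m \<le> n - 2" "{1, 2} \<subseteq> {\<bar>w (m + 1)\<bar>, \<bar>w (m + 2)\<bar>}"
    by (auto simp: bad_def)
  then have "{\<bar>w (m + 1)\<bar>, \<bar>w (m + 2)\<bar>} \<subseteq> (\<lambda>m. \<bar>w m\<bar>) ` {l+1..n}" by auto
  then show "{1, 2} \<subseteq> (\<lambda>m. \<bar>w m\<bar>) ` {l+1..n}" using m(3) by blast
next
  assume "{1, 2} \<subseteq> (\<lambda>m. \<bar>w m\<bar>) ` {l+1..n}"
  then obtain p q where pq: "l + 1 \<le> p" "p \<le> n" "\<bar>w p\<bar> = 1" "l + 1 \<le> q" "q \<le> n" "\<bar>w q\<bar> = 2"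
    by (auto simp: image_iff) 
  have adj: "b = a + 1" if "a < b" "{a, b} = {p, q}" for a b
  proof (rule ccontr)
    assume "b \<noteq> a + 1"
    then have ab: "a < a + 1" "a + 1 < b" using that by auto
    have r: "l + 1 \<le> a" "b \<le> n" using that pq by (auto simp: doubleton_eq_iff)
    have "w a < w (a + 1)" "w (a + 1) < w b" using w_mono r ab by auto
    moreover have "\<bar>w a\<bar> \<le> 2" "\<bar>w b\<bar> \<le> 2" using that pq by (auto simp: doubleton_eq_iff)
    moreover have "w (a + 1) \<noteq> 0" using w_range[of "a + 1"] r ab l2 by auto
    ultimately have "\<bar>w (a + 1)\<bar> = \<bar>w p\<bar> \<or> \<bar>w (a + 1)\<bar> = \<bar>w q\<bar>" using pq by auto
    then have "a + 1 = p \<or> a + 1 = q" using w_abs_inj[of "a + 1"] r pq l2 by auto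
    then show False using ab that by (auto simp: doubleton_eq_iff)
  qed
  have "p \<noteq> q" using pq by auto
  then consider "q = p + 1" | "p = q + 1" using adj[of p q] adj[of q p] by (metis insert_commute linorder_neqE)
  then show "\<exists>m. bad m"
  proof cases
    case 1
    then have "bad (p - 1)" using w_step[of p] pq by (auto simp: bad_def abs_if add.commute split: if_splits)
    then show ?thesis ..
  next
    case 2
    then have "bad (q - 1)" using w_step[of q] pq by (auto simp: bad_def abs_if add.commute split: if_splits)
    then show ?thesis ..
  qed
qed

text \<open>The places of the absolute values 1 and 2 are determined by \<open>w\<close>, and their
  sum \<open>2 * m + 3\<close> determines \<open>m\<close>, whichever comes first.\<close>

lemma bad_unique:
  assumes "bad m" "bad m'"
  shows "m = m'"
proof -
  have m: "l \<le> m" "l \<le> m'" using assms by (simp_all add: bad_def)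
  have *: "\<exists>p q. m + 1 \<le> p \<and> m + 1 \<le> q \<and> p + q = 2 * m + 3 \<and> \<bar>w p\<bar> = 1 \<and> \<bar>w q\<bar> = 2" if "bad m" for m
  proof -
    have "\<bar>w (m + 1)\<bar> = 1 \<and> \<bar>w (m + 2)\<bar> = 2 \<or> \<bar>w (m + 2)\<bar> = 1 \<and> \<bar>w (m + 1)\<bar> = 2"
      using that unfolding bad_def by fastforce
    then show ?thesis
    proof
      assume "\<bar>w (m + 1)\<bar> = 1 \<and> \<bar>w (m + 2)\<bar> = 2"
      then show ?thesis by (intro exI[of _ "m + 1"] exI[of _ "m + 2"]) simp
    next
      assume "\<bar>w (m + 2)\<bar> = 1 \<and> \<bar>w (m + 1)\<bar> = 2"
      then show ?thesis by (intro exI[of _ "m + 2"] exI[of _ "m + 1"]) simp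
    qed
  qed
  obtain p q where p: "m + 1 \<le> p" "m + 1 \<le> q" "p + q = 2 * m + 3" "\<bar>w p\<bar> = 1" "\<bar>w q\<bar> = 2"
    using *[OF assms(1)] by blast
  obtain p' q' where p': "m' + 1 \<le> p'" "m' + 1 \<le> q'" "p' + q' = 2 * m' + 3" "\<bar>w p'\<bar> = 1" "\<bar>w q'\<bar> = 2"
    using *[OF assms(2)] by blast
  have "p = p'" by (rule w_abs_inj) (use p p' m l2 in simp_all)
  moreover have "q = q'" by (rule w_abs_inj) (use p p' m l2 in simp_all)
  ultimately show ?thesis using p(3) p'(3) by simp
qed

lemma predecessor_closed_if: "(\<And>m. \<not> bad m) \<Longrightarrow> predecessor_closed n l S"
  unfolding predecessor_closed_def
proof (intro conjI subarray_subset ballI impI)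
  fix e e' assume nb: "\<And>m. \<not> bad m" and e: "e \<in> array n l" "e' \<in> S" "h_arrow e e' \<or> v_arrow e e'"
  obtain m v m' v' where "e = (m, v)" "e' = (m', v')" by fastforce
  then show "e \<in> S" using e h_closed v_closed_or_bad(1) nb by blast
qed

text \<open>Violations occur only at bad pairs of rows, and every bad pair does contain an offending
  arrow, exhibited below for each of the four cases.\<close>

lemma scalar_closed_iff:
  fixes \<alpha> \<beta> :: "'k::field"
  shows "scalar_predecessor_closed n l \<alpha> \<beta> S \<longleftrightarrow> (\<forall>m. bad m \<longrightarrow> (if alpha_type m then \<alpha> else \<beta>) = 0)"
proof
  assume R: "\<forall>m. bad m \<longrightarrow> (if alpha_type m then \<alpha> else \<beta>) = 0"
  have closed: "(m, v) \<in> S" if "(m, v) \<in> array n l" "(m', v') \<in> S" "h_arrow (m, v) (m', v') \<or> v_arrow (m, v) (m', v')"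
    "scalar l \<alpha> \<beta> (m, v) (m', v') \<noteq> 0" for m v m' v'
  proof (rule ccontr)
    assume o: "(m, v) \<notin> S"
    then have va: "v_arrow (m, v) (m', v')" using that h_closed by blast
    show False
      using v_closed_or_bad(1)[OF that(1,2) va o] v_closed_or_bad(2)[OF that(1,2) va o, where \<alpha> = \<alpha> and \<beta> = \<beta>] R that(4)
      by blast
  qed
  then show "scalar_predecessor_closed n l \<alpha> \<beta> S"
    unfolding scalar_predecessor_closed_def
  proof (intro conjI subarray_subset ballI impI)
    fix e e' assume e: "e \<in> array n l" "e' \<in> S" "(h_arrow e e' \<or> v_arrow e e') \<and> scalar l \<alpha> \<beta> e e' \<noteq> 0"
    obtain m v m' v' where "e = (m, v)" "e' = (m', v')" by fastforce
    then show "e \<in> S" using closed e by blast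
  qed
next
  assume L: "scalar_predecessor_closed n l \<alpha> \<beta> S"
  show "\<forall>m. bad m \<longrightarrow> (if alpha_type m then \<alpha> else \<beta>) = 0"
  proof (intro allI impI)
    fix m assume b: "bad m"
    then have m: "l \<le> m" "m + 1 \<le> n - 1" by (auto simp: bad_def)
    have m2: "m + 1 + 1 = m + 2" by simp
    have "\<exists>v v'. (m, v) \<in> array n l \<and> (m, v) \<notin> S \<and> (m + 1, v') \<in> S \<and> v_arrow (m, v) (m + 1, v')"
    proof -
      have "(w (m + 1), w (m + 2)) \<in> {(1, 2), (-1, 2), (-2, 1), (-2, -1)}" using b by (simp add: bad_def)
      then consider "w (m + 1) = 1" "w (m + 2) = 2" | "w (m + 1) = -1" "w (m + 2) = 2"
        | "w (m + 1) = -2" "w (m + 2) = 1" | "w (m + 1) = -2" "w (m + 2) = -1" by auto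
      then show ?thesis
      proof cases
        case 1 show ?thesis
          by (rule exI[of _ "-1"], rule exI[of _ 2]) (use 1 m l2 n4 in \<open>auto simp: array_iff' subarray_iff v_arrow_def m2\<close>)
      next
        case 2 show ?thesis
          by (rule exI[of _ 1], rule exI[of _ 2]) (use 2 m l2 n4 in \<open>auto simp: array_iff' subarray_iff v_arrow_def m2\<close>)
      next
        case 3 show ?thesis
          by (rule exI[of _ "-2"], rule exI[of _ 1]) (use 3 m l2 n4 in \<open>auto simp: array_iff' subarray_iff v_arrow_def m2\<close>)
      next
        case 4 show ?thesis
          by (rule exI[of _ "-2"], rule exI[of _ "-1"]) (use 4 m l2 n4 in \<open>auto simp: array_iff' subarray_iff v_arrow_def m2\<close>)
      qed
    qed
    then obtain v v' where v: "(m, v) \<in> array n l" "(m, v) \<notin> S" "(m + 1, v') \<in> S" "v_arrow (m, v) (m + 1, v')" by blast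
    then have "scalar l \<alpha> \<beta> (m, v) (m + 1, v') = 0" using L unfolding scalar_predecessor_closed_def by blast
    then show "(if alpha_type m then \<alpha> else \<beta>) = 0"
      using v_closed_or_bad(2)[OF v(1,3,4,2), where \<alpha> = \<alpha> and \<beta> = \<beta>] by blast
  qed
qed

text \<open>At most one pair of rows is bad, so at most one of the two scalars has to
  vanish.\<close>

lemma scalar_closed_choice:
  obtains "scalar_predecessor_closed n l (1 :: 'k::field) 0 S" | "scalar_predecessor_closed n l (0 :: 'k) 1 S"
  using bad_unique by (fastforce simp: scalar_closed_iff split: if_splits)

text \<open>Otherwise \<open>w (m + 1), \<dots>, w (m + k)\<close> would have the absolute values \<open>1, \<dots>, k\<close>, and the two of
  absolute value \<open>1\<close> and \<open>2\<close> would be adjacent.\<close>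

lemma antidiagonal:
  assumes nb: "\<And>m. \<not> bad m" and m: "l \<le> m" and k: "2 \<le> k" and o: "(m, - k) \<notin> S" and i: "(m + k - 1, k) \<in> S"
  shows False
proof -
  have b: "m + k \<le> n" using i by (auto simp: subarray_iff)
  have lo: "- k \<le> w (m + 1)" using o m k b l2 by (auto simp: subarray_iff)
  have hi: "w (m + k) \<le> k" using i by (auto simp: subarray_iff)
  have "\<bar>w p\<bar> \<in> {1..k}" if p: "p \<in> {m+1..m+k}" for p
  proof -
    have "w (m + 1) \<le> w p" using w_mono[of "m + 1" p] p m b by (cases "p = m + 1") auto
    moreover have "w p \<le> w (m + k)" using w_mono[of p "m + k"] p m b by (cases "p = m + k") auto
    moreover have "w p \<noteq> 0" using w_range[of p] p m b l2 by auto
    ultimately show ?thesis using lo hi by auto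
  qed
  then have sub: "(\<lambda>p. \<bar>w p\<bar>) ` {m+1..m+k} \<subseteq> {1..k}" by blast
  have "inj_on (\<lambda>p. \<bar>w p\<bar>) {m+1..m+k}"
    by (rule inj_onI) (rule w_abs_inj, use m l2 in auto)
  then have "card ((\<lambda>p. \<bar>w p\<bar>) ` {m+1..m+k}) = card {1..k}" by (simp add: card_image)
  then have "(\<lambda>p. \<bar>w p\<bar>) ` {m+1..m+k} = {1..k}" using sub by (intro card_subset_eq) auto
  then have "{1, 2} \<subseteq> (\<lambda>p. \<bar>w p\<bar>) ` {m+1..m+k}" using k by auto
  also have "\<dots> \<subseteq> (\<lambda>p. \<bar>w p\<bar>) ` {l+1..n}" using m b by (intro image_mono) auto
  finally show False using bad_iff nb by blast
qed

lemma inv_w: "w (inv_into UNIV w a) = a" "inv_into UNIV w (w a) = a" "inv_into UNIV w (- a) = - inv_into UNIV w a"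
proof -
  have bij: "bij w" using weyl_permutes[OF weyl] permutes_bij by blast
  show 1: "w (inv_into UNIV w a) = a" for a using bij by (simp add: bij_is_surj surj_f_inv_f)
  show 2: "inv_into UNIV w (w a) = a" for a using bij by (simp add: bij_is_inj)
  have "w (- inv_into UNIV w a) = - a" using weyl_minus[OF weyl] 1 by simp
  then show "inv_into UNIV w (- a) = - inv_into UNIV w a" using 2 by metis
qed

lemma after_in_block:
  assumes "l \<le> m" "m \<le> n - 1" "a \<in> signed_range n" "m + 1 < inv_into UNIV w a"
  shows "w (m + 1) < a"
proof -
  have "inv_into UNIV w a \<in> signed_range n" using weyl_signed_range[OF weyl, of "inv_into UNIV w a"] assms(3) inv_w(1) by simp
  then have "w (m + 1) < w (inv_into UNIV w a)" using assms by (intro w_mono) (auto simp: signed_range_def)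
  then show ?thesis by (simp add: inv_w)
qed

text \<open>\<open>j + 1\<close> comes before \<open>j\<close> in \<open>w\<close>, and
  \<open>- j\<close> before \<open>- j - 1\<close>; for \<open>j = -1\<close>, \<open>2\<close>
  comes before \<open>-1\<close> and \<open>1\<close> before \<open>-2\<close>. The increasing tail
  contradicts each of these orders.\<close>

lemma left_descent_values:
  assumes j: "j \<in> vertices n" and d: "\<not> ascent (inv_into UNIV w) j" and m: "l \<le> m" "m \<le> n - 1"
  shows "1 \<le> j \<Longrightarrow> w (m + 1) \<noteq> j + 1 \<and> w (m + 1) \<noteq> - j" and "j = -1 \<Longrightarrow> w (m + 1) \<noteq> 1 \<and> w (m + 1) \<noteq> 2"
proof -
  let ?i = "inv_into UNIV w"
  have inj: "?i a = ?i b \<longleftrightarrow> a = b" for a b by (metis inv_w(1))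
  have sr: "a \<in> signed_range n" if "a \<noteq> 0" "- n \<le> a" "a \<le> n" for a using that by (simp add: signed_range_def)
  have pos: "?i (w (m + 1)) = m + 1" by (rule inv_w(2))
  note after = after_in_block[OF m sr]
  show "1 \<le> j \<Longrightarrow> w (m + 1) \<noteq> j + 1 \<and> w (m + 1) \<noteq> - j"
  proof (intro conjI notI)
    assume j1: "1 \<le> j"
    then have jn: "j \<le> n - 1" using j by (auto simp: vertices_def)
    have lt: "?i (j + 1) < ?i j" using d j1 inj[of j "j + 1"] by (auto simp: ascent_def)
    { assume e: "w (m + 1) = j + 1"
      then show False using after[of j] lt pos j1 jn by simp }
    { assume e: "w (m + 1) = - j"
      then have "?i (- (j + 1)) > m + 1" using lt pos inv_w(3)[of j] inv_w(3)[of "j + 1"] by simp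
      then show False using after[of "- (j + 1)"] e j1 jn by simp }
  qed
  show "j = -1 \<Longrightarrow> w (m + 1) \<noteq> 1 \<and> w (m + 1) \<noteq> 2"
  proof (intro conjI notI)
    assume j1: "j = -1"
    have lt: "?i 2 < ?i (-1)" using d j1 inj[of 2 "-1"] inv_w(3)[of 1] by (auto simp: ascent_def)
    { assume e: "w (m + 1) = 2"
      then show False using after[of "-1"] lt pos n4 by simp }
    { assume e: "w (m + 1) = 1"
      then have "?i (-2) > m + 1" using lt pos inv_w(3)[of 1] inv_w(3)[of 2] by simp
      then show False using after[of "-2"] e n4 by simp }
  qed
qed

text \<open>If all predecessors of a missing entry on \<open>j\<close> were present,
  \<open>w (m + 1)\<close> would be a value excluded by \<open>left_descent_values\<close>. An entry
  at the very beginning of its row is handled by \<open>w_le\<close>.\<close>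

lemma missing_predecessor:
  assumes j: "j \<in> vertices n" and d: "\<not> ascent (inv_into UNIV w) j"
    and e: "(m, v) \<in> array n l" "(m, v) \<notin> S" "entry_vertex (m, v) = j"
  shows "\<exists>v'. (m, v') \<in> array n l \<and> (m, v') \<notin> S \<and> h_arrow (m, v') (m, v) \<and> entry_vertex (m, v') \<noteq> j"
proof -
  have b: "l \<le> m" "m \<le> n - 1" "m - l + 1 - n \<le> v" "v \<le> m" "v \<noteq> 0" using e by (auto simp: array_iff')
  note dv = left_descent_values[OF j d b(1,2)]
  have nz: "w (m + 1) \<noteq> 0" using w_range[of "m + 1"] b l2 by simp
  have le: "w (m + 1) \<le> m + 1" by (rule w_le[OF b(1,2)])
  have out: "\<not> (1 \<le> w (m + 1) \<and> w (m + 1) \<le> v \<or> w (m + 1) = -1 \<and> (2 \<le> v \<or> v = -1) \<or> w (m + 1) \<le> -2 \<and> w (m + 1) + 1 \<le> v)"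
    using e(2) b by (simp add: subarray_iff)
  consider "2 \<le> v" | "v = 1" | "v = -1" | "v = -2" | "v \<le> -3" using b(5) by linarith
  then show ?thesis
  proof cases
    case 1
    then have "j = v" using e(3) by simp
    then show ?thesis
      using 1 dv(1) out nz le b by (intro exI[of _ "v + 1"]) (auto simp: array_iff' subarray_iff h_arrow_def)
  next
    case 2
    then have "j = 1" using e(3) by simp
    then show ?thesis
      using 2 dv(1) out nz le b l2 by (intro exI[of _ 2]) (auto simp: array_iff' subarray_iff h_arrow_def)
  next
    case 3
    then have "j = -1" using e(3) by simp
    then show ?thesis
      using 3 dv(2) out nz le b l2 by (intro exI[of _ 2]) (auto simp: array_iff' subarray_iff h_arrow_def)
  next
    \<comment> \<open>The entry \<open>-2\<close> has two predecessors; if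
      \<open>w (m + 1) = 1\<close>, the row contains 1 but not -1, and otherwise 1 is
      missing.\<close>
    case 4
    then have "j = 2" using e(3) by simp
    then show ?thesis
      using 4 dv(1) out nz le b l2 n4
      by (intro exI[of _ "if w (m + 1) = 1 then -1 else 1"]) (auto simp: array_iff' subarray_iff h_arrow_def)
  next
    case 5
    then have "j = - v" using e(3) by simp
    then show ?thesis
      using 5 dv(1) out nz le b l2 by (intro exI[of _ "v + 1"]) (auto simp: array_iff' subarray_iff h_arrow_def)
  qed
qed

end

section \<open>Dependence on the scalars\<close>

text \<open>The array bases for \<open>(\<alpha>, \<beta>)\<close> and \<open>(\<alpha>', \<beta>')\<close> of the same module differ by the multiples
  \<open>\<alpha>' - \<alpha>\<close> of the entries \<open>k\<close> in row \<open>m + k - 1\<close>, added to the entries \<open>-k\<close> in row \<open>m\<close>.\<close>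

definition rescale :: "int \<Rightarrow> int \<Rightarrow> 'k::field \<Rightarrow> (entry \<Rightarrow> 'k) \<Rightarrow> entry \<Rightarrow> 'k" where
  "rescale n l d f = (\<lambda>(m, v). if (m, v) \<in> array n l
    then f (m, v) + (if 2 \<le> v then d * f (m - v + 1, - v) else 0) else 0)"

lemma rescale_apply: "rescale n l d f (m, v) = (if (m, v) \<in> array n l
    then f (m, v) + (if 2 \<le> v then d * f (m - v + 1, - v) else 0) else 0)"
  by (simp add: rescale_def)

lemma linear_map_rescale: "linear_map (rescale n l d)"
  by (auto simp: linear_map_def rescale_def fun_eq_iff algebra_simps)

lemma rescale_vectors: "rescale n l d f \<in> array_vectors n l"
  by (auto simp: rescale_def array_vectors_def)

text \<open>Once \<open>\<beta>\<close> and \<open>\<beta>'\<close> are eliminated by the two sum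
  conditions, both sides agree coordinate by coordinate.\<close>

lemma rescale_arrow_act:
  fixes \<alpha> \<beta> \<alpha>' \<beta>' :: "'k::field"
  assumes rep: "array_rep n l \<alpha> \<beta>" and rep': "array_rep n l \<alpha>' \<beta>'"
    and f: "f \<in> array_vectors n l" and a: "a \<in> arrows n"
  shows "rescale n l (\<alpha>' - \<alpha>) (arrow_act n l \<alpha> \<beta> a f) = arrow_act n l \<alpha>' \<beta>' a (rescale n l (\<alpha>' - \<alpha>) f)"
proof -
  interpret L: array_rep n l \<alpha> \<beta> by (rule rep)
  interpret L': array_rep n l \<alpha>' \<beta>' by (rule rep')
  let ?d = "\<alpha>' - \<alpha>"
  have \<beta>: "\<beta> = 1 - \<alpha>" "\<beta>' = 1 - \<alpha>'" using L.sum1 L'.sum1 by (simp_all add: algebra_simps)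
  have out: "f (m, v) = 0" if "\<not> (l \<le> m \<and> m \<le> n - 1 \<and> m - l + 1 - n \<le> v \<and> v \<le> m \<and> v \<noteq> 0)" for m v
    using L.V_zero[OF f, of "(m, v)"] that by (simp add: L.array_iff)
  note formula = L.arrow_act_formula[OF f a] L'.arrow_act_formula[OF rescale_vectors a]
  have "rescale n l ?d (arrow_act n l \<alpha> \<beta> a f) (m, v) = arrow_act n l \<alpha>' \<beta>' a (rescale n l ?d f) (m, v)" for m v
  proof (cases "(m, v) \<in> array n l")
    case False
    then show ?thesis unfolding formula by (simp add: rescale_apply)
  next
    case True
    then have b: "l \<le> m" "m \<le> n - 1" "m - l + 1 - n \<le> v" "v \<le> m" "v \<noteq> 0" by (auto simp: L.array_iff)
    show ?thesis
    proof (cases a)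
      case (X i)
      then have "1 \<le> i" "i \<le> n - 2" using a by (auto simp: arrows_def)
      then show ?thesis
        using b L.l2 L.ln L.upper_cases[of m] unfolding rescale_apply formula unfolding X L.arrow_formula.simps L'.arrow_formula.simps rescale_apply
        by (cases "i = 1") (auto simp: rescale_apply L.array_iff out L.upper_pred \<beta> algebra_simps)
    next
      case X1'
      then show ?thesis
        using b L.l2 L.ln L.upper_cases[of m] unfolding rescale_apply formula unfolding X1' L.arrow_formula.simps L'.arrow_formula.simps rescale_apply
        by (auto simp: rescale_apply L.array_iff out L.upper_pred \<beta> algebra_simps)
    next
      case (Y i)
      then have "2 \<le> i" "i \<le> n - 1" using a by (auto simp: arrows_def)
      then show ?thesis
        using b L.l2 L.ln L.upper_cases[of m] unfolding rescale_apply formula unfolding Y L.arrow_formula.simps L'.arrow_formula.simps rescale_apply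
        by (cases "i = 2") (auto simp: rescale_apply L.array_iff out L.upper_pred \<beta> algebra_simps)
    next
      case Y2'
      then show ?thesis
        using b L.l2 L.ln L.upper_cases[of m] unfolding rescale_apply formula unfolding Y2' L.arrow_formula.simps L'.arrow_formula.simps rescale_apply
        by (auto simp: rescale_apply L.array_iff out L.upper_pred \<beta> algebra_simps)
    qed
  qed
  then show ?thesis by (auto simp: fun_eq_iff)
qed

lemma rescale_path_act:
  fixes \<alpha> \<beta> \<alpha>' \<beta>' :: "'k::field"
  assumes rep: "array_rep n l \<alpha> \<beta>" and rep': "array_rep n l \<alpha>' \<beta>'"
    and f: "f \<in> array_vectors n l" and p: "is_path n p"
  shows "rescale n l (\<alpha>' - \<alpha>) (path_act n l \<alpha> \<beta> p f) = path_act n l \<alpha>' \<beta>' p (rescale n l (\<alpha>' - \<alpha>) f)"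
proof -
  let ?r = "rescale n l (\<alpha>' - \<alpha>)"
  have fold: "?r (fold (arrow_act n l \<alpha> \<beta>) as g) = fold (arrow_act n l \<alpha>' \<beta>') as (?r g)"
    if "is_path n (i, as)" "g \<in> array_vectors n l" for as g i
    using that
  proof (induction as arbitrary: g i)
    case (Cons a as)
    then have "is_path n (tgt a, as)" "a \<in> arrows n" by auto
    then show ?case using Cons.IH[of "tgt a" "arrow_act n l \<alpha> \<beta> a g"] Cons.prems(2)
      by (simp add: arrow_act_vectors rescale_arrow_act[OF rep rep'])
  qed simp
  obtain i as where ias: "p = (i, as)" by force
  have proj: "(\<lambda>e. if entry_vertex e = i then f e else 0) \<in> array_vectors n l"
    using f by (auto simp: array_vectors_def)
  have "?r (\<lambda>e. if entry_vertex e = i then f e else 0) = (\<lambda>e. if entry_vertex e = i then ?r f e else 0)"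
    by (auto simp: rescale_def fun_eq_iff)
  then show ?thesis using fold[of i as, OF _ proj] p by (simp add: path_act_def ias)
qed

lemma rescale_act:
  fixes \<alpha> \<beta> \<alpha>' \<beta>' :: "'k::field"
  assumes rep: "array_rep n l \<alpha> \<beta>" and rep': "array_rep n l \<alpha>' \<beta>'"
    and f: "f \<in> array_vectors n l" and c: "c \<in> carrier (path_algebra n)"
  shows "rescale n l (\<alpha>' - \<alpha>) (path_algebra_act n l \<alpha> \<beta> c f) =
    path_algebra_act n l \<alpha>' \<beta>' c (rescale n l (\<alpha>' - \<alpha>) f)"
proof -
  have fin: "finite (supp c)" using c by (simp add: path_algebra_carrier)
  have "is_path n p" if "p \<in> supp c" for p using path_algebra_is_path[OF c] that by (simp add: supp_def)
  then show ?thesis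
    unfolding path_algebra_act_eq linear_map_sum[OF linear_map_rescale fin]
    using rescale_path_act[OF rep rep' f] by (auto intro!: ext sum.cong)
qed

text \<open>The base change fixes the generator, and by \<open>diag\<close> it never adds the
  coefficient of an entry outside \<open>S\<close> to that of an entry in \<open>S\<close>.\<close>

lemma complement_span_independent:
  fixes \<alpha> \<beta> \<alpha>' \<beta>' :: "'k::field"
  assumes rep: "array_rep n l \<alpha> \<beta>" and rep': "array_rep n l \<alpha>' \<beta>'"
    and diag: "\<And>m k. \<lbrakk>l \<le> m; 2 \<le> k; (m, - k) \<notin> S; (m + k - 1, k) \<in> S\<rbrakk> \<Longrightarrow> False"
    and x: "x \<in> carrier (preproj n)"
    and a: "x \<odot>\<^bsub>array_module n l \<alpha> \<beta>\<^esub> array_rep.gen_vec l \<in> complement_span n l S"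
  shows "x \<odot>\<^bsub>array_module n l \<alpha>' \<beta>'\<^esub> array_rep.gen_vec l \<in> complement_span n l S"
proof -
  interpret L: array_rep n l \<alpha> \<beta> by (rule rep)
  interpret L': array_rep n l \<alpha>' \<beta>' by (rule rep')
  let ?r = "rescale n l (\<alpha>' - \<alpha>)"
  obtain c where c: "c \<in> carrier (path_algebra n)" "x = L.cls c" using L.PP_rep[OF x] by blast
  have g: "?r L.gen_vec = L.gen_vec"
    using L.l2 L.ln by (auto simp: rescale_def L.gen_vec_def L.unit_vec_def fun_eq_iff array_def)
  have "x \<odot>\<^bsub>array_module n l \<alpha>' \<beta>'\<^esub> L.gen_vec = ?r (x \<odot>\<^bsub>array_module n l \<alpha> \<beta>\<^esub> L.gen_vec)"
    using rescale_act[OF rep rep' L.gen_vec_V c(1)] g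
    by (simp add: c(2) L.smult_cls[OF c(1) L.gen_vec_V] L'.smult_cls[OF c(1) L.gen_vec_V])
  moreover have "?r f \<in> complement_span n l S" if f: "f \<in> complement_span n l S" for f :: "entry \<Rightarrow> 'k"
    unfolding complement_span_def
  proof (intro CollectI allI impI)
    fix e assume e: "e \<notin> array n l - S"
    obtain m v where mv: "e = (m, v)" by force
    have z: "f e' = 0" if "e' \<notin> array n l - S" for e' using f that unfolding complement_span_def by blast
    have "f (m - v + 1, - v) = 0" if "2 \<le> v" "(m, v) \<in> array n l"
    proof (rule z, rule notI)
      assume n: "(m - v + 1, - v) \<in> array n l - S"
      have "(m, v) \<in> S" using e that mv by blast
      then show False using diag[of "m - v + 1" v] n that by (simp add: array_def)
    qed
    then show "?r f e = 0" using z[OF e] by (simp add: rescale_def mv)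
  qed
  ultimately show ?thesis using a by simp
qed

section \<open>Left multiplication by a simple reflection\<close>

text \<open>A row is cut off by a value of \<open>w\<close>; exchanging that value under
  \<open>simple_refl j\<close> moves the cut across entries on \<open>j\<close> only.\<close>

lemma row_condition_change:
  fixes x v :: int
  assumes j: "j = -1 \<or> 1 \<le> j" and xv: "x \<noteq> 0" "v \<noteq> 0" and y: "y = simple_refl j x"
    and ne: "(1 \<le> x \<and> x \<le> v \<or> x = -1 \<and> (2 \<le> v \<or> v = -1) \<or> x \<le> -2 \<and> x + 1 \<le> v) \<noteq>
      (1 \<le> y \<and> y \<le> v \<or> y = -1 \<and> (2 \<le> v \<or> v = -1) \<or> y \<le> -2 \<and> y + 1 \<le> v)"
  shows "(if -1 \<le> v then v else - v) = j"
  using j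
proof
  assume j: "j = -1"
  have "x = 1 \<and> y = -2 \<or> x = -2 \<and> y = 1 \<or> x = 2 \<and> y = -1 \<or> x = -1 \<and> y = 2 \<or> y = x"
    using y unfolding j simple_refl_minus_one by (simp split: if_splits)
  then consider "x = 1" "y = -2" | "x = -2" "y = 1" | "x = 2" "y = -1" | "x = -1" "y = 2" | "y = x" by blast
  then show ?thesis by cases (use ne xv j in \<open>auto split: if_splits\<close>)
next
  assume j: "1 \<le> j"
  have "x = j \<and> y = j + 1 \<or> x = j + 1 \<and> y = j \<or> x = - j \<and> y = - j - 1 \<or> x = - j - 1 \<and> y = - j \<or> y = x"
    using y unfolding simple_refl_pos[OF j] by (simp split: if_splits)
  then consider "x = j" "y = j + 1" | "x = j + 1" "y = j" | "x = - j" "y = - j - 1" | "x = - j - 1" "y = - j" | "y = x"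
    by blast
  then show ?thesis by cases (use ne xv j in \<open>auto split: if_splits\<close>)
qed

lemma subarray_change:
  assumes w: "grassmannian_elt n l w" and w': "grassmannian_elt n l w'" and j: "j \<in> vertices n"
    and s: "w = simple_refl j \<circ> w'" and e: "(e \<in> subarray n l w) \<noteq> (e \<in> subarray n l w')"
  shows "entry_vertex e = j"
proof -
  interpret W: grassmannian_elt n l w by (rule w)
  interpret W': grassmannian_elt n l w' by (rule w')
  obtain m v where mv: "e = (m, v)" by force
  have b: "l \<le> m" "m \<le> n - 1" "v \<noteq> 0" using e unfolding mv W.subarray_iff W'.subarray_iff by blast+
  have "w' (m + 1) \<noteq> 0" using W'.w_range[of "m + 1"] b W.l2 by simp
  moreover have "w (m + 1) = simple_refl j (w' (m + 1))" using s by simp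
  ultimately have "(if -1 \<le> v then v else - v) = j"
  proof (rule row_condition_change[OF vertices_cases[OF j] _ b(3)])
    let ?P = "\<lambda>x. 1 \<le> x \<and> x \<le> v \<or> x = -1 \<and> (2 \<le> v \<or> v = -1) \<or> x \<le> -2 \<and> x + 1 \<le> v"
    show "?P (w' (m + 1)) \<noteq> ?P (w (m + 1))"
      using e unfolding mv W.subarray_iff W'.subarray_iff by blast
  qed
  then show ?thesis by (simp add: mv)
qed

text \<open>For \<open>j = 1\<close> and \<open>j = -1\<close> the two values change in place and
  the sign of their product is kept. For \<open>j = 2\<close> the bad place moves by one row: one
  neighbour of the value of absolute value 1 leaves, the other enters with opposite sign, and
  \<open>upper\<close> changes sign too. For \<open>j \<ge> 3\<close> both values are
  untouched.\<close>

lemma alpha_type_change: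
  assumes w: "grassmannian_elt n l w" and w': "grassmannian_elt n l w'" and j: "j \<in> vertices n"
    and s: "w = simple_refl j \<circ> w'"
    and bad: "grassmannian_elt.bad n l w m" and bad': "grassmannian_elt.bad n l w' m'"
  shows "grassmannian_elt.alpha_type l w m = grassmannian_elt.alpha_type l w' m'"
proof -
  interpret W: grassmannian_elt n l w by (rule w)
  interpret W': grassmannian_elt n l w' by (rule w')
  have b: "l \<le> m" "m \<le> n - 2" "(w (m + 1), w (m + 2)) \<in> {(1, 2), (-1, 2), (-2, 1), (-2, -1)}"
    using bad by (simp_all add: W.bad_def)
  have b': "l \<le> m'" "m' \<le> n - 2" "(w' (m' + 1), w' (m' + 2)) \<in> {(1, 2), (-1, 2), (-2, 1), (-2, -1)}"
    using bad' by (simp_all add: W'.bad_def)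
  have at: "w i = simple_refl j (w' i)" for i using s by simp
  \<comment> \<open>Monotonicity of \<open>w\<close> excludes two of the four pairs when
    \<open>j\<close> is 1 or -1.\<close>
  have step: "w (m' + 1) < w (m' + 2)" using W.w_step[of "m' + 1"] b' by (simp add: add.commute)
  have up: "upper l (i + 1) = - upper l i" "upper l i = 1 \<or> upper l i = -1" for i by (auto simp: upper_def)
  consider "j = -1" | "j = 1" | "j = 2" | "3 \<le> j" using vertices_cases[OF j] by linarith
  then show ?thesis
  proof cases
    case 3
    have inj: "\<bar>w p\<bar> = \<bar>w q\<bar> \<Longrightarrow> 1 \<le> p \<Longrightarrow> 1 \<le> q \<Longrightarrow> p = q" for p q using W.w_abs_inj by blast
    have at2: "simple_refl 2 1 = 1" "simple_refl 2 (-1) = -1" "simple_refl 2 2 = 3" "simple_refl 2 (-2) = -3"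
      by (simp_all add: simple_refl_pos)
    have pos: "1 \<le> m" "1 \<le> m'" using b b' W.l2 by auto
    consider (a) "\<bar>w' (m' + 1)\<bar> = 1" "w' (m' + 2) = 2" | (b) "w' (m' + 1) = -2" "\<bar>w' (m' + 2)\<bar> = 1"
      using b'(3) by fastforce
    then show ?thesis
    proof cases
      case a
      then have w1: "w (m' + 1) = w' (m' + 1)" and w2: "w (m' + 2) = 3"
        using at[of "m' + 1"] at[of "m' + 2"] 3 at2 by (auto simp: abs_if split: if_splits)
      have "\<not> \<bar>w (m + 1)\<bar> = 1"
      proof
        assume 1: "\<bar>w (m + 1)\<bar> = 1"
        then have "m = m'" using inj[of "m + 1" "m' + 1"] a w1 pos by simp
        then show False using w2 b(3) 1 by auto
      qed
      then have m1: "w (m + 1) = -2" "\<bar>w (m + 2)\<bar> = 1" using b(3) by auto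
      then have m': "m' = m + 1" using inj[of "m + 2" "m' + 1"] a w1 pos by simp
      have e: "w' (m' + 1) = w (m + 2)" using w1 m' by (simp add: add.commute)
      show ?thesis
        unfolding W.alpha_type_def W'.alpha_type_def e a(2) m1(1) unfolding m' up(1) using m1(2) up(2)[of m]
        by (auto simp: abs_if split: if_splits)
    next
      case b
      then have w1: "w (m' + 2) = w' (m' + 2)" and w2: "w (m' + 1) = -3"
        using at[of "m' + 1"] at[of "m' + 2"] 3 at2 by (auto simp: abs_if split: if_splits)
      have "\<not> \<bar>w (m + 2)\<bar> = 1"
      proof
        assume 1: "\<bar>w (m + 2)\<bar> = 1"
        then have "m = m'" using inj[of "m + 2" "m' + 2"] b w1 pos by simp
        then show False using w2 \<open>(w (m + 1), w (m + 2)) \<in> _\<close> 1 by auto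
      qed
      then have m1: "w (m + 2) = 2" "\<bar>w (m + 1)\<bar> = 1" using \<open>(w (m + 1), w (m + 2)) \<in> _\<close> by auto
      then have m: "m = m' + 1" using inj[of "m + 1" "m' + 2"] b w1 pos by simp
      have e: "w' (m' + 2) = w (m + 1)" using w1 m by (simp add: add.commute)
      show ?thesis
        unfolding W.alpha_type_def W'.alpha_type_def e b(1) m1(1) unfolding m up(1) using m1(2) up(2)[of m'] m
        by (auto simp: abs_if split: if_splits)
    qed
  next
    case 4
    then have "simple_refl j 1 = 1" "simple_refl j (-1) = -1" "simple_refl j 2 = 2" "simple_refl j (-2) = -2"
      by (auto simp: simple_refl_pos)
    then have eq: "w (m' + 1) = w' (m' + 1)" "w (m' + 2) = w' (m' + 2)"
      using b'(3) at[of "m' + 1"] at[of "m' + 2"] by auto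
    then have "W.bad m'" using bad' by (simp add: W.bad_def W'.bad_def)
    then have "m = m'" using W.bad_unique[OF bad] by simp
    then show ?thesis using eq by (simp add: W.alpha_type_def W'.alpha_type_def)
  next
    case 1
    then have "(w' (m' + 1), w' (m' + 2)) = (1, 2) \<and> (w (m' + 1), w (m' + 2)) = (-2, -1) \<or>
      (w' (m' + 1), w' (m' + 2)) = (-2, -1) \<and> (w (m' + 1), w (m' + 2)) = (1, 2)"
      using b'(3) at[of "m' + 1"] at[of "m' + 2"] step by (auto simp: simple_refl_minus_one)
    then have "W.bad m'" "sgn (w (m' + 1) * w (m' + 2)) = sgn (w' (m' + 1) * w' (m' + 2))"
      using b' by (auto simp: W.bad_def)
    then show ?thesis using W.bad_unique[OF bad] by (simp add: W.alpha_type_def W'.alpha_type_def)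
  next
    case 2
    then have "(w' (m' + 1), w' (m' + 2)) = (-1, 2) \<and> (w (m' + 1), w (m' + 2)) = (-2, 1) \<or>
      (w' (m' + 1), w' (m' + 2)) = (-2, 1) \<and> (w (m' + 1), w (m' + 2)) = (-1, 2)"
      using b'(3) at[of "m' + 1"] at[of "m' + 2"] step by (auto simp: simple_refl_pos)
    then have "W.bad m'" "sgn (w (m' + 1) * w (m' + 2)) = sgn (w' (m' + 1) * w' (m' + 2))"
      using b' by (auto simp: W.bad_def)
    then show ?thesis using W.bad_unique[OF bad] by (simp add: W.alpha_type_def W'.alpha_type_def)
  qed
qed

section \<open>The factor modules\<close>

text \<open>\<open>a e + I\<close> goes to \<open>a g + K\<close>, written as a union over
  representatives. The equivalence relating \<open>I\<close> and \<open>K\<close> makes this well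
  defined and injective.\<close>

lemma quotient_iso:
  fixes M :: "('r, 'a) module" and R :: "('r, 'e) ring_scheme" and J :: "('r, 'r set) module"
  assumes M: "left_module R M" and I: "ideal I R" and K: "submodule K R M"
    and g: "g \<in> carrier M" and e: "e \<in> carrier R" "e \<odot>\<^bsub>M\<^esub> g = g"
    and gen: "\<And>x. x \<in> carrier M \<Longrightarrow> \<exists>a\<in>carrier R. a \<odot>\<^bsub>M\<^esub> g = x"
    and IK: "\<And>a. a \<in> carrier R \<Longrightarrow> a \<otimes>\<^bsub>R\<^esub> e \<in> I \<longleftrightarrow> a \<odot>\<^bsub>M\<^esub> g \<in> K"
    and J: "carrier J = {x \<otimes>\<^bsub>R Quot I\<^esub> (I +>\<^bsub>R\<^esub> e) | x. x \<in> carrier (R Quot I)}"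
      "\<And>x y. x \<oplus>\<^bsub>J\<^esub> y = x \<oplus>\<^bsub>R Quot I\<^esub> y" "\<And>a x. a \<odot>\<^bsub>J\<^esub> x = (I +>\<^bsub>R\<^esub> a) \<otimes>\<^bsub>R Quot I\<^esub> x"
  shows "\<exists>f. left_module_iso R J (quot_module M K) f \<and> f (I +>\<^bsub>R\<^esub> e) = K +>\<^bsub>M\<^esub> g"
proof -
  interpret left_module R M by (rule M)
  interpret I: ideal I R by (rule I)
  interpret K: abelian_subgroup K M by (rule submodule_abelian_subgroup[OF K])
  let ?Q = "quot_module M K"
  let ?c = "\<lambda>a. I +>\<^bsub>R\<^esub> (a \<otimes>\<^bsub>R\<^esub> e)"
  define f where "f = (\<lambda>X. \<Union>b\<in>X. K +>\<^bsub>M\<^esub> (b \<odot>\<^bsub>M\<^esub> g))"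
  have cr: "carrier (R Quot I) = (\<lambda>a. I +>\<^bsub>R\<^esub> a) ` carrier R"
    by (auto simp: FactRing_def A_RCOSETS_def')
  have ce: "(I +>\<^bsub>R\<^esub> a) \<otimes>\<^bsub>R Quot I\<^esub> (I +>\<^bsub>R\<^esub> e) = ?c a" if "a \<in> carrier R" for a
    using that e(1) by (simp add: FactRing_def I.rcoset_mult_add)
  have "carrier J = (\<lambda>x. x \<otimes>\<^bsub>R Quot I\<^esub> (I +>\<^bsub>R\<^esub> e)) ` carrier (R Quot I)" unfolding J(1) by blast
  then have car: "carrier J = ?c ` carrier R" unfolding cr image_image using ce by simp
  have fc: "f (?c a) = K +>\<^bsub>M\<^esub> (a \<odot>\<^bsub>M\<^esub> g)" if a: "a \<in> carrier R" for a
  proof -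
    have "K +>\<^bsub>M\<^esub> (b \<odot>\<^bsub>M\<^esub> g) = K +>\<^bsub>M\<^esub> (a \<odot>\<^bsub>M\<^esub> g)" if b: "b \<in> ?c a" for b
    proof -
      obtain h where h: "h \<in> I" "b = h \<oplus>\<^bsub>R\<^esub> a \<otimes>\<^bsub>R\<^esub> e" using b by (auto simp: a_r_coset_def')
      have hc: "h \<in> carrier R" using h by simp
      have "h \<odot>\<^bsub>M\<^esub> g \<in> K" using IK[OF hc] I.I_r_closed[OF h(1) e(1)] by simp
      moreover have "b \<odot>\<^bsub>M\<^esub> g = h \<odot>\<^bsub>M\<^esub> g \<oplus>\<^bsub>M\<^esub> a \<odot>\<^bsub>M\<^esub> g"
        using h(2) hc a e g by (simp add: smult_l_distr smult_assoc1)
      ultimately have "b \<odot>\<^bsub>M\<^esub> g \<in> K +>\<^bsub>M\<^esub> (a \<odot>\<^bsub>M\<^esub> g)" by (auto simp: a_r_coset_def')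
      then show ?thesis by (rule K.a_repr_independence'[OF _ smult_closed[OF a g], symmetric])
    qed
    then have "f (?c a) = (\<Union>b\<in>?c a. K +>\<^bsub>M\<^esub> (a \<odot>\<^bsub>M\<^esub> g))" unfolding f_def by simp
    also have "\<dots> = K +>\<^bsub>M\<^esub> (a \<odot>\<^bsub>M\<^esub> g)" using I.a_rcos_self[of "a \<otimes>\<^bsub>R\<^esub> e"] a e(1) by blast
    finally show ?thesis .
  qed
  have carQ: "carrier ?Q = (\<lambda>a. K +>\<^bsub>M\<^esub> (a \<odot>\<^bsub>M\<^esub> g)) ` carrier R"
  proof -
    have "carrier ?Q = (\<lambda>x. K +>\<^bsub>M\<^esub> x) ` carrier M" by (auto simp: quot_module_def A_RCOSETS_def')
    moreover have "carrier M = (\<lambda>a. a \<odot>\<^bsub>M\<^esub> g) ` carrier R"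
    proof (intro equalityI subsetI)
      fix x assume "x \<in> carrier M"
      then obtain a where "a \<in> carrier R" "a \<odot>\<^bsub>M\<^esub> g = x" using gen by blast
      then show "x \<in> (\<lambda>a. a \<odot>\<^bsub>M\<^esub> g) ` carrier R" by (intro image_eqI[where x = a]) simp_all
    qed (use smult_closed[OF _ g] in blast)
    ultimately show ?thesis by (simp only: image_image)
  qed
  have inj: "?c a = ?c b" if ab: "a \<in> carrier R" "b \<in> carrier R" "K +>\<^bsub>M\<^esub> (a \<odot>\<^bsub>M\<^esub> g) = K +>\<^bsub>M\<^esub> (b \<odot>\<^bsub>M\<^esub> g)" for a b
  proof -
    have "a \<odot>\<^bsub>M\<^esub> g \<in> K +>\<^bsub>M\<^esub> (b \<odot>\<^bsub>M\<^esub> g)" using K.a_rcos_self[OF smult_closed[OF ab(1) g]] ab(3) by simp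
    then have "a \<odot>\<^bsub>M\<^esub> g \<ominus>\<^bsub>M\<^esub> b \<odot>\<^bsub>M\<^esub> g \<in> K"
      using K.a_rcos_module[OF smult_closed[OF ab(2) g] smult_closed[OF ab(1) g]] by (simp add: M.minus_eq)
    then have "(a \<ominus>\<^bsub>R\<^esub> b) \<odot>\<^bsub>M\<^esub> g \<in> K" using ab g by (simp add: smult_l_diff)
    then have "(a \<ominus>\<^bsub>R\<^esub> b) \<otimes>\<^bsub>R\<^esub> e \<in> I" using IK ab by simp
    then have "a \<otimes>\<^bsub>R\<^esub> e \<ominus>\<^bsub>R\<^esub> b \<otimes>\<^bsub>R\<^esub> e \<in> I" using ab e(1) by (simp add: R.minus_eq R.l_distr R.l_minus)
    then show ?thesis using R.quotient_eq_iff_same_a_r_cos[OF I] ab e(1) by simp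
  qed
  have "left_module_iso R J ?Q f"
    unfolding left_module_iso_def
  proof (intro conjI ballI)
    show "bij_betw f (carrier J) (carrier ?Q)"
      unfolding bij_betw_def
    proof
      show "inj_on f (carrier J)" unfolding car 
      proof (rule inj_onI)
        fix x y assume "x \<in> ?c ` carrier R" "y \<in> ?c ` carrier R" and eq: "f x = f y"
        then obtain a b where ab: "a \<in> carrier R" "b \<in> carrier R" "x = ?c a" "y = ?c b" by blast
        then show "x = y" using inj[OF ab(1,2)] eq fc by simp
      qed
      show "f ` carrier J = carrier ?Q" unfolding car carQ image_image using fc by simp
    qed
    fix x assume "x \<in> carrier J"
    then obtain a where a: "a \<in> carrier R" "x = ?c a" using car by blast
    {
      fix y assume "y \<in> carrier J"
      then obtain b where b: "b \<in> carrier R" "y = ?c b" using car by blast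
      have "x \<oplus>\<^bsub>J\<^esub> y = ?c (a \<oplus>\<^bsub>R\<^esub> b)"
        using a b e(1) by (simp add: J(2) FactRing_def I.a_rcos_sum R.l_distr)
      then show "f (x \<oplus>\<^bsub>J\<^esub> y) = f x \<oplus>\<^bsub>?Q\<^esub> f y"
        using a b g by (simp add: fc quot_module_def K.a_rcos_sum smult_closed smult_l_distr)
    }
  next
    fix r x assume r: "r \<in> carrier R" and "x \<in> carrier J"
    then obtain a where a: "a \<in> carrier R" "x = ?c a" using car by blast
    have "r \<odot>\<^bsub>J\<^esub> x = ?c (r \<otimes>\<^bsub>R\<^esub> a)"
      using a r e(1) by (simp add: J(3) FactRing_def I.rcoset_mult_add R.m_assoc)
    then show "f (r \<odot>\<^bsub>J\<^esub> x) = r \<odot>\<^bsub>?Q\<^esub> f x"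
      using a r g by (simp add: fc quot_module_smult[OF M K] smult_closed smult_assoc1)
  qed
  moreover have "f (I +>\<^bsub>R\<^esub> e) = K +>\<^bsub>M\<^esub> g" using fc[of "\<one>\<^bsub>R\<^esub>"] e(1) g by (simp add: smult_one)
  ultimately show ?thesis by blast
qed

context array_rep
begin

lemma idem_gen_vec: "idem n l \<odot>\<^bsub>M\<^esub> gen_vec = gen_vec"
  using idem_smult[OF _ gen_vec_V, of l] l2 ln by (auto simp: gen_vec_def unit_vec_def vertices_def fun_eq_iff)

lemma complement_span_iff: "f \<in> complement_span n l T \<longleftrightarrow> (\<forall>e. e \<notin> E - T \<longrightarrow> f e = 0)"
  unfolding complement_span_def by blast

lemma unit_vec_complement: "unit_vec m v \<in> complement_span n l T \<longleftrightarrow> (m, v) \<in> E - T"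
  unfolding complement_span_iff unit_vec_def by (metis zero_neq_one)

text \<open>Entries on \<open>j\<close> are obtained from missing predecessors. The entries
  \<open>-2\<close> come last: the arrow into them may also produce the \<open>2\<close> of the next
  row, which then lies outside the subarray as well, by closure under arrows with nonzero
  scalar.\<close>

lemma complement_span_generated:
  assumes W: "grassmannian_elt n l w" and j: "j \<in> vertices n" and d: "\<not> ascent (inv_into UNIV w) j"
    and cl: "scalar_predecessor_closed n l \<alpha> \<beta> (subarray n l w)"
    and T: "submodule T PP M"
    and T': "\<And>m v. \<lbrakk>(m, v) \<in> E - subarray n l w; entry_vertex (m, v) \<noteq> j\<rbrakk> \<Longrightarrow> unit_vec m v \<in> T"
  shows "complement_span n l (subarray n l w) \<subseteq> T"
proof -
  interpret W: grassmannian_elt n l w by (rule W)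
  have pos: "unit_vec m v \<in> T" if mv: "(m, v) \<in> E - W.S" "v \<noteq> -2" for m v
  proof (cases "entry_vertex (m, v) = j")
    case True
    then obtain v' where v': "(m, v') \<in> E" "(m, v') \<notin> W.S" "h_arrow (m, v') (m, v)" "entry_vertex (m, v') \<noteq> j"
      using W.missing_predecessor[OF j d, of m v] mv by blast
    show ?thesis by (rule unit_vec_h_arrow[OF T v'(1) _ v'(3) T']) (use v' mv in auto)
  qed (use T' mv in blast)
  have "unit_vec m v \<in> T" if mv: "(m, v) \<in> E - W.S" for m v
  proof (cases "v = -2 \<and> entry_vertex (m, v) = j")
    case True
    then obtain v' where v': "(m, v') \<in> E" "(m, v') \<notin> W.S" "h_arrow (m, v') (m, v)" "entry_vertex (m, v') \<noteq> j"
      using W.missing_predecessor[OF j d, of m v] mv by blast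
    have "v' = 1 \<or> v' = -1" using v'(1,3) True mv by (auto simp: array_iff elim!: W.h_arrow_cases)
    then have va: "v_arrow (m, v') (m + 1, 2)" by (auto simp: v_arrow_def)
    have "unit_vec (m + 1) 2 \<in> T" if "(m + 1, 2) \<in> E" "scalar l \<alpha> \<beta> (m, v') (m + 1, 2) \<noteq> 0"
    proof -
      have "(m + 1, 2) \<notin> W.S" using cl v'(1,2) va that(2) unfolding scalar_predecessor_closed_def by blast
      then show ?thesis using pos that(1) by simp
    qed
    then show ?thesis by (intro unit_vec_h_arrow[OF T v'(1) _ v'(3) T']) (use v' mv in auto)
  next
    case False
    then show ?thesis using pos[OF mv] T'[OF mv] by blast
  qed
  then show ?thesis
    using submodule_span[OF T] unfolding complement_span_iff subset_iff by blast
qed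

text \<open>\<open>1 - e_j\<close> erases the coordinates on \<open>j\<close>, and away from
  \<open>j\<close> the two subarrays agree; this verifies the premises of
  \<open>ideal_prod_step\<close>.\<close>

lemma word_ideal_step:
  assumes W: "grassmannian_elt n l w" and W': "grassmannian_elt n l w'" and j: "j \<in> vertices n"
    and s: "w = simple_refl j \<circ> w'" and d: "\<not> ascent (inv_into UNIV w) j"
    and cl: "scalar_predecessor_closed n l \<alpha> \<beta> (subarray n l w)"
    and cl': "scalar_predecessor_closed n l \<alpha> \<beta> (subarray n l w')"
    and I: "ideal I PP"
    and IH: "\<And>x. x \<in> carrier PP \<Longrightarrow>
      x \<otimes>\<^bsub>PP\<^esub> idem n l \<in> I \<longleftrightarrow> x \<odot>\<^bsub>M\<^esub> gen_vec \<in> complement_span n l (subarray n l w')"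
    and x: "x \<in> carrier PP"
  shows "x \<otimes>\<^bsub>PP\<^esub> idem n l \<in> ideal_prod PP (vertex_ideal n j) I \<longleftrightarrow>
    x \<odot>\<^bsub>M\<^esub> gen_vec \<in> complement_span n l (subarray n l w)"
  unfolding vertex_ideal_def
proof (rule left_module.ideal_prod_step[OF array_left_module I])
  interpret left_module PP M by (rule array_left_module)
  let ?K' = "complement_span n l (subarray n l w') :: (entry \<Rightarrow> 'k) set"
  let ?c = "\<one>\<^bsub>PP\<^esub> \<ominus>\<^bsub>PP\<^esub> idem n j"
  have change: "e \<in> subarray n l w \<longleftrightarrow> e \<in> subarray n l w'" if "entry_vertex e \<noteq> j" for e
    using subarray_change[OF W W' j s] that by blast
  have lv: "l \<in> vertices n" using l2 ln by (simp add: vertices_def)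
  have KV: "f \<in> V" if "f \<in> ?K'" for f using that unfolding complement_span_iff array_vectors_def by blast
  show "gen_vec \<in> carrier M" using gen_vec_V by simp
  show "idem n l \<in> carrier PP" by (rule idem_closed[OF lv])
  show "idem n l \<odot>\<^bsub>M\<^esub> gen_vec = gen_vec" by (rule idem_gen_vec)
  show "\<exists>a\<in>carrier PP. a \<odot>\<^bsub>M\<^esub> gen_vec = f" if "f \<in> carrier M" for f using gen_vec_orbit that by simp
  show "a \<otimes>\<^bsub>PP\<^esub> idem n l = \<zero>\<^bsub>PP\<^esub>" if "a \<in> carrier PP" "a \<odot>\<^bsub>M\<^esub> gen_vec = \<zero>\<^bsub>M\<^esub>" for a
    by (rule gen_vec_faithful[OF that])
  show "submodule ?K' PP M" by (rule complement_span_submodule[OF cl'])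
  show "submodule (complement_span n l (subarray n l w)) PP M" by (rule complement_span_submodule[OF cl])
  show "?c \<in> carrier PP" using idem_closed[OF j] by simp
  show "?c \<odot>\<^bsub>M\<^esub> f \<in> complement_span n l (subarray n l w)" if f: "f \<in> ?K'" for f
    unfolding co_idem_smult[OF j KV[OF f]] complement_span_iff
  proof (intro allI impI)
    fix e assume "e \<notin> E - subarray n l w"
    then have "entry_vertex e \<noteq> j \<Longrightarrow> e \<notin> E - subarray n l w'" using change by blast
    then have "entry_vertex e \<noteq> j \<Longrightarrow> f e = 0" using f unfolding complement_span_iff by blast
    then show "(if entry_vertex e = j then 0 else f e) = 0" by simp
  qed
  show "complement_span n l (subarray n l w) \<subseteq> T" if T: "submodule T PP M" "\<And>f. f \<in> ?K' \<Longrightarrow> ?c \<odot>\<^bsub>M\<^esub> f \<in> T" for T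
  proof (rule complement_span_generated[OF W j d cl T(1)])
    fix m v assume mv: "(m, v) \<in> E - subarray n l w" "entry_vertex (m, v) \<noteq> j"
    then have u: "unit_vec m v \<in> ?K'" using change[of "(m, v)"] by (simp add: unit_vec_complement)
    have "?c \<odot>\<^bsub>M\<^esub> unit_vec m v = unit_vec m v"
      unfolding co_idem_smult[OF j KV[OF u]] using mv(2) by (auto simp: unit_vec_def fun_eq_iff)
    then show "unit_vec m v \<in> T" using T(2)[OF u] by simp
  qed
qed (use IH x in auto)

end

lemma word_ideal_ideal:
  assumes "4 \<le> n" "set js \<subseteq> vertices n"
  shows "ideal (word_ideal n js) (preproj n :: (path \<Rightarrow> 'k::field) set ring)"
proof -
  interpret R: ring "preproj n :: (path \<Rightarrow> 'k) set ring" by (rule preproj_ring[OF assms(1)])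
  show ?thesis using assms(2)
  proof (induction js)
    case (Cons j js)
    have "idem n j \<in> carrier (preproj n :: (path \<Rightarrow> 'k) set ring)"
      using Cons.prems by (auto simp: idem_def preproj_def FactRing_def A_RCOSETS_def' intro!: path_elt_closed)
    then have "ideal (vertex_ideal n j) (preproj n :: (path \<Rightarrow> 'k) set ring)"
      unfolding vertex_ideal_def by (intro R.genideal_ideal) simp
    then show ?case using Cons R.ideal_prod_is_ideal by (simp add: word_ideal_def)
  qed (simp add: word_ideal_def R.oneideal)
qed

text \<open>The scalars are generalised in the induction, because the step may have to use other
  scalars for the suffix. For the empty word the subarray is empty, since
  \<open>id (m + 1) > m\<close>.\<close>

lemma word_ideal_preimage:
  fixes \<alpha> \<beta> :: "'k::field"
  assumes n: "4 \<le> n" and l: "2 \<le> l" "l \<le> n - 1"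
    and red: "reduced_word n js w" and gr: "grassmannian n l w"
    and \<alpha>\<beta>: "\<alpha> + \<beta> = 1" and cl: "scalar_predecessor_closed n l \<alpha> \<beta> (subarray n l w)"
    and x: "x \<in> carrier (preproj n)"
  shows "x \<otimes>\<^bsub>preproj n\<^esub> idem n l \<in> word_ideal n js \<longleftrightarrow>
    x \<odot>\<^bsub>array_module n l \<alpha> \<beta>\<^esub> array_rep.gen_vec l \<in> complement_span n l (subarray n l w)"
  using red gr \<alpha>\<beta> cl x
proof (induction js arbitrary: w \<alpha> \<beta> x)
  case Nil
  interpret L: array_rep n l \<alpha> \<beta> by unfold_locales (use n l Nil in auto)
  interpret left_module "preproj n" "array_module n l \<alpha> \<beta>" by (rule L.array_left_module)
  interpret W: grassmannian_elt n l w by unfold_locales (use n l Nil in auto)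
  have "w = id" using Nil(1) by (simp add: reduced_word_def)
  then have "(m, v) \<notin> subarray n l w" for m v using W.subarray_iff[of m v] W.l2 by auto
  then have "subarray n l w = {}" by auto
  then have "complement_span n l (subarray n l w) = (L.V)"
    by (simp add: complement_span_def array_vectors_def)
  moreover have "x \<odot>\<^bsub>array_module n l \<alpha> \<beta>\<^esub> L.gen_vec \<in> L.V"
    using smult_closed[OF Nil(5)] L.gen_vec_V by simp
  moreover have "x \<otimes>\<^bsub>preproj n\<^esub> idem n l \<in> word_ideal n []"
    using Nil(5) L.idem_closed[of l] l by (simp add: word_ideal_def vertices_def)
  ultimately show ?case by simp
next
  case (Cons j js)
  have n2: "2 \<le> n" using n by simp
  let ?w' = "word_prod js"
  note red' = left_descent_of_reduced_word[OF n2 Cons.prems(1)]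
  have gr': "grassmannian n l ?w'" by (rule grassmannian_left_factor[OF n2 Cons.prems(1,2)])
  have j: "j \<in> vertices n" and js: "set js \<subseteq> vertices n" and w: "w = simple_refl j \<circ> ?w'"
    using Cons.prems(1) by (auto simp: reduced_word_def)
  have W: "grassmannian_elt n l w" and W': "grassmannian_elt n l ?w'"
    by (unfold_locales; use n l Cons.prems(2) gr' in auto)+
  interpret W: grassmannian_elt n l w by (rule W)
  interpret W': grassmannian_elt n l ?w' by (rule W')
  have I: "ideal (word_ideal n js) (preproj n :: (path \<Rightarrow> 'k) set ring)" by (rule word_ideal_ideal[OF n js])
  have step: "x \<otimes>\<^bsub>preproj n\<^esub> idem n l \<in> word_ideal n (j # js) \<longleftrightarrow>
      x \<odot>\<^bsub>array_module n l a b\<^esub> array_rep.gen_vec l \<in> complement_span n l (subarray n l w)"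
    if ab: "a + b = 1" "scalar_predecessor_closed n l a b (subarray n l w)"
      "scalar_predecessor_closed n l a b (subarray n l ?w')" for a b :: 'k
  proof -
    have L: "array_rep n l a b" by unfold_locales (use n l ab in auto)
    show ?thesis
      using array_rep.word_ideal_step[OF L W W' j w red'(3) ab(2,3) I Cons.IH[OF red'(1) gr' ab(1,3)] Cons.prems(5)]
      by (simp add: word_ideal_def)
  qed
  show ?case
  proof (cases "\<exists>m. W.bad m")
    case True
    then obtain m where m: "W.bad m" ..
    have "scalar_predecessor_closed n l \<alpha> \<beta> (subarray n l ?w')"
      unfolding W'.scalar_closed_iff
    proof (intro allI impI)
      fix m' assume "W'.bad m'"
      then have "W.alpha_type m = W'.alpha_type m'" by (rule alpha_type_change[OF W W' j w m])
      moreover have "(if W.alpha_type m then \<alpha> else \<beta>) = 0" using Cons.prems(4) m unfolding W.scalar_closed_iff by blast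
      ultimately show "(if W'.alpha_type m' then \<alpha> else \<beta>) = 0" by simp
    qed
    then show ?thesis by (rule step[OF Cons.prems(3,4)])
  next
    case False
    then have cl: "scalar_predecessor_closed n l a b (subarray n l w)" for a b :: 'k by (simp add: W.scalar_closed_iff)
    \<comment> \<open>Scalars admissible for the suffix; the base change then leads back to the
      given ones, in both directions.\<close>
    have "\<exists>a b :: 'k. a + b = 1 \<and> scalar_predecessor_closed n l a b (subarray n l ?w')"
    proof (rule W'.scalar_closed_choice[where 'k = 'k])
      assume "scalar_predecessor_closed n l (1 :: 'k) 0 (subarray n l ?w')"
      then show ?thesis by (intro exI[of _ 1] exI[of _ 0]) simp
    next
      assume "scalar_predecessor_closed n l (0 :: 'k) 1 (subarray n l ?w')"
      then show ?thesis by (intro exI[of _ 0] exI[of _ 1]) simp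
    qed
    then obtain a b :: 'k where ab: "a + b = 1" "scalar_predecessor_closed n l a b (subarray n l ?w')" by blast
    have L: "array_rep n l \<alpha> \<beta>" "array_rep n l a b" by (unfold_locales; use n l ab Cons.prems(3) in auto)+
    have diag: "False" if "l \<le> m" "2 \<le> k" "(m, - k) \<notin> W.S" "(m + k - 1, k) \<in> W.S" for m k
      using W.antidiagonal[OF _ that] False by blast
    show ?thesis
      unfolding step[OF ab(1) cl ab(2)]
    proof
      assume h: "x \<odot>\<^bsub>array_module n l a b\<^esub> array_rep.gen_vec l \<in> complement_span n l W.S"
      show "x \<odot>\<^bsub>array_module n l \<alpha> \<beta>\<^esub> array_rep.gen_vec l \<in> complement_span n l W.S"
        by (rule complement_span_independent[OF L(2,1) _ Cons.prems(5) h]) (rule diag)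
    next
      assume h: "x \<odot>\<^bsub>array_module n l \<alpha> \<beta>\<^esub> array_rep.gen_vec l \<in> complement_span n l W.S"
      show "x \<odot>\<^bsub>array_module n l a b\<^esub> array_rep.gen_vec l \<in> complement_span n l W.S"
        by (rule complement_span_independent[OF L(1,2) _ Cons.prems(5) h]) (rule diag)
    qed
  qed
qed

text \<open>Preservation of the generators pins down the isomorphism: it is the canonical one
  between two quotients of \<open>P_l\<close>.\<close>

theorem theorem6p12:
  fixes n l :: int and w :: "int \<Rightarrow> int"
  assumes "4 \<le> n" and "2 \<le> l" and "l \<le> n - 1"
    and "join_irreducible n w" and "of_type n l w"
  shows "(\<not> {1, 2} \<subseteq> (\<lambda>m. \<bar>w m\<bar>) ` {l+1..n} \<longrightarrow> predecessor_closed n l (subarray n l w)) \<and>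
    ({1, 2} \<subseteq> (\<lambda>m. \<bar>w m\<bar>) ` {l+1..n} \<longrightarrow>
       scalar_predecessor_closed n l (1::'k::field) 0 (subarray n l w) \<or>
       scalar_predecessor_closed n l (0::'k) 1 (subarray n l w)) \<and>
    (\<exists>\<alpha> \<beta> :: 'k. \<alpha> + \<beta> = 1 \<and> scalar_predecessor_closed n l \<alpha> \<beta> (subarray n l w)) \<and>
    (\<forall>\<alpha> \<beta> :: 'k. \<alpha> + \<beta> = 1 \<and> scalar_predecessor_closed n l \<alpha> \<beta> (subarray n l w) \<longrightarrow>
       left_module (preproj n) (array_module n l \<alpha> \<beta>) \<and>
       submodule (complement_span n l (subarray n l w)) (preproj n) (array_module n l \<alpha> \<beta>) \<and>
       left_module (preproj n) (factor_module n l \<alpha> \<beta> (subarray n l w)) \<and>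
       (\<forall>js. reduced_word n js w \<longrightarrow>
         (\<exists>f. left_module_iso (preproj n) (J_module n js l)
                (factor_module n l \<alpha> \<beta> (subarray n l w)) f \<and>
              f (J_gen n js l) = factor_gen n l \<alpha> \<beta> (subarray n l w))))"
proof -
  have lv: "l \<in> vertices n" using assms(2,3) by (simp add: vertices_def)
  have gr: "grassmannian n l w"
    using assms by (intro join_irreducible_grassmannian lv) auto
  interpret W: grassmannian_elt n l w by unfold_locales (use assms gr in auto)
  have choice: "scalar_predecessor_closed n l (1::'k) 0 (subarray n l w) \<or> scalar_predecessor_closed n l (0::'k) 1 (subarray n l w)"
    by (rule W.scalar_closed_choice[where 'k = 'k]; blast)
  have main: "left_module (preproj n) (array_module n l \<alpha> \<beta>) \<and>
       submodule (complement_span n l (subarray n l w)) (preproj n) (array_module n l \<alpha> \<beta>) \<and>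
       left_module (preproj n) (factor_module n l \<alpha> \<beta> (subarray n l w)) \<and>
       (\<forall>js. reduced_word n js w \<longrightarrow>
         (\<exists>f. left_module_iso (preproj n) (J_module n js l)
                (factor_module n l \<alpha> \<beta> (subarray n l w)) f \<and>
              f (J_gen n js l) = factor_gen n l \<alpha> \<beta> (subarray n l w)))"
    if ab: "\<alpha> + \<beta> = 1" "scalar_predecessor_closed n l \<alpha> \<beta> (subarray n l w)" for \<alpha> \<beta> :: 'k
  proof (intro conjI allI impI)
    interpret L: array_rep n l \<alpha> \<beta> by unfold_locales (use assms ab in auto)
    show M: "left_module (preproj n) (array_module n l \<alpha> \<beta>)" by (rule L.array_left_module)
    show K: "submodule (complement_span n l (subarray n l w)) (preproj n) (array_module n l \<alpha> \<beta>)"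
      by (rule L.complement_span_submodule[OF ab(2)])
    show "left_module (preproj n) (factor_module n l \<alpha> \<beta> (subarray n l w))"
      unfolding factor_module_def by (rule quot_module_left_module[OF M K])
    fix js assume red: "reduced_word n js w"
    then have js: "set js \<subseteq> vertices n" by (simp add: reduced_word_def)
    have "\<exists>f. left_module_iso (preproj n) (J_module n js l)
        (quot_module (array_module n l \<alpha> \<beta>) (complement_span n l (subarray n l w))) f \<and>
        f (word_ideal n js +>\<^bsub>preproj n\<^esub> idem n l) = complement_span n l (subarray n l w) +>\<^bsub>array_module n l \<alpha> \<beta>\<^esub> L.gen_vec"
    proof (rule quotient_iso[OF M word_ideal_ideal[OF assms(1) js] K _ L.idem_closed[OF lv] L.idem_gen_vec])
      show "L.gen_vec \<in> carrier (array_module n l \<alpha> \<beta>)" using L.gen_vec_V by simp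
      show "\<exists>a\<in>carrier (preproj n). a \<odot>\<^bsub>array_module n l \<alpha> \<beta>\<^esub> L.gen_vec = x"
        if "x \<in> carrier (array_module n l \<alpha> \<beta>)" for x using L.gen_vec_orbit that by simp
      show "a \<otimes>\<^bsub>preproj n\<^esub> idem n l \<in> word_ideal n js \<longleftrightarrow>
          a \<odot>\<^bsub>array_module n l \<alpha> \<beta>\<^esub> L.gen_vec \<in> complement_span n l (subarray n l w)"
        if "a \<in> carrier (preproj n)" for a
        by (rule word_ideal_preimage[OF assms(1-3) red gr ab that])
    qed (simp_all only: J_module_def Let_def partial_object.simps ring.simps module.simps)
    moreover have "L.gen_vec = (\<lambda>e. if e = (l, l) then 1 else 0)"
      by (simp add: L.gen_vec_def L.unit_vec_def)
    ultimately show "\<exists>f. left_module_iso (preproj n) (J_module n js l)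
                (factor_module n l \<alpha> \<beta> (subarray n l w)) f \<and>
              f (J_gen n js l) = factor_gen n l \<alpha> \<beta> (subarray n l w)"
      unfolding factor_module_def factor_gen_def J_gen_def by (simp only:)
  qed
  have pred: "\<not> {1, 2} \<subseteq> (\<lambda>m. \<bar>w m\<bar>) ` {l+1..n} \<longrightarrow> predecessor_closed n l (subarray n l w)"
    using W.bad_iff by (metis W.predecessor_closed_if)
  have ex: "\<exists>\<alpha> \<beta> :: 'k. \<alpha> + \<beta> = 1 \<and> scalar_predecessor_closed n l \<alpha> \<beta> (subarray n l w)"
    using choice
  proof
    assume "scalar_predecessor_closed n l (1::'k) 0 (subarray n l w)"
    then show ?thesis by (intro exI[of _ 1] exI[of _ 0]) simp
  next
    assume "scalar_predecessor_closed n l (0::'k) 1 (subarray n l w)"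
    then show ?thesis by (intro exI[of _ 0] exI[of _ 1]) simp
  qed
  show ?thesis
    by (intro conjI pred impI choice ex) (intro allI impI, elim conjE, rule main, assumption+)
qed

end
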